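(* Let $\Omega\subset\mathbb{R}^n$ be open and bounded, let $d:=\dim_b(\partial\Omega)$, and assume $n-1\le d<n$. Let $\alpha\in\left(\frac{d}{n},1\right]$ and let $\{v_k\}\subset C^{0,\alpha}(\Omega,\mathbb{R}^n)$ be a bounded sequence (in $C^{0,\alpha}$) converging uniformly to $v$. Then, for every pair $(\beta,p)$ with $p\ge1$ and $0\le\beta<\frac{n}{p}-\frac{d}{\alpha}$, the sequence $\deg(v_k,\Omega,\cdot)$ converges to $\deg(v,\Omega,\cdot)$ strongly in $W^{\beta,p}(\mathbb{R}^n)$.
   Context: $n$ is a positive integer. $\dim_b$ is the box counting (Minkowski) dimension: $\dim_b(K)=\limsup_{\varepsilon\to0}\frac{\log N_\varepsilon(K)}{\log(1/\varepsilon)}$, where $N_\varepsilon(K)$ is the minimal number of balls of radius $\varepsilon$ covering the bounded set $K$ (it is the limit whenever the limit exists). $C^{0,\alpha}(\Omega,\mathbb{R}^n)$ is the space of Hölder maps with norm $\|v\|_{C^{0,\alpha}}=\sup_\Omega|v|+\sup_{x\ne y\in\Omega}\frac{|v(x)-v(y)|}{|x-y|^\alpha}$. Such maps extend uniquely to continuous maps on $\overline\Omega$, denoted the same way, and $\deg(v,\Omega,y)$ is the Brouwer degree, defined for $y\in\mathbb{R}^n\setminus v(\partial\Omega)$ (it vanishes for $y\notin v(\overline\Omega)$). Under the hypotheses here $v(\partial\Omega)$ is Lebesgue-null, so $\deg(v,\Omega,\cdot)$ is regarded as an a.e. defined function on $\mathbb{R}^n$. $W^{0,p}=L^p(\mathbb{R}^n)$;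 for $0<\beta<1$, $W^{\beta,p}(\mathbb{R}^n)$ is the fractional Sobolev space with norm $\|f\|_{L^p}+[f]_{W^{\beta,p}}$, where $[f]_{W^{\beta,p}}=\left(\int_{\mathbb{R}^n}\int_{\mathbb{R}^n}\frac{|f(x)-f(y)|^p}{|x-y|^{n+\beta p}}\,dx\,dy\right)^{1/p}$. (In the stated range one always has $\beta<1$.) *)

theory Defs
  imports "HOL-Analysis.Analysis"
begin

section \<open>Box counting dimension\<close>

text \<open>The centres of the balls need not lie in \<open>K\<close>.\<close>

definition covering_number :: "real \<Rightarrow> 'a::metric_space set \<Rightarrow> nat" where
  "covering_number \<epsilon> K = (LEAST m. \<exists>C. finite C \<and> card C = m \<and> K \<subseteq> (\<Union>c\<in>C. ball c \<epsilon>))"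

text \<open>Meant for bounded subsets of Euclidean spaces, where the covering numbers are finite.
  Since \<open>ln 0 = 0\<close>, the empty set gets dimension \<open>0\<close>.\<close>

definition box_dim :: "'a::metric_space set \<Rightarrow> ereal" where
  "box_dim K = Limsup (at_right 0)
     (\<lambda>\<epsilon>. ereal (ln (real (covering_number \<epsilon> K)) / ln (1 / \<epsilon>)))"


section \<open>Hoelder maps\<close>

definition holder_norm ::
    "real \<Rightarrow> 'a::real_normed_vector set \<Rightarrow> ('a \<Rightarrow> 'b::real_normed_vector) \<Rightarrow> ennreal" where
  "holder_norm \<alpha> \<Omega> v =
     (SUP x\<in>\<Omega>. ennreal (norm (v x))) +
     (SUP (x, y)\<in>{(x, y). x \<in> \<Omega> \<and> y \<in> \<Omega> \<and> x \<noteq> y}.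
        ennreal (norm (v x - v y) / norm (x - y) powr \<alpha>))"

definition holder_space ::
    "real \<Rightarrow> 'a::real_normed_vector set \<Rightarrow> ('a \<Rightarrow> 'b::real_normed_vector) set" where
  "holder_space \<alpha> \<Omega> = {v. holder_norm \<alpha> \<Omega> v < \<infinity>}"

text \<open>The continuous extension to \<open>closure \<Omega>\<close> of a uniformly continuous map on an open
  set \<open>\<Omega>\<close>; only the values of \<open>v\<close> on \<open>\<Omega>\<close> are used.\<close>

definition closure_extension ::
    "'a::metric_space set \<Rightarrow> ('a \<Rightarrow> 'b::metric_space) \<Rightarrow> 'a \<Rightarrow> 'b" where
  "closure_extension \<Omega> v x = (if x \<in> \<Omega> then v x else Lim (at x within \<Omega>) v)"


section \<open>Brouwer degree\<close>

text \<open>A map is of class \<open>C^(k+1)\<close> if it is differentiable and its partial derivatives are of class \<open>C^k\<close>.\<close>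

primrec C_on_space :: "nat \<Rightarrow> ('a::euclidean_space \<Rightarrow> 'b::euclidean_space) \<Rightarrow> bool" where
  "C_on_space 0 f \<longleftrightarrow> continuous_on UNIV f"
| "C_on_space (Suc k) f \<longleftrightarrow> (\<forall>x. f differentiable at x) \<and>
     (\<forall>b\<in>Basis. C_on_space k (\<lambda>x. frechet_derivative f (at x) b))"

definition smooth_map :: "('a::euclidean_space \<Rightarrow> 'b::euclidean_space) \<Rightarrow> bool" where
  "smooth_map f \<longleftrightarrow> (\<forall>k. C_on_space k f)"

definition regular_value_on ::
    "(real^'n \<Rightarrow> real^'n) \<Rightarrow> (real^'n) set \<Rightarrow> real^'n \<Rightarrow> bool" where
  "regular_value_on w \<Omega> y \<longleftrightarrow> (\<forall>x\<in>\<Omega>. w x = y \<longrightarrow> det (jacobian w (at x)) \<noteq> 0)"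

definition signed_count ::
    "(real^'n \<Rightarrow> real^'n) \<Rightarrow> (real^'n) set \<Rightarrow> real^'n \<Rightarrow> real" where
  "signed_count w \<Omega> y = (\<Sum>x\<in>{x \<in> \<Omega>. w x = y}. sgn (det (jacobian w (at x))))"

text \<open>For a bounded open set \<open>\<Omega>\<close>, a map \<open>v\<close> that is continuous on \<open>closure \<Omega>\<close> and
  \<open>y \<notin> v ` frontier \<Omega>\<close>, the degree is the signed number of preimages of \<open>y\<close> under any smooth
  map \<open>w\<close> that has \<open>y\<close> as a regular value and satisfies
  \<open>sup {norm (w x - v x) | x \<in> closure \<Omega>} < dist (y, v (frontier \<Omega>))\<close>. By compactness this
  strict inequality is equivalent to the pointwise condition below, which for \<open>\<Omega> = {}\<close> holds
  vacuously. On \<open>v ` frontier \<Omega>\<close>, where the degree is not defined, the value is \<open>0\<close>.\<close>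

definition brouwer_degree ::
    "(real^'n \<Rightarrow> real^'n) \<Rightarrow> (real^'n) set \<Rightarrow> real^'n \<Rightarrow> int" where
  "brouwer_degree v \<Omega> y =
     (if y \<in> v ` frontier \<Omega> then 0
      else (THE m. \<exists>w. smooth_map w \<and> regular_value_on w \<Omega> y \<and>
              (\<forall>x\<in>closure \<Omega>. \<forall>z\<in>frontier \<Omega>. norm (w x - v x) < dist y (v z)) \<and>
              of_int m = signed_count w \<Omega> y))"


section \<open>Fractional Sobolev spaces\<close>

definition ennreal_rpow :: "ennreal \<Rightarrow> real \<Rightarrow> ennreal" where
  "ennreal_rpow a r = (if a = \<infinity> then \<infinity> else ennreal (enn2real a powr r))"

definition Lp_norm :: "real \<Rightarrow> (real^'n \<Rightarrow> real) \<Rightarrow> ennreal" where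
  "Lp_norm p f = ennreal_rpow (\<integral>\<^sup>+x. ennreal (\<bar>f x\<bar> powr p) \<partial>lebesgue) (1 / p)"

definition gagliardo_seminorm :: "real \<Rightarrow> real \<Rightarrow> (real^'n \<Rightarrow> real) \<Rightarrow> ennreal" where
  "gagliardo_seminorm \<beta> p f =
     ennreal_rpow
       (\<integral>\<^sup>+x. \<integral>\<^sup>+y. ennreal (\<bar>f x - f y\<bar> powr p / norm (x - y) powr (real CARD('n) + \<beta> * p))
          \<partial>lebesgue \<partial>lebesgue)
       (1 / p)"

text \<open>For \<open>0 \<le> \<beta> < 1\<close> and \<open>1 \<le> p < \<infinity>\<close>. Functions are not identified up to null sets; all notions
  below are invariant under changes on null sets.\<close>

definition sobolev_norm :: "real \<Rightarrow> real \<Rightarrow> (real^'n \<Rightarrow> real) \<Rightarrow> ennreal" where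
  "sobolev_norm \<beta> p f = Lp_norm p f + (if \<beta> = 0 then 0 else gagliardo_seminorm \<beta> p f)"

definition sobolev_space :: "real \<Rightarrow> real \<Rightarrow> (real^'n \<Rightarrow> real) set" where
  "sobolev_space \<beta> p = {f \<in> borel_measurable lebesgue. sobolev_norm \<beta> p f < \<infinity>}"

definition sobolev_tendsto ::
    "real \<Rightarrow> real \<Rightarrow> (nat \<Rightarrow> real^'n \<Rightarrow> real) \<Rightarrow> (real^'n \<Rightarrow> real) \<Rightarrow> bool" where
  "sobolev_tendsto \<beta> p f g \<longleftrightarrow>
     (\<forall>k. f k \<in> sobolev_space \<beta> p) \<and> g \<in> sobolev_space \<beta> p \<and>
     (\<lambda>k. sobolev_norm \<beta> p (\<lambda>x. f k x - g x)) \<longlonglongrightarrow> 0"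

end

theory Submission
  imports Defs "HOL-Computational_Algebra.Polynomial"
begin

text \<open>Let \<open>V\<close> be a Hoelder extension of \<open>v\<close> to the whole space, \<open>u\<^sub>j\<close> its smooth interpolation on a
  cubical grid of mesh \<open>\<epsilon>\<^sub>j = 2 powr (- j)\<close>, and \<open>\<Phi>\<^sub>j\<close> a smooth step map of width \<open>\<delta>\<^sub>j\<close>, comparable to
  \<open>\<epsilon>\<^sub>j powr \<alpha>\<close>, whose Jacobian is a bump of mass one. Then \<open>F\<^sub>j(y) = \<integral>\<^sub>\<Omega> det D(\<Phi>\<^sub>j(u\<^sub>j - y))\<close> is a
  mollified degree, and \<open>F\<^sub>j(y) = deg(v,\<Omega>,y)\<close> for almost every \<open>y\<close> and all large \<open>j\<close>. Since \<open>det\<close> is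
  a null Lagrangian, the map for \<open>j + 1\<close> may be replaced by that for \<open>j\<close> away from a layer of width
  comparable to \<open>\<epsilon>\<^sub>j\<close> at the boundary, so \<open>F\<^sub>j\<^sub>+\<^sub>1 - F\<^sub>j\<close> is the integral over this layer of bumps in \<open>y\<close> of
  height \<open>\<epsilon>\<^sub>j powr (- n)\<close> and width \<open>\<delta>\<^sub>j\<close>. The layer has measure at most \<open>\<epsilon>\<^sub>j powr (n - d')\<close> for \<open>d' > d\<close>,
  whence the \<open>W\<^sup>\<beta>\<^sup>,\<^sup>p\<close> norm of \<open>F\<^sub>j\<^sub>+\<^sub>1 - F\<^sub>j\<close> is at most a multiple of \<open>\<epsilon>\<^sub>j powr (\<alpha> * (n/p - \<beta>) - d')\<close>.
  This is summable, with constants that depend only on the Hoelder bound; and for fixed \<open>j\<close> the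
  function \<open>F\<^sub>j\<close> depends continuously on \<open>v\<close> in the uniform norm.\<close>

subsection \<open>Determinants of perturbed identities\<close>

text \<open>A Hoelder map need not have a Jacobian, and that of \<open>u\<^sub>j\<close> may grow
  like \<open>\<epsilon>\<^sub>j powr (\<alpha> - 1)\<close>. Taking the step width comparable to
  the interpolation error compensates for this: composing with the step multiplies the Jacobian by a
  factor of order \<open>1 / \<delta>\<^sub>j\<close>, so its entries are of order
  \<open>1 / \<epsilon>\<^sub>j\<close>. Moreover, once \<open>y\<close> is a few widths away,
  consecutive interpolants lie on the same side of the step in some coordinate. Two such maps can be
  blended by a scalar cutoff at no cost: one row of the Jacobian of the blend vanishes, whatever the
  gradient of the cutoff is. The same device, in many small steps, links \<open>u\<^sub>j\<close> to
  every smooth map admissible in the definition of the degree; for almost every \<open>y\<close>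
  this also shows that the defining count does not depend on the smooth map. The exponent arises
  because a bump of height 1 and width \<delta> has a norm of order
  \<open>\<delta> powr (n/p - \<beta>)\<close>. The null Lagrangian identity is derived for C^1 maps
  from volumes of images, without second derivatives.\<close>

lemma norm_le_card_bound:
  fixes z :: "real^'n" assumes "\<And>i. \<bar>z $ i\<bar> \<le> t" shows "norm z \<le> real CARD('n) * t"
proof -
  have "(\<Sum>i\<in>UNIV. \<bar>z $ i\<bar>) \<le> (\<Sum>i\<in>(UNIV::'n set). t)" using assms by (intro sum_mono)
  then show ?thesis using norm_le_l1_cart[of z] by simp
qed

text \<open>Lagrange interpolation at the nodes \<open>X\<close>: \<open>c x\<close> is the value at
  0 of the basis polynomial of \<open>x\<close>, so the weights do not depend on
  \<open>q\<close>.\<close>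

lemma poly_extrapolation:
  fixes X :: "real set"
  assumes "finite X"
  obtains c where "\<And>q. degree q < card X \<Longrightarrow> poly q 0 = (\<Sum>x\<in>X. c x * poly q x)"
proof
  define L where "L x = (\<Prod>y\<in>X - {x}. smult (1 / (x - y)) [:- y, 1:])" for x
  fix q :: "real poly" assume q: "degree q < card X"
  define r where "r = (\<Sum>x\<in>X. smult (poly q x) (L x))"
  have L: "poly (L x) y = (if x = y then 1 else 0)" if "x \<in> X" "y \<in> X" for x y
  proof (cases "x = y")
    case True
    then show ?thesis by (auto simp: L_def poly_prod divide_simps intro!: prod.neutral)
  next
    case False
    then show ?thesis using that assms
      by (auto simp: L_def poly_prod intro!: prod_zero bexI[of _ y])
  qed
  have dL: "degree (L x) \<le> card X - 1" if "x \<in> X" for x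
  proof -
    have "degree (L x) \<le> (\<Sum>y\<in>X - {x}. degree (smult (1 / (x - y)) [:- y, 1:]))"
      unfolding L_def using assms
      by (metis (no_types, lifting) degree_prod_sum_le comp_def finite_Diff sum.cong)
    also have "\<dots> \<le> (\<Sum>y\<in>X - {x}. 1)"
      by (intro sum_mono order.trans[OF degree_smult_le]) auto
    finally show ?thesis using that assms by simp
  qed
  have X: "card X > 0" using q by simp
  have "degree r \<le> card X - 1"
    unfolding r_def
    by (intro degree_sum_le assms) (meson dL degree_smult_le le_trans)
  with X have dr: "degree r < card X" by linarith
  have "poly q y = poly r y" if "y \<in> X" for y
  proof -
    have "poly r y = (\<Sum>x\<in>X. poly q x * (if x = y then 1 else 0))"
      unfolding r_def poly_sum by (intro sum.cong) (use L that in auto)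
    also have "\<dots> = (\<Sum>x\<in>X. if x = y then poly q x else 0)" by (intro sum.cong) auto
    finally show ?thesis using that assms by simp
  qed
  then have "q = r" using poly_eqI_degree q dr by blast
  then have "poly q 0 = poly r 0" by simp
  then show "poly q 0 = (\<Sum>x\<in>X. poly (L x) 0 * poly q x)"
    by (simp add: r_def poly_sum mult.commute)
qed

text \<open>In the Leibniz formula every factor is a polynomial of degree at most one in
  \<open>t\<close>, and each product has \<open>CARD('n)\<close> factors.\<close>

lemma det_add_mat_poly:
  fixes A :: "real^'n^'n"
  obtains q where "degree q \<le> CARD('n)" "\<And>t. poly q t = det (A + mat t)"
proof
  define q where "q = (\<Sum>p\<in>{p. p permutes (UNIV::'n set)}.
      smult (of_int (sign p)) (\<Prod>i\<in>UNIV. [:A$i$p i, if i = p i then 1 else 0:]))"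
  show "poly q t = det (A + mat t)" for t
    unfolding q_def det_def poly_sum
    by (intro sum.cong) (auto simp: poly_prod mat_def intro!: prod.cong)
  have "degree (\<Prod>i\<in>UNIV. [:A$i$p i, if i = p i then 1 else 0:]) \<le> CARD('n)" for p
  proof -
    have "degree (\<Prod>i\<in>UNIV. [:A$i$p i, if i = p i then 1 else 0:])
        \<le> (\<Sum>i\<in>(UNIV::'n set). degree [:A$i$p i, if i = p i then 1 else 0:])"
      using degree_prod_sum_le[of "UNIV::'n set" "\<lambda>i. [:A$i$p i, if i = p i then 1 else 0:]"]
      unfolding comp_def by simp
    also have "\<dots> \<le> (\<Sum>i\<in>(UNIV::'n set). 1)" by (intro sum_mono) auto
    finally show ?thesis by simp
  qed
  then show "degree q \<le> CARD('n)"
    unfolding q_def by (intro degree_sum_le) (auto intro: order.trans[OF degree_smult_le])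
qed

text \<open>Determinants are recovered from those of large multiples of the identity plus the matrix.\<close>

lemma det_extrapolation:
  fixes L :: real
  obtains T c where "finite T" "\<And>t. t \<in> T \<Longrightarrow> t > L"
    "\<And>A::real^'n^'n. det A = (\<Sum>t\<in>T. c t * det (A + mat t))"
proof -
  \<comment> \<open>One node more than the degree bound of \<open>det_add_mat_poly\<close>; starting
    at \<open>\<bar>L\<bar> + 1\<close> keeps all nodes above \<open>L\<close> for either sign of
    \<open>L\<close>.\<close>
  define T where "T = (\<lambda>i. \<bar>L\<bar> + 1 + real i) ` {..CARD('n)}"
  have T: "finite T" "card T = CARD('n) + 1"
    unfolding T_def by (auto simp: card_image inj_on_def)
  obtain c where c: "\<And>q. degree q < card T \<Longrightarrow> poly q 0 = (\<Sum>x\<in>T. c x * poly q x)"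
    using poly_extrapolation[OF T(1)] by blast
  have "det A = (\<Sum>t\<in>T. c t * det (A + mat t))" for A :: "real^'n^'n"
  proof -
    obtain q where q: "degree q \<le> CARD('n)" "\<And>t. poly q t = det (A + mat t)"
      using det_add_mat_poly[of A] by blast
    have "A + mat 0 = A" by (simp add: mat_def vec_eq_iff)
    then show ?thesis using c[of q] q T by simp
  qed
  moreover have "t > L" if "t \<in> T" for t using that by (auto simp: T_def)
  ultimately show ?thesis using that T by blast
qed

lemma mat_vector_mult: "mat t *v h = t *\<^sub>R (h :: real^'n)"
proof -
  have "(\<Sum>j\<in>UNIV. (if i = j then t else 0) * h $ j) = (\<Sum>j\<in>UNIV. if i = j then t * h $ j else 0)" for i
    by (intro sum.cong) auto
  then show ?thesis by (simp add: vec_eq_iff matrix_vector_mult_def mat_def)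
qed

text \<open>Along \<open>s *\<^sub>R A + mat t\<close> with \<open>s\<close> from 0 to 1 the
  determinant starts at \<open>t ^ CARD('n)\<close> and cannot vanish: a kernel vector
  \<open>h\<close> would give \<open>t * norm h \<le> L * norm h\<close>. The intermediate value
  theorem then fixes the sign.\<close>

lemma det_add_mat_pos:
  fixes A :: "real^'n^'n"
  assumes A: "\<And>h. norm (A *v h) \<le> L * norm h" and t: "L < t"
  shows "det (A + mat t) > 0"
proof -
  have "L \<ge> 0"
  proof -
    have "0 \<le> L * norm (axis undefined 1 :: real^'n)"
      using A[of "axis undefined 1"] norm_ge_zero order.trans by blast
    then show ?thesis by simp
  qed
  have nz: "det (s *\<^sub>R A + mat t) \<noteq> 0" if s: "s \<in> {0..1}" for s
  proof
    assume "det (s *\<^sub>R A + mat t) = 0"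
    then obtain h where h: "h \<noteq> 0" "(s *\<^sub>R A + mat t) *v h = 0"
      using det_nz_iff_inj[OF matrix_vector_mul_linear[of "s *\<^sub>R A + mat t"]]
        linear_injective_0[OF matrix_vector_mul_linear[of "s *\<^sub>R A + mat t"]] by (auto simp: matrix_of_matrix_vector_mul)
    then have "t *\<^sub>R h = - (s *\<^sub>R (A *v h))"
      using h(2) by (simp add: matrix_vector_mult_add_rdistrib mat_vector_mult scaleR_matrix_vector_assoc eq_neg_iff_add_eq_0 add.commute)
    then have "\<bar>t\<bar> * norm h = s * norm (A *v h)"
      using s by (metis abs_of_nonneg atLeastAtMost_iff norm_minus_cancel norm_scaleR)
    also have "\<dots> \<le> 1 * (L * norm h)"
      using s A[of h] by (intro mult_mono) auto
    finally have "\<bar>t\<bar> \<le> L" using h(1) by simp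
    then show False using t by simp
  qed
  have cont: "continuous_on {0..1} (\<lambda>s. det (s *\<^sub>R A + mat t))"
    unfolding det_def by (intro continuous_intros)
  have "det (0 *\<^sub>R A + mat t) = t ^ CARD('n)"
    by (subst det_diagonal) (auto simp: mat_def)
  then have p0: "det (0 *\<^sub>R A + mat t) > 0" using t \<open>L \<ge> 0\<close> by simp
  show ?thesis
  proof (rule ccontr)
    assume "\<not> det (A + mat t) > 0"
    then have "det (1 *\<^sub>R A + mat t) \<le> 0" by simp
    then obtain s where "0 \<le> s" "s \<le> 1" "det (s *\<^sub>R A + mat t) = 0"
      using IVT2'[of "\<lambda>s. det (s *\<^sub>R A + mat t)" 1 0 0] p0 cont by auto
    then show False using nz by auto
  qed
qed

subsection \<open>Change of variables\<close>

text \<open>The library's change of variables and Sard theorems are stated for well-ordered index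
  types only; they are transported along a relabelling of the coordinates.\<close>

typedef ('a::finite) wo = "UNIV :: 'a set" ..

instantiation wo :: (finite) "{finite, wellorder}"
begin

definition less_eq_wo :: "'a wo \<Rightarrow> 'a wo \<Rightarrow> bool" where
  "less_eq_wo x y \<longleftrightarrow> to_nat_on (UNIV::'a set) (Rep_wo x) \<le> to_nat_on (UNIV::'a set) (Rep_wo y)"

definition less_wo :: "'a wo \<Rightarrow> 'a wo \<Rightarrow> bool" where
  "less_wo x y \<longleftrightarrow> to_nat_on (UNIV::'a set) (Rep_wo x) < to_nat_on (UNIV::'a set) (Rep_wo y)"

instance
proof
  have inj: "inj (to_nat_on (UNIV::'a set))" by (intro inj_on_to_nat_on countable_finite finite)
  show "finite (UNIV :: 'a wo set)"
    by (metis finite_imageI finite type_definition.Abs_image type_definition_wo)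
  fix x y z :: "'a wo"
  show "(x < y) = (x \<le> y \<and> \<not> y \<le> x)" "x \<le> x" "x \<le> y \<Longrightarrow> y \<le> z \<Longrightarrow> x \<le> z" "x \<le> y \<or> y \<le> x"
    by (auto simp: less_eq_wo_def less_wo_def)
  show "x \<le> y \<Longrightarrow> y \<le> x \<Longrightarrow> x = y"
    using inj by (auto simp: less_eq_wo_def Rep_wo_inject inj_eq dest!: antisym)
next
  fix P :: "'a wo \<Rightarrow> bool" and a :: "'a wo" assume *: "\<And>x. (\<And>y. y < x \<Longrightarrow> P y) \<Longrightarrow> P x"
  have "\<forall>a. to_nat_on (UNIV::'a set) (Rep_wo a) = n \<longrightarrow> P a" for n
    by (induction n rule: less_induct) (metis * less_wo_def)
  then show "P a" by blast
qed

end

section \<open>Transport along a relabelling of the coordinates\<close>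

lemma bij_Rep_wo: "bij Rep_wo" and bij_Abs_wo: "bij Abs_wo"
  by (auto intro!: o_bij[of Abs_wo Rep_wo] o_bij[of Rep_wo Abs_wo]
      simp: fun_eq_iff Rep_wo_inverse Abs_wo_inverse)

definition relabel :: "real^'n::finite \<Rightarrow> real^'n wo" where
  "relabel x = (\<chi> i. x $ Rep_wo i)"

definition unlabel :: "real^'n::finite wo \<Rightarrow> real^'n" where
  "unlabel x = (\<chi> i. x $ Abs_wo i)"

lemma relabel_unlabel [simp]: "relabel (unlabel x) = x" "unlabel (relabel y) = y"
  by (simp_all add: relabel_def unlabel_def vec_eq_iff Rep_wo_inverse Abs_wo_inverse)

lemma linear_relabel: "linear relabel" and linear_unlabel: "linear unlabel"
  by (auto intro!: linearI simp: relabel_def unlabel_def vec_eq_iff)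

lemma bounded_linear_relabel: "bounded_linear relabel"
  and bounded_linear_unlabel: "bounded_linear unlabel"
  using linear_relabel linear_unlabel by (simp_all add: linear_conv_bounded_linear)

lemma continuous_on_relabel [continuous_intros]:
  "continuous_on S f \<Longrightarrow> continuous_on S (\<lambda>x. relabel (f x))"
  by (rule bounded_linear.continuous_on[OF bounded_linear_relabel])

lemma continuous_on_unlabel [continuous_intros]:
  "continuous_on S f \<Longrightarrow> continuous_on S (\<lambda>x. unlabel (f x))"
  by (rule bounded_linear.continuous_on[OF bounded_linear_unlabel])

lemma borel_measurable_relabel [measurable]: "relabel \<in> borel_measurable borel"
  and borel_measurable_unlabel [measurable]: "unlabel \<in> borel_measurable borel"
  by (auto intro!: borel_measurable_continuous_onI continuous_intros)

lemma image_relabel: "relabel ` A = unlabel -` A"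
  by (auto simp: image_iff) (metis relabel_unlabel(1))

text \<open>Lebesgue measure is determined by its values on boxes, and a relabelling only permutes
  the side lengths of a box.\<close>

lemma distr_relabel: "distr lborel borel relabel = (lborel :: (real^'n::finite wo) measure)"
proof (rule lborel_eqI[symmetric])
  fix l u :: "real^'n wo"
  assume le: "\<And>b. b \<in> Basis \<Longrightarrow> l \<bullet> b \<le> u \<bullet> b"
  have le': "l $ i \<le> u $ i" for i
    using le[of "axis i 1"] by (simp add: axis_in_Basis_iff inner_axis)
  have prod_Basis: "(\<Prod>b\<in>Basis. f b) = (\<Prod>i\<in>UNIV. f (axis i 1))"
    for f :: "real^'k \<Rightarrow> real"
    unfolding Basis_vec_def by (subst prod.UNION_disjoint) (auto simp: axis_eq_axis)
  have "relabel -` box l u = box (unlabel l) (unlabel u)"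
  proof (intro set_eqI iffI)
    fix x assume "x \<in> relabel -` box l u"
    then have *: "\<And>i. l $ i < x $ Rep_wo i \<and> x $ Rep_wo i < u $ i"
      by (auto simp: relabel_def mem_box_cart)
    have "l $ Abs_wo i < x $ i \<and> x $ i < u $ Abs_wo i" for i
      using *[of "Abs_wo i"] by (simp add: Abs_wo_inverse)
    then show "x \<in> box (unlabel l) (unlabel u)" by (auto simp: unlabel_def mem_box_cart)
  next
    fix x assume "x \<in> box (unlabel l) (unlabel u)"
    then have *: "\<And>i. l $ Abs_wo i < x $ i \<and> x $ i < u $ Abs_wo i"
      by (auto simp: unlabel_def mem_box_cart)
    have "l $ i < x $ Rep_wo i \<and> x $ Rep_wo i < u $ i" for i
      using *[of "Rep_wo i"] by (simp add: Rep_wo_inverse)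
    then show "x \<in> relabel -` box l u" by (auto simp: relabel_def mem_box_cart)
  qed
  moreover have "unlabel l \<bullet> b \<le> unlabel u \<bullet> b" if "b \<in> Basis" for b
    using that le' by (auto simp: Basis_vec_def unlabel_def inner_axis)
  ultimately have "emeasure (distr lborel borel relabel) (box l u)
      = (\<Prod>b\<in>Basis. (unlabel u - unlabel l) \<bullet> b)"
    by (subst emeasure_distr) auto
  also have "(\<Prod>b\<in>Basis. (unlabel u - unlabel l) \<bullet> b) = (\<Prod>i\<in>UNIV. (u - l) $ Abs_wo i)"
    by (simp add: prod_Basis inner_axis unlabel_def)
  also have "\<dots> = (\<Prod>i\<in>UNIV. (u - l) $ i)"
    by (intro prod.reindex_bij_betw[where h=Abs_wo and g="\<lambda>i. (u - l) $ i"] bij_Abs_wo)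
  also have "\<dots> = (\<Prod>b\<in>Basis. (u - l) \<bullet> b)"
    by (simp add: prod_Basis inner_axis)
  finally show "emeasure (distr lborel borel relabel) (box l u) = (\<Prod>b\<in>Basis. (u - l) \<bullet> b)" .
qed simp

text \<open>The matrix of the linear map of \<open>A\<close> conjugated by the relabelling
  (\<open>relabel_matrix_vector\<close>).\<close>

definition relabel_matrix :: "real^'n::finite^'n \<Rightarrow> real^'n wo^'n wo" where
  "relabel_matrix A = (\<chi> i j. A $ Rep_wo i $ Rep_wo j)"

lemma relabel_matrix_vector: "relabel (A *v unlabel h) = relabel_matrix A *v h"
proof -
  have "(\<Sum>j\<in>UNIV. A $ k $ j * h $ Abs_wo j) = (\<Sum>j\<in>UNIV. A $ k $ Rep_wo j * h $ j)" for k
    using sum.reindex_bij_betw[OF bij_Rep_wo, of "\<lambda>j. A $ k $ j * h $ Abs_wo j"]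
    by (simp add: Rep_wo_inverse)
  then show ?thesis
    by (simp add: relabel_def unlabel_def relabel_matrix_def matrix_vector_mult_def vec_eq_iff)
qed

text \<open>Conjugation with \<open>Rep_wo\<close> is a bijection between the two symmetric groups
  under which the terms of the Leibniz formula correspond.\<close>

lemma det_relabel_matrix: "det (relabel_matrix A) = det (A :: real^'a::finite^'a)"
proof -
  let ?R = "Rep_wo :: 'a wo \<Rightarrow> 'a"
  have conj: "bij (?R \<circ> p \<circ> Abs_wo)" if "bij p" for p
    by (intro bij_comp bij_Abs_wo bij_Rep_wo that)
  have perm_iff: "q permutes UNIV \<longleftrightarrow> bij q" for q :: "'c \<Rightarrow> 'c"
    by (auto intro: permutes_bij bij_imp_permutes)
  have bij: "bij_betw (\<lambda>p. ?R \<circ> p \<circ> Abs_wo) {p. p permutes UNIV} {p. p permutes UNIV}"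
  proof (rule bij_betwI[where g="\<lambda>p. Abs_wo \<circ> p \<circ> ?R"])
    show "(\<lambda>p. ?R \<circ> p \<circ> Abs_wo) \<in> {p. p permutes UNIV} \<rightarrow> {p. p permutes UNIV}"
      unfolding perm_iff using conj by blast
    have "bij (Abs_wo \<circ> p \<circ> ?R)" if "bij p" for p :: "'a \<Rightarrow> 'a"
      by (intro bij_comp bij_Abs_wo bij_Rep_wo that)
    then show "(\<lambda>p. Abs_wo \<circ> p \<circ> ?R) \<in> {p. p permutes UNIV} \<rightarrow> {p. p permutes UNIV}"
      unfolding perm_iff by blast
  qed (auto simp: fun_eq_iff Rep_wo_inverse Abs_wo_inverse)
  \<comment> \<open>Conjugation preserves signs: it respects composition and sends transpositions to
    transpositions, so induction over products of transpositions applies.\<close>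
  have sgn: "sign (?R \<circ> p \<circ> Abs_wo) = sign p" if "p permutes UNIV" for p
    using finite[of UNIV] that
  proof (induction rule: permutes_rev_induct)
    case id
    have "?R \<circ> id \<circ> Abs_wo = id" by (simp add: fun_eq_iff Abs_wo_inverse)
    then show ?case by simp
  next
    case (swap a b p)
    have eq: "?R \<circ> (p \<circ> Transposition.transpose a b) \<circ> Abs_wo
        = (?R \<circ> p \<circ> Abs_wo) \<circ> Transposition.transpose (?R a) (?R b)"
      by (auto simp: fun_eq_iff Transposition.transpose_def Rep_wo_inverse Abs_wo_inverse)
    have perm: "permutation q" if "bij q" for q :: "'c::finite \<Rightarrow> 'c"
      using that by (auto simp: permutation)
    have "bij p" using swap.hyps by (simp add: permutes_bij)
    then have "bij (?R \<circ> p \<circ> Abs_wo)" by (rule conj)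
    moreover have "sign (?R \<circ> p \<circ> Abs_wo) = sign p" using swap by (simp add: comp_def)
    ultimately show ?case
      using swap(3)
      unfolding eq sign_compose[OF perm[OF conj[OF \<open>bij p\<close>]] permutation_swap_id]
        sign_compose[OF perm[OF \<open>bij p\<close>] permutation_swap_id]
      by (simp add: sign_swap_id Rep_wo_inject)
  qed
  have "det A = (\<Sum>p\<in>{p. p permutes (UNIV::'a wo set)}.
      of_int (sign (?R \<circ> p \<circ> Abs_wo)) * (\<Prod>i\<in>UNIV. A $ i $ (?R \<circ> p \<circ> Abs_wo) i))"
    unfolding det_def by (rule sum.reindex_bij_betw[OF bij, symmetric])
  also have "\<dots> = det (relabel_matrix A)"
    unfolding det_def
  proof (intro sum.cong refl arg_cong2[where f="(*)"])
    fix p :: "'a wo \<Rightarrow> 'a wo" assume p: "p \<in> {p. p permutes UNIV}"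
    then show "of_int (sign (?R \<circ> p \<circ> Abs_wo)) = of_int (sign p)" using sgn by simp
    show "(\<Prod>i\<in>UNIV. A $ i $ (?R \<circ> p \<circ> Abs_wo) i) = (\<Prod>i\<in>UNIV. relabel_matrix A $ i $ p i)"
      using prod.reindex_bij_betw[OF bij_Rep_wo, of "\<lambda>i. A $ i $ (?R \<circ> p \<circ> Abs_wo) i"]
      by (simp add: relabel_matrix_def Rep_wo_inverse)
  qed
  finally show ?thesis by simp
qed

lemma has_derivative_relabel:
  fixes f :: "real^'n \<Rightarrow> real^'n" and A :: "real^'n^'n"
  assumes "(f has_derivative (\<lambda>h. A *v h)) (at x within S)"
  shows "(relabel \<circ> f \<circ> unlabel has_derivative (\<lambda>h. relabel_matrix A *v h)) (at (relabel x) within relabel ` S)"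
proof -
  have "unlabel ` (relabel ` S) = S" by force
  then have "(f has_derivative (\<lambda>h. A *v h)) (at (unlabel (relabel x)) within unlabel ` (relabel ` S))"
    using assms by simp
  then have "(f \<circ> unlabel has_derivative (\<lambda>h. A *v h) \<circ> unlabel) (at (relabel x) within relabel ` S)"
    by (rule diff_chain_within[rotated])
       (rule bounded_linear_imp_has_derivative[OF bounded_linear_unlabel])
  then have "(relabel \<circ> (f \<circ> unlabel) has_derivative relabel \<circ> ((\<lambda>h. A *v h) \<circ> unlabel))
      (at (relabel x) within relabel ` S)"
    by (rule diff_chain_within)
       (rule bounded_linear_imp_has_derivative[OF bounded_linear_relabel])
  then show ?thesis by (simp add: comp_def relabel_matrix_vector)
qed

text \<open>Borel regularity of the image is assumed only to avoid completions; it is open in all uses.\<close>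

lemma measure_injective_image:
  fixes f :: "real^'n \<Rightarrow> real^'n" and F :: "real^'n \<Rightarrow> real^'n^'n"
  assumes S: "S \<in> sets borel" and fS: "f ` S \<in> sets borel"
    and der: "\<And>x. x \<in> S \<Longrightarrow> (f has_derivative (\<lambda>h. F x *v h)) (at x within S)"
    and inj: "inj_on f S"
    and int: "set_integrable lborel S (\<lambda>x. \<bar>det (F x)\<bar>)"
  shows "measure lborel (f ` S) = (LINT x:S|lborel. \<bar>det (F x)\<bar>)"
proof -
  define g where "g = relabel \<circ> f \<circ> unlabel"
  define G where "G y = relabel_matrix (F (unlabel y))" for y
  let ?T = "relabel ` S"
  have T: "?T \<in> sets borel"
    unfolding image_relabel using S measurable_sets_borel[OF borel_measurable_unlabel] by blast
  have gT: "g ` ?T = unlabel -` (f ` S)"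
    unfolding image_relabel[symmetric] g_def by (auto simp: image_comp comp_def)
  have gTb: "g ` ?T \<in> sets borel"
    unfolding gT using fS measurable_sets_borel[OF borel_measurable_unlabel] by blast
  have derg: "(g has_derivative (\<lambda>h. G y *v h)) (at y within ?T)" if "y \<in> ?T" for y
    using that has_derivative_relabel[OF der] by (auto simp: g_def G_def)
  have injg: "inj_on g ?T"
    using inj unfolding g_def inj_on_def by (metis (no_types, lifting) comp_apply image_iff relabel_unlabel(2))
  have indT: "indicator ?T (relabel x) = (indicator S x :: real)" for x :: "real^'n"
    by (metis image_iff indicator_simps relabel_unlabel(2))
  have [measurable]: "(\<lambda>x. indicator S x * \<bar>det (F x)\<bar>) \<in> borel_measurable lborel"
    using int unfolding set_integrable_def by (auto dest: borel_measurable_integrable)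
  have detG: "\<bar>det (G (relabel x))\<bar> = \<bar>det (F x)\<bar>" for x
    by (simp add: G_def det_relabel_matrix)
  have mG: "(\<lambda>y. indicator ?T y * \<bar>det (G y)\<bar>) \<in> borel_measurable borel"
  proof -
    have "(\<lambda>y. indicator ?T y * \<bar>det (G y)\<bar>) = (\<lambda>x. indicator S x * \<bar>det (F x)\<bar>) \<circ> unlabel"
      by (auto simp: fun_eq_iff G_def det_relabel_matrix) (metis indT relabel_unlabel(1))+
    also have "\<dots> \<in> borel_measurable borel" by measurable
    finally show ?thesis .
  qed
  have intG: "set_integrable lborel ?T (\<lambda>y. \<bar>det (G y)\<bar>)"
    unfolding set_integrable_def distr_relabel[symmetric]
    using int mG by (subst integrable_distr_eq) (auto simp: set_integrable_def indT detG)
  have eqG: "(LINT y:?T|lborel. \<bar>det (G y)\<bar>) = (LINT x:S|lborel. \<bar>det (F x)\<bar>)"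
    unfolding set_lebesgue_integral_def distr_relabel[symmetric]
    using mG by (subst integral_distr) (auto simp: indT detG)
  have hk: "(\<lambda>y. \<bar>det (G y)\<bar>) integrable_on ?T"
    "(LINT y:?T|lborel. \<bar>det (G y)\<bar>) = integral ?T (\<lambda>y. \<bar>det (G y)\<bar>)"
    using set_borel_integral_eq_integral[OF intG] by auto
  have "measure lebesgue (g ` ?T) = integral ?T (\<lambda>y. \<bar>det (matrix (\<lambda>h. G y *v h))\<bar>)"
    using T derg injg hk(1) by (intro measure_differentiable_image_eq) auto
  then have "measure lebesgue (g ` ?T) = (LINT x:S|lborel. \<bar>det (F x)\<bar>)"
    using hk(2) eqG by simp
  moreover have "measure lebesgue (g ` ?T) = measure (distr lborel borel relabel) (g ` ?T)"
    using gTb by (simp add: distr_relabel)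
  moreover have "\<dots> = measure lborel (f ` S)"
  proof -
    have "relabel -` (unlabel -` (f ` S)) = f ` S" by auto
    then show ?thesis unfolding gT[symmetric] using gTb by (subst measure_distr) (auto simp: gT)
  qed
  ultimately show ?thesis by simp
qed

text \<open>Sard's theorem between spaces of equal dimension; a vanishing determinant enters as a
  rank deficiency.\<close>

lemma negligible_critical_values:
  fixes f :: "real^'n \<Rightarrow> real^'n" and F :: "real^'n \<Rightarrow> real^'n^'n"
  assumes der: "\<And>x. x \<in> S \<Longrightarrow> (f has_derivative (\<lambda>h. F x *v h)) (at x within S)"
    and det: "\<And>x. x \<in> S \<Longrightarrow> det (F x) = 0"
  shows "negligible (f ` S)"
proof -
  define g where "g = relabel \<circ> f \<circ> unlabel"
  define G where "G y = relabel_matrix (F (unlabel y))" for y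
  have "negligible (g ` (relabel ` S))"
  proof (rule baby_Sard[where f'="\<lambda>y h. G y *v h"])
    fix y assume "y \<in> relabel ` S"
    then have y: "unlabel y \<in> S" by auto
    show "(g has_derivative (\<lambda>h. G y *v h)) (at y within relabel ` S)"
      using has_derivative_relabel[OF der[OF y]] by (simp add: g_def G_def)
    have "det (G y) = 0" by (simp add: G_def det_relabel_matrix det[OF y])
    then show "rank (matrix (\<lambda>h. G y *v h)) < CARD('n wo)"
      using det_nz_iff_inj[OF matrix_vector_mul_linear[of "G y"]]
      by (simp add: less_rank_noninjective)
  qed simp
  moreover have "g ` (relabel ` S) = relabel ` (f ` S)"
    by (auto simp: g_def image_comp comp_def)
  ultimately have "relabel ` (f ` S) \<in> null_sets lebesgue"
    by (simp add: negligible_iff_null_sets)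
  \<comment> \<open>The relabelled image is only known to be Lebesgue null; a Borel null superset
    can be pulled back along \<open>relabel\<close>.\<close>
  then obtain N where N: "relabel ` (f ` S) \<subseteq> N" "N \<in> null_sets lborel"
    by (meson null_sets_completion_iff2)
  have "emeasure lborel (relabel -` N) = 0"
    using N(2) by (subst (asm) distr_relabel[symmetric]) (auto simp: null_sets_distr_iff)
  moreover have "relabel -` N \<in> sets lborel"
    using N(2) measurable_sets_borel[OF borel_measurable_relabel, of N] by (auto dest: null_setsD2)
  ultimately have "relabel -` N \<in> null_sets lborel" by (simp add: null_sets_def)
  then have "negligible (relabel -` N)"
    by (simp add: negligible_iff_null_sets null_sets_completionI)
  then show ?thesis by (rule negligible_subset) (use N(1) in auto)
qed

subsection \<open>Null Lagrangians\<close>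

lemma abs_det_le:
  fixes A :: "real^'n^'n"
  assumes "\<And>i j. \<bar>A $ i $ j\<bar> \<le> a"
  shows "\<bar>det A\<bar> \<le> fact CARD('n) * a ^ CARD('n)"
proof -
  have "\<bar>det A\<bar> \<le> (\<Sum>p\<in>{p. p permutes (UNIV::'n set)}. \<bar>of_int (sign p) * (\<Prod>i\<in>UNIV. A$i$p i)\<bar>)"
    unfolding det_def by (rule sum_abs)
  also have "\<dots> \<le> (\<Sum>p\<in>{p. p permutes (UNIV::'n set)}. a ^ CARD('n))"
  proof (rule sum_mono)
    fix p :: "'n \<Rightarrow> 'n"
    have "(\<Prod>i\<in>UNIV. \<bar>A$i$p i\<bar>) \<le> (\<Prod>i\<in>(UNIV::'n set). a)"
      using assms by (intro prod_mono) auto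
    then show "\<bar>of_int (sign p) * (\<Prod>i\<in>UNIV. A$i$p i)\<bar> \<le> a ^ CARD('n)"
      by (simp add: abs_mult abs_prod flip: of_int_abs)
  qed
  also have "\<dots> = fact CARD('n) * a ^ CARD('n)"
    by (simp add: card_permutations)
  finally show ?thesis .
qed

lemma continuous_on_det [continuous_intros]:
  fixes F :: "'a::topological_space \<Rightarrow> real^'n^'n"
  shows "continuous_on S F \<Longrightarrow> continuous_on S (\<lambda>x. det (F x))"
  unfolding det_def by (intro continuous_intros)

lemma set_integrable_bounded_continuous:
  fixes f :: "'a::euclidean_space \<Rightarrow> real"
  assumes S: "open S" "bounded S" and f: "continuous_on S f" "\<And>x. x \<in> S \<Longrightarrow> \<bar>f x\<bar> \<le> B"
  shows "set_integrable lborel S f"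
  unfolding set_integrable_def
proof (rule Bochner_Integration.integrable_bound)
  have "emeasure lborel S < \<infinity>" using S(2) by (rule emeasure_bounded_finite)
  then show "integrable lborel (\<lambda>x. indicator S x * B)"
    using S(1) by (intro integrable_mult_left integrable_real_indicator) auto
  show "(\<lambda>x. indicator S x *\<^sub>R f x) \<in> borel_measurable lborel"
    using borel_measurable_continuous_on_indicator[OF _ f(1)] S(1) by auto
  show "AE x in lborel. norm (indicator S x *\<^sub>R f x) \<le> norm (indicator S x * B)"
    using f(2) by (intro AE_I2) (fastforce simp: indicator_def)
qed

text \<open>Injective because \<open>u\<close> changes a difference of two points by less than its
  multiple by \<open>t\<close>; surjective because solving for \<open>x\<close> is a fixed point
  problem for \<open>\<lambda>x. (1 / t) *\<^sub>R (y - u x)\<close>, a contraction with factor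
  \<open>L / t\<close>.\<close>

lemma expansive_perturbation_bij:
  fixes u :: "'a::euclidean_space \<Rightarrow> 'a"
  assumes u: "\<And>x y. norm (u x - u y) \<le> L * norm (x - y)" and t: "0 \<le> L" "L < t"
  shows "bij (\<lambda>x. t *\<^sub>R x + u x)"
proof (rule bijI)
  show "inj (\<lambda>x. t *\<^sub>R x + u x)"
  proof (rule injI)
    fix x y assume eq: "t *\<^sub>R x + u x = t *\<^sub>R y + u y"
    then have "t *\<^sub>R (x - y) = u y - u x" by (simp add: algebra_simps)
    then have "t * norm (x - y) \<le> L * norm (x - y)"
      using u[of y x] t by (metis abs_of_pos norm_minus_commute norm_scaleR order.strict_trans1)
    with t show "x = y" by (simp add: mult_le_cancel_right) 
  qed
  show "surj (\<lambda>x. t *\<^sub>R x + u x)"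
    unfolding surj_def
  proof
    fix y
    have "\<exists>!x. (1 / t) *\<^sub>R (y - u x) = x"
    proof (rule banach_fix_type[of "L / t"])
      show "\<forall>x z. dist ((1 / t) *\<^sub>R (y - u x)) ((1 / t) *\<^sub>R (y - u z)) \<le> L / t * dist x z"
      proof (intro allI)
        fix x z
        have "dist ((1 / t) *\<^sub>R (y - u x)) ((1 / t) *\<^sub>R (y - u z)) = (1 / t) * norm (u z - u x)"
          using t by (simp add: dist_norm flip: scaleR_diff_right)
        also have "\<dots> \<le> (1 / t) * (L * norm (z - x))"
          using t u by (intro mult_left_mono) auto
        finally show "dist ((1 / t) *\<^sub>R (y - u x)) ((1 / t) *\<^sub>R (y - u z)) \<le> L / t * dist x z"
          by (simp add: dist_norm norm_minus_commute)
      qed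
    qed (use t in auto)
    then obtain x where "(1 / t) *\<^sub>R (y - u x) = x" by blast
    then have "t *\<^sub>R x = y - u x"
      using t by (metis divide_self_if less_irrefl order.strict_trans1 scaleR_one scaleR_scaleR times_divide_eq_right mult.right_neutral)
    then show "\<exists>x. y = t *\<^sub>R x + u x" by (intro exI[of _ x]) simp
  qed
qed

text \<open>For \<open>t\<close> beyond the Lipschitz constants, \<open>t id + u\<close> and \<open>t id + w\<close> are bijections that agree
  off \<open>\<Omega>\<close>, hence map \<open>\<Omega>\<close> onto the same set, whose volume is the integral of either Jacobian.
  The determinants at \<open>t = 0\<close> follow by extrapolation.\<close>

lemma null_lagrangian_lipschitz:
  fixes u w :: "real^'n \<Rightarrow> real^'n" and U W :: "real^'n \<Rightarrow> real^'n^'n"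
  assumes \<Omega>: "open \<Omega>" "bounded \<Omega>"
    and u: "\<And>x y. norm (u x - u y) \<le> L * norm (x - y)"
      "\<And>x. x \<in> \<Omega> \<Longrightarrow> (u has_derivative (\<lambda>h. U x *v h)) (at x)" "continuous_on \<Omega> U"
      "\<And>x h. x \<in> \<Omega> \<Longrightarrow> norm (U x *v h) \<le> L * norm h"
    and w: "\<And>x y. norm (w x - w y) \<le> L * norm (x - y)"
      "\<And>x. x \<in> \<Omega> \<Longrightarrow> (w has_derivative (\<lambda>h. W x *v h)) (at x)" "continuous_on \<Omega> W"
      "\<And>x h. x \<in> \<Omega> \<Longrightarrow> norm (W x *v h) \<le> L * norm h"
    and L: "0 \<le> L" and eq: "\<And>x. x \<notin> \<Omega> \<Longrightarrow> u x = w x"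
  shows "(LINT x:\<Omega>|lborel. det (U x)) = (LINT x:\<Omega>|lborel. det (W x))"
proof -
  obtain T c where T: "finite T" "\<And>t. t \<in> T \<Longrightarrow> t > L"
    and det: "\<And>A::real^'n^'n. det A = (\<Sum>t\<in>T. c t * det (A + mat t))"
    using det_extrapolation by blast
  \<comment> \<open>For \<open>t > L\<close> the determinant is positive, so the area formula holds
    without absolute value and gives the volume of the image.\<close>
  have main: "set_integrable lborel \<Omega> (\<lambda>x. det (G x + mat t)) \<and>
      (LINT x:\<Omega>|lborel. det (G x + mat t)) = measure lborel ((\<lambda>x. t *\<^sub>R x + g x) ` \<Omega>)"
    if g: "\<And>x y. norm (g x - g y) \<le> L * norm (x - y)"
      "\<And>x. x \<in> \<Omega> \<Longrightarrow> (g has_derivative (\<lambda>h. G x *v h)) (at x)" "continuous_on \<Omega> G"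
      "\<And>x h. x \<in> \<Omega> \<Longrightarrow> norm (G x *v h) \<le> L * norm h" and t: "t > L" for g G t
  proof -
    let ?f = "\<lambda>x. t *\<^sub>R x + g x"
    have inj: "inj ?f" using expansive_perturbation_bij[OF g(1) L t] by (rule bij_is_inj)
    have "continuous_on UNIV g"
      by (rule lipschitz_on_continuous_on[of L]) (use g(1) L in \<open>auto intro!: lipschitz_onI simp: dist_norm\<close>)
    \<comment> \<open>Invariance of domain makes the image open and hence Borel, as
      \<open>measure_injective_image\<close> requires.\<close>
    then have op: "open (?f ` \<Omega>)"
      by (intro invariance_of_domain continuous_intros \<Omega>(1) inj_on_subset[OF inj])
         (auto intro: continuous_on_subset)
    have pos: "det (G x + mat t) > 0" if "x \<in> \<Omega>" for x
      using det_add_mat_pos[OF g(4)[OF that] t] .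
    have entry: "\<bar>(G x + mat t) $ i $ j\<bar> \<le> L + t" if x: "x \<in> \<Omega>" for x i j
    proof -
      have "\<bar>G x $ i $ j\<bar> = \<bar>(G x *v axis j 1) $ i\<bar>"
        by (simp add: matrix_vector_mult_basis column_def)
      also have "\<dots> \<le> norm (G x *v axis j 1)" by (rule component_le_norm_cart)
      also have "\<dots> \<le> L" using g(4)[OF x, of "axis j 1"] by simp
      finally have "\<bar>G x $ i $ j\<bar> \<le> L" .
      moreover have "\<bar>(mat t :: real^'n^'n) $ i $ j\<bar> \<le> t" using L t by (simp add: mat_def)
      ultimately show ?thesis by simp
    qed
    have int: "set_integrable lborel \<Omega> (\<lambda>x. det (G x + mat t))"
      by (intro set_integrable_bounded_continuous[OF \<Omega>] continuous_intros g(3))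
         (rule abs_det_le[OF entry])
    have "measure lborel (?f ` \<Omega>) = (LINT x:\<Omega>|lborel. \<bar>det (G x + mat t)\<bar>)"
    proof (rule measure_injective_image)
      show "set_integrable lborel \<Omega> (\<lambda>x. \<bar>det (G x + mat t)\<bar>)"
        using set_integrable_abs[OF int] .
      show "(?f has_derivative (\<lambda>h. (G x + mat t) *v h)) (at x within \<Omega>)" if "x \<in> \<Omega>" for x
      proof -
        have "(?f has_derivative (\<lambda>h. t *\<^sub>R h + G x *v h)) (at x)"
          by (intro has_derivative_add has_derivative_scaleR_right has_derivative_ident g(2)[OF that])
        then have "(?f has_derivative (\<lambda>h. (G x + mat t) *v h)) (at x)"
          by (simp add: matrix_vector_mult_add_rdistrib mat_vector_mult add.commute)
        then show ?thesis by (rule has_derivative_at_withinI)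
      qed
      show "\<Omega> \<in> sets borel" "?f ` \<Omega> \<in> sets borel" using \<Omega>(1) op by auto
      show "inj_on ?f \<Omega>" using inj by (rule inj_on_subset) simp
    qed
    also have "\<dots> = (LINT x:\<Omega>|lborel. det (G x + mat t))"
      using pos \<Omega>(1) by (intro set_lebesgue_integral_cong) (auto simp: less_imp_le)
    finally show ?thesis using int by simp
  qed
  have img: "(\<lambda>x. t *\<^sub>R x + u x) ` \<Omega> = (\<lambda>x. t *\<^sub>R x + w x) ` \<Omega>" if t: "t > L" for t
  proof -
    have compl: "(\<lambda>x. t *\<^sub>R x + g x) ` \<Omega> = - ((\<lambda>x. t *\<^sub>R x + g x) ` (- \<Omega>))"
      if "\<And>x y. norm (g x - g y) \<le> L * norm (x - y)" for g
      using bij_image_Compl_eq[OF expansive_perturbation_bij[OF that L t], of "\<Omega>"] by simp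
    have "(\<lambda>x. t *\<^sub>R x + u x) ` (- \<Omega>) = (\<lambda>x. t *\<^sub>R x + w x) ` (- \<Omega>)"
      using eq by (intro image_cong) auto
    then show ?thesis using compl[OF u(1)] compl[OF w(1)] by simp
  qed
  have sum: "(LINT x:\<Omega>|lborel. det (G x)) = (\<Sum>t\<in>T. c t * (LINT x:\<Omega>|lborel. det (G x + mat t)))"
    if "\<And>t. t \<in> T \<Longrightarrow> set_integrable lborel \<Omega> (\<lambda>x. det (G x + mat t))" for G :: "real^'n \<Rightarrow> real^'n^'n"
  proof -
    have "(\<lambda>x. det (G x)) = (\<lambda>x. \<Sum>t\<in>T. c t * det (G x + mat t))"
      by (rule ext) (rule det)
    then have "(LINT x:\<Omega>|lborel. det (G x)) = (LINT x:\<Omega>|lborel. \<Sum>t\<in>T. c t * det (G x + mat t))"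
      by (simp only:)
    also have "\<dots> = (\<Sum>t\<in>T. LINT x:\<Omega>|lborel. c t * det (G x + mat t))"
      unfolding set_lebesgue_integral_def scaleR_sum_right
      using that by (intro Bochner_Integration.integral_sum) (auto simp: set_integrable_def mult.left_commute)
    finally show ?thesis by simp
  qed
  show ?thesis
    using main[OF u] main[OF w] img T(2) sum[of U] sum[of W] by simp
qed

subsection \<open>Continuously differentiable maps\<close>

text \<open>The Jacobian is carried along as a second argument: integrands become explicit
  expressions in it, and its continuity can be stated directly. Likewise the gradient in
  \<open>C1_fun\<close>, which is a row of that matrix (\<open>C1_map_component\<close>).\<close>

definition C1_map :: "(real^'n \<Rightarrow> real^'n) \<Rightarrow> (real^'n \<Rightarrow> real^'n^'n) \<Rightarrow> bool" where
  "C1_map f F \<longleftrightarrow> (\<forall>x. (f has_derivative (\<lambda>h. F x *v h)) (at x)) \<and> continuous_on UNIV F"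

definition C1_fun :: "(real^'n \<Rightarrow> real) \<Rightarrow> (real^'n \<Rightarrow> real^'n) \<Rightarrow> bool" where
  "C1_fun c X \<longleftrightarrow> (\<forall>x. (c has_derivative (\<lambda>h. X x \<bullet> h)) (at x)) \<and> continuous_on UNIV X"

lemma has_derivative_vec_lambda:
  fixes f :: "'a::euclidean_space \<Rightarrow> real^'n"
  assumes "\<And>i. ((\<lambda>x. f x $ i) has_derivative (\<lambda>h. f' h $ i)) (at x within S)"
  shows "(f has_derivative f') (at x within S)"
  unfolding has_derivative_componentwise_within[of f]
  using assms by (auto simp: Basis_vec_def inner_axis)

lemma C1_mapI:
  assumes "\<And>i. C1_fun (\<lambda>x. f x $ i) (\<lambda>x. F x $ i)"
  shows "C1_map f F"
  unfolding C1_map_def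
proof
  show "\<forall>x. (f has_derivative (*v) (F x)) (at x)"
    using assms by (auto intro!: has_derivative_vec_lambda simp: C1_fun_def matrix_vector_mul_component)
  have "continuous_on UNIV (\<lambda>x. \<chi> i. F x $ i)"
    using assms by (intro continuous_on_vec_lambda) (auto simp: C1_fun_def)
  then show "continuous_on UNIV F" by simp
qed

lemma C1_map_component:
  assumes "C1_map f F" shows "C1_fun (\<lambda>x. f x $ i) (\<lambda>x. F x $ i)"
  unfolding C1_fun_def
proof (intro conjI allI)
  fix x
  have "((\<lambda>x. f x $ i) has_derivative (\<lambda>h. (F x *v h) $ i)) (at x)"
    using assms by (intro bounded_linear.has_derivative[OF bounded_linear_vec_nth]) (simp add: C1_map_def)
  then show "((\<lambda>x. f x $ i) has_derivative (\<bullet>) (F x $ i)) (at x)"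
    by (simp add: matrix_vector_mul_component)
  show "continuous_on UNIV (\<lambda>x. F x $ i)"
    using assms by (auto simp: C1_map_def intro!: continuous_intros)
qed

lemma C1_map_derivative: "C1_map f F \<Longrightarrow> (f has_derivative (\<lambda>h. F x *v h)) (at x within S)"
  by (auto simp: C1_map_def intro: has_derivative_at_withinI)

lemma C1_map_continuous: "C1_map f F \<Longrightarrow> continuous_on S f"
  by (meson C1_map_derivative differentiable_def differentiable_imp_continuous_on differentiable_on_def)

lemma C1_map_continuous': "C1_map f F \<Longrightarrow> continuous_on S F"
  unfolding C1_map_def by (meson continuous_on_subset subset_UNIV)

lemma C1_fun_continuous: "C1_fun f F \<Longrightarrow> continuous_on S f"
  unfolding C1_fun_def
  by (meson differentiable_def differentiable_imp_continuous_on differentiable_on_def has_derivative_at_withinI)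

lemma C1_fun_continuous': "C1_fun f F \<Longrightarrow> continuous_on S F"
  unfolding C1_fun_def by (meson continuous_on_subset subset_UNIV)

lemma C1_fun_const: "C1_fun (\<lambda>x. c) (\<lambda>x. 0)"
  by (auto simp: C1_fun_def)

lemma C1_fun_add: "C1_fun f F \<Longrightarrow> C1_fun g G \<Longrightarrow> C1_fun (\<lambda>x. f x + g x) (\<lambda>x. F x + G x)"
  by (auto simp: C1_fun_def inner_add_left intro!: has_derivative_add continuous_intros)

lemma C1_fun_mult:
  "C1_fun f F \<Longrightarrow> C1_fun g G \<Longrightarrow> C1_fun (\<lambda>x. f x * g x) (\<lambda>x. f x *\<^sub>R G x + g x *\<^sub>R F x)"
  by (auto simp: C1_fun_def inner_add_left mult.commute
      intro!: has_derivative_eq_rhs[OF has_derivative_mult] continuous_intros C1_fun_continuous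
      dest: C1_fun_continuous[unfolded C1_fun_def])

lemma C1_fun_diff: "C1_fun f F \<Longrightarrow> C1_fun g G \<Longrightarrow> C1_fun (\<lambda>x. f x - g x) (\<lambda>x. F x - G x)"
  by (auto simp: C1_fun_def inner_diff_left intro!: has_derivative_diff continuous_intros)

lemma C1_fun_sum:
  "(\<And>i. i \<in> I \<Longrightarrow> C1_fun (f i) (F i)) \<Longrightarrow> C1_fun (\<lambda>x. \<Sum>i\<in>I. f i x) (\<lambda>x. \<Sum>i\<in>I. F i x)"
  by (induction I rule: infinite_finite_induct) (auto intro: C1_fun_const C1_fun_add)

lemma C1_fun_compose:
  assumes f: "C1_fun f F" and g: "\<And>s. (g has_real_derivative g' s) (at s)" "continuous_on UNIV g'"
  shows "C1_fun (\<lambda>x. g (f x)) (\<lambda>x. g' (f x) *\<^sub>R F x)"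
  unfolding C1_fun_def
proof (intro conjI allI)
  fix x
  have "(f has_derivative (\<lambda>h. F x \<bullet> h)) (at x)" using f by (simp add: C1_fun_def)
  from has_derivative_compose[OF this g(1)[of "f x", unfolded has_field_derivative_def]]
  show "((\<lambda>x. g (f x)) has_derivative (\<bullet>) (g' (f x) *\<^sub>R F x)) (at x)"
    by (rule has_derivative_eq_rhs) (simp add: fun_eq_iff)
  show "continuous_on UNIV (\<lambda>x. g' (f x) *\<^sub>R F x)"
    using C1_fun_continuous[OF f] C1_fun_continuous'[OF f]
    by (intro continuous_intros continuous_on_compose2[OF g(2)]) auto
qed

lemma norm_matrix_vector_mult_le: "norm (A *v x) \<le> norm A * norm (x :: real^'n)"
  for A :: "real^'n^'m"
proof -
  have "norm (A *v x) = L2_set (\<lambda>i. norm (A $ i \<bullet> x)) UNIV"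
    by (simp add: norm_vec_def matrix_vector_mul_component)
  also have "\<dots> \<le> L2_set (\<lambda>i. norm (A $ i) * norm x) UNIV"
    by (intro L2_set_mono) (auto simp: Cauchy_Schwarz_ineq2)
  also have "\<dots> = norm A * norm x"
    by (simp add: L2_set_left_distrib norm_vec_def[of A])
  finally show ?thesis .
qed

lemma C1_map_lipschitz_on_bounded:
  assumes f: "C1_map f F" and B: "compact B" "convex B"
  obtains L where "L \<ge> 0" "\<And>x h. x \<in> B \<Longrightarrow> norm (F x *v h) \<le> L * norm h"
    "\<And>x y. x \<in> B \<Longrightarrow> y \<in> B \<Longrightarrow> norm (f x - f y) \<le> L * norm (x - y)"
proof -
  have "bounded (F ` B)"
    using C1_map_continuous'[OF f] B(1) by (intro compact_imp_bounded compact_continuous_image)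
  then obtain L where L: "\<And>x. x \<in> B \<Longrightarrow> norm (F x) \<le> L" by (auto simp: bounded_iff)
  have b: "norm (F x *v h) \<le> \<bar>L\<bar> * norm h" if "x \<in> B" for x h
  proof -
    have "norm (F x *v h) \<le> norm (F x) * norm h" by (rule norm_matrix_vector_mult_le)
    also have "\<dots> \<le> \<bar>L\<bar> * norm h" using L[OF that] by (intro mult_right_mono) auto
    finally show ?thesis .
  qed
  moreover have "norm (f x - f y) \<le> \<bar>L\<bar> * norm (x - y)" if "x \<in> B" "y \<in> B" for x y
    by (rule differentiable_bound[OF B(2) C1_map_derivative[OF f]])
       (use b that in \<open>auto intro!: onorm_le\<close>)
  ultimately show ?thesis using that[of "\<bar>L\<bar>"] by auto
qed

text \<open>Reduces to globally Lipschitz maps by composing with the nearest point projection onto a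
  closed ball that contains \<open>\<Omega>\<close>. The projection is 1-Lipschitz and the identity
  on \<open>\<Omega>\<close>.\<close>

theorem null_lagrangian:
  fixes u w :: "real^'n \<Rightarrow> real^'n"
  assumes \<Omega>: "open \<Omega>" "bounded \<Omega>" and u: "C1_map u U" and w: "C1_map w W"
    and eq: "\<And>x. x \<notin> \<Omega> \<Longrightarrow> u x = w x"
  shows "(LINT x:\<Omega>|lborel. det (U x)) = (LINT x:\<Omega>|lborel. det (W x))"
proof -
  obtain R where R: "R > 0" "\<Omega> \<subseteq> ball 0 R"
    using bounded_subset_ballD[OF \<Omega>(2)] by blast
  let ?B = "cball (0::real^'n) R" and ?c = "closest_point (cball (0::real^'n) R)"
  have B: "compact ?B" "convex ?B" "closed ?B" "?B \<noteq> {}" using R by auto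
  have sub: "x \<in> ?B" if "x \<in> \<Omega>" for x using R that by auto
  have c: "?c x \<in> ?B" for x using closest_point_in_set[OF B(3,4)] .
  obtain L1 where L1: "L1 \<ge> 0" "\<And>x h. x \<in> ?B \<Longrightarrow> norm (U x *v h) \<le> L1 * norm h"
    "\<And>x y. x \<in> ?B \<Longrightarrow> y \<in> ?B \<Longrightarrow> norm (u x - u y) \<le> L1 * norm (x - y)"
    using C1_map_lipschitz_on_bounded[OF u B(1,2)] by blast
  obtain L2 where L2: "L2 \<ge> 0" "\<And>x h. x \<in> ?B \<Longrightarrow> norm (W x *v h) \<le> L2 * norm h"
    "\<And>x y. x \<in> ?B \<Longrightarrow> y \<in> ?B \<Longrightarrow> norm (w x - w y) \<le> L2 * norm (x - y)"
    using C1_map_lipschitz_on_bounded[OF w B(1,2)] by blast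
  define L where "L = max L1 L2"
  have lip: "norm (f (?c x) - f (?c y)) \<le> L * norm (x - y)"
    if "\<And>x y. x \<in> ?B \<Longrightarrow> y \<in> ?B \<Longrightarrow> norm (f x - f y) \<le> M * norm (x - y)" "M \<le> L" "M \<ge> 0"
    for f :: "real^'n \<Rightarrow> real^'n" and M x y
  proof -
    have "norm (f (?c x) - f (?c y)) \<le> M * norm (?c x - ?c y)" using that(1) c by blast
    also have "\<dots> \<le> L * norm (x - y)"
      using closest_point_lipschitz[OF B(2-4)] that by (intro mult_mono) (auto simp: dist_norm)
    finally show ?thesis .
  qed
  have der: "((\<lambda>x. f (?c x)) has_derivative (\<lambda>h. F x *v h)) (at x)"
    if f: "C1_map f F" and x: "x \<in> \<Omega>" for f :: "real^'n \<Rightarrow> real^'n" and F x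
    by (rule has_derivative_transform_within_open[OF C1_map_derivative[OF f] \<Omega>(1) x])
       (use sub in \<open>simp add: closest_point_self\<close>)
  \<comment> \<open>A point projected into the open ball already lies in the ball and is its own
    projection, so no outside point is brought into \<open>\<Omega>\<close>.\<close>
  have off: "?c x \<notin> \<Omega>" if "x \<notin> \<Omega>" for x
  proof
    assume *: "?c x \<in> \<Omega>"
    have ri: "rel_interior ?B = ball 0 R" using R by (simp add: rel_interior_nonempty_interior)
    have "affine hull ?B = UNIV" using R by (intro affine_hull_nonempty_interior) simp
    then have "x \<in> ball 0 R"
      using closest_point_in_rel_interior[of ?B x] * B R(2) ri by auto
    then show False using * that by (simp add: closest_point_self)
  qed
  have L: "0 \<le> L" "L1 \<le> L" "L2 \<le> L" using L1(1) by (auto simp: L_def)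
  show ?thesis
  proof (rule null_lagrangian_lipschitz[OF \<Omega>, where u="\<lambda>x. u (?c x)" and w="\<lambda>x. w (?c x)" and L=L])
    show "norm (u (?c x) - u (?c y)) \<le> L * norm (x - y)" for x y
      using L1(3) L(2) L1(1) by (rule lip)
    show "norm (w (?c x) - w (?c y)) \<le> L * norm (x - y)" for x y
      using L2(3) L(3) L2(1) by (rule lip)
    show "norm (U x *v h) \<le> L * norm h" if "x \<in> \<Omega>" for x h
      using L1(2)[OF sub[OF that]] by (rule order.trans) (simp add: L mult_right_mono)
    show "norm (W x *v h) \<le> L * norm h" if "x \<in> \<Omega>" for x h
      using L2(2)[OF sub[OF that]] by (rule order.trans) (simp add: L mult_right_mono)
    show "u (?c x) = w (?c x)" if "x \<notin> \<Omega>" for x using eq off that by blast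
  qed (use L u w in \<open>auto intro: der C1_map_continuous'\<close>)
qed

subsection \<open>Step maps and blending\<close>

text \<open>The primitive of the tent \<open>dpsi\<close> of height 2 on the unit interval. A
  quadratic spline is C^1, which suffices for the null Lagrangian identity, and its bounds are
  piecewise arithmetic.\<close>

definition psi :: "real \<Rightarrow> real" where
  "psi s = 2 * (max 0 s)\<^sup>2 - 4 * (max 0 (s - 1/2))\<^sup>2 + 2 * (max 0 (s - 1))\<^sup>2"

definition dpsi :: "real \<Rightarrow> real" where
  "dpsi s = 4 * max 0 s - 8 * max 0 (s - 1/2) + 4 * max 0 (s - 1)"

lemma has_real_derivative_square_pos_part:
  "((\<lambda>s::real. (max 0 s)\<^sup>2) has_real_derivative 2 * max 0 s) (at s)"
proof -
  consider "s < 0" | "s = 0" | "s > 0" by linarith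
  then show ?thesis
  proof cases
    case 1
    then have "((\<lambda>s::real. 0) has_real_derivative 2 * max 0 s) (at s)" by simp
    then show ?thesis
      by (rule has_field_derivative_transform_within_open[of _ _ _ "{..<0}"]) (use 1 in auto)
  next
    case 3
    then have "((\<lambda>s::real. s\<^sup>2) has_real_derivative 2 * max 0 s) (at s)"
      by (auto intro!: derivative_eq_intros)
    then show ?thesis
      by (rule has_field_derivative_transform_within_open[of _ _ _ "{0<..}"]) (use 3 in auto)
  next
    case 2
    have "(\<lambda>h::real. (max 0 h)\<^sup>2 / h) \<midarrow>0\<rightarrow> 0"
    proof (rule Lim_null_comparison)
      show "\<forall>\<^sub>F h in at (0::real). norm ((max 0 h)\<^sup>2 / h) \<le> \<bar>h\<bar>"
        by (intro always_eventually allI) (auto simp: max_def power2_eq_square)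
      show "(abs \<longlongrightarrow> 0) (at (0::real))" using tendsto_rabs_zero_iff[of "\<lambda>x::real. x" "at 0"] by simp
    qed
    then show ?thesis using 2 by (simp add: DERIV_def)
  qed
qed

lemma has_real_derivative_psi: "(psi has_real_derivative dpsi s) (at s)"
proof -
  note D = has_real_derivative_square_pos_part
  have "((\<lambda>s. (max 0 (s - a))\<^sup>2) has_real_derivative 2 * max 0 (s - a)) (at s)" for a :: real
  proof -
    have "((\<lambda>s. s - a) has_real_derivative 1) (at s)" by (auto intro!: derivative_eq_intros)
    from DERIV_chain2[where f="\<lambda>s. (max 0 s)\<^sup>2", OF D this] show ?thesis by simp
  qed
  from this[of 0] this[of "1/2"] this[of 1]
  have "((\<lambda>s. 2 * (max 0 s)\<^sup>2 - 4 * (max 0 (s - 1/2))\<^sup>2 + 2 * (max 0 (s - 1))\<^sup>2)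
      has_real_derivative 2 * (2 * max 0 s) - 4 * (2 * max 0 (s - 1/2)) + 2 * (2 * max 0 (s - 1))) (at s)"
    by (intro DERIV_add DERIV_diff DERIV_cmult) simp_all
  then show ?thesis by (simp add: psi_def[abs_def] dpsi_def)
qed

lemma continuous_on_dpsi [continuous_intros]:
  "continuous_on S f \<Longrightarrow> continuous_on S (\<lambda>x. dpsi (f x))"
  unfolding dpsi_def by (intro continuous_intros)

lemma continuous_on_psi [continuous_intros]:
  "continuous_on S f \<Longrightarrow> continuous_on S (\<lambda>x. psi (f x))"
  unfolding psi_def by (intro continuous_intros)

lemma dpsi_outside: "s \<le> 0 \<or> 1 \<le> s \<Longrightarrow> dpsi s = 0"
  by (auto simp: dpsi_def max_def)

lemma dpsi_pos: "0 < s \<Longrightarrow> s < 1 \<Longrightarrow> 0 < dpsi s"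
  by (auto simp: dpsi_def max_def)

lemma dpsi_bounds: "0 \<le> dpsi s" "dpsi s \<le> 2"
  by (auto simp: dpsi_def max_def)

text \<open>The constant adds up the slopes 4, 8 and 4 of the three ramps in
  \<open>dpsi\<close>.\<close>

lemma dpsi_lipschitz: "\<bar>dpsi s - dpsi t\<bar> \<le> 16 * \<bar>s - t\<bar>"
  by (auto simp: dpsi_def max_def abs_if)

lemma psi_below: "s \<le> 0 \<Longrightarrow> psi s = 0"
  by (auto simp: psi_def max_def)

lemma psi_above: "1 \<le> s \<Longrightarrow> psi s = 1"
  by (auto simp: psi_def max_def power2_eq_square algebra_simps)

lemma psi_mono: "s \<le> t \<Longrightarrow> psi s \<le> psi t"
  by (rule DERIV_nonneg_imp_nondecreasing[of s t psi])
     (auto intro!: exI has_real_derivative_psi dpsi_bounds)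

lemma psi_strict_mono: "0 \<le> s \<Longrightarrow> s < t \<Longrightarrow> t \<le> 1 \<Longrightarrow> psi s < psi t"
  by (rule DERIV_pos_imp_increasing_open[of s t psi])
     (auto intro!: exI has_real_derivative_psi dpsi_pos continuous_intros)

lemma psi_bounds: "0 \<le> psi s" "psi s \<le> 1"
  using psi_mono[of "min s 0" s] psi_mono[of s "max s 1"] psi_below[of "min s 0"] psi_above[of "max s 1"]
  by auto

lemma psi_lipschitz: "\<bar>psi s - psi t\<bar> \<le> 2 * \<bar>s - t\<bar>"
  using field_differentiable_bound[of UNIV psi dpsi 2 s t] dpsi_bounds
  by (auto intro: has_real_derivative_psi)

lemma psi_surj:
  assumes "0 < r" "r < 1" obtains s where "0 < s" "s < 1" "psi s = r"
proof -
  obtain s where s: "0 \<le> s" "s \<le> 1" "psi s = r"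
    using IVT'[of psi 0 r 1] continuous_on_psi[of "{0..1}" "\<lambda>x. x"] assms
    by (auto simp: psi_below psi_above)
  then have "s \<noteq> 0" "s \<noteq> 1" using assms by (auto simp: psi_below psi_above)
  with s that[of s] show ?thesis by simp
qed

text \<open>Acting on each coordinate separately, the step map has a diagonal Jacobian. Its
  determinant is a product of tents supported in the cube of side \<open>\<delta>\<close>, and it
  has mass one because that cube is mapped onto the unit cube (\<open>stepv_cube\<close>).\<close>

definition stepv :: "real \<Rightarrow> real^'n \<Rightarrow> real^'n" where
  "stepv \<delta> z = (\<chi> i. psi (z $ i / \<delta>))"

text \<open>Chain rule: the Jacobian of \<open>stepv \<delta> (g x)\<close> for
  \<open>z = g x\<close> and \<open>A\<close> the Jacobian of \<open>g\<close>.\<close>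

definition stepm :: "real \<Rightarrow> real^'n \<Rightarrow> real^'n^'n \<Rightarrow> real^'n^'n" where
  "stepm \<delta> z A = (\<chi> i j. dpsi (z $ i / \<delta>) / \<delta> * A $ i $ j)"

lemma C1_map_step:
  assumes g: "C1_map g G" and \<delta>: "\<delta> \<noteq> 0"
  shows "C1_map (\<lambda>x. stepv \<delta> (g x)) (\<lambda>x. stepm \<delta> (g x) (G x))"
proof (rule C1_mapI)
  fix i
  have D: "((\<lambda>s. psi (s / \<delta>)) has_real_derivative dpsi (s / \<delta>) / \<delta>) (at s)" for s
  proof -
    have "((\<lambda>s. s / \<delta>) has_real_derivative 1 / \<delta>) (at s)"
      using \<delta> by (auto intro!: derivative_eq_intros)
    from DERIV_chain2[where f=psi, OF has_real_derivative_psi this] show ?thesis by simp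
  qed
  show "C1_fun (\<lambda>x. stepv \<delta> (g x) $ i) (\<lambda>x. stepm \<delta> (g x) (G x) $ i)"
    using C1_fun_compose[OF C1_map_component[OF g] D] \<delta>
    by (simp add: stepv_def stepm_def scaleR_vec_def continuous_intros)
qed

lemma det_stepm: "det (stepm \<delta> z A) = (\<Prod>i\<in>UNIV. dpsi (z $ i / \<delta>) / \<delta>) * det A"
proof -
  have "stepm \<delta> z A = (\<chi> i. (dpsi (z $ i / \<delta>) / \<delta>) *s A $ i)"
    by (simp add: stepm_def vec_eq_iff)
  then show ?thesis using det_rows_mul[of "\<lambda>i. dpsi (z $ i / \<delta>) / \<delta>" "\<lambda>i. A $ i"] by simp
qed

definition blend :: "real \<Rightarrow> real^'n \<Rightarrow> real^'n \<Rightarrow> real^'n" where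
  "blend c a b = b + c *\<^sub>R (a - b)"

text \<open>Product rule: the Jacobian of the blend of two C^1 maps with Jacobians \<open>A\<close>
  and \<open>B\<close>, where \<open>X\<close> is the gradient of the cutoff
  \<open>c\<close>.\<close>

definition blendm ::
    "real \<Rightarrow> real^'n \<Rightarrow> real^'n \<Rightarrow> real^'n^'n \<Rightarrow> real^'n \<Rightarrow> real^'n^'n \<Rightarrow> real^'n^'n" where
  "blendm c X a A b B = (\<chi> i j. B $ i $ j + c * (A $ i $ j - B $ i $ j) + X $ j * (a $ i - b $ i))"

lemma C1_map_blend:
  assumes "C1_fun c X" "C1_map a A" "C1_map b B"
  shows "C1_map (\<lambda>x. blend (c x) (a x) (b x)) (\<lambda>x. blendm (c x) (X x) (a x) (A x) (b x) (B x))"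
proof (rule C1_mapI)
  fix i
  have "C1_fun (\<lambda>x. b x $ i + c x * (a x $ i - b x $ i))
      (\<lambda>x. B x $ i + (c x *\<^sub>R (A x $ i - B x $ i) + (a x $ i - b x $ i) *\<^sub>R X x))"
    by (intro C1_fun_add C1_fun_mult C1_fun_diff C1_map_component assms)
  moreover have "(\<lambda>x. B x $ i + (c x *\<^sub>R (A x $ i - B x $ i) + (a x $ i - b x $ i) *\<^sub>R X x))
     = (\<lambda>x. blendm (c x) (X x) (a x) (A x) (b x) (B x) $ i)"
    by (auto simp: fun_eq_iff blendm_def vec_eq_iff algebra_simps)
  ultimately show "C1_fun (\<lambda>x. blend (c x) (a x) (b x) $ i)
      (\<lambda>x. blendm (c x) (X x) (a x) (A x) (b x) (B x) $ i)"
    by (simp add: blend_def)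
qed

lemma blendm_1: "blendm 1 0 a A b B = A"
  by (simp add: blendm_def vec_eq_iff)

definition cutoff :: "(real^'n) set \<Rightarrow> (real^'n \<Rightarrow> real) \<Rightarrow> (real^'n \<Rightarrow> real^'n) \<Rightarrow> bool" where
  "cutoff \<Omega> c X \<longleftrightarrow> C1_fun c X \<and> (\<forall>x. 0 \<le> c x \<and> c x \<le> 1) \<and> (\<forall>x. x \<notin> \<Omega> \<longrightarrow> c x = 0)"

text \<open>Since \<open>c\<close> never exceeds 1, a point with value 1 is a maximum. There the
  blend has the Jacobian of the first map (\<open>blendm_1\<close>), even if \<open>c\<close> is not
  constant nearby.\<close>

lemma cutoff_gradient_eq_0:
  assumes "cutoff \<Omega> c X" "c x = 1" shows "X x = 0"
proof -
  have "(c has_derivative (\<bullet>) (X x)) (at x)" using assms by (simp add: cutoff_def C1_fun_def)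
  moreover have "\<forall>y\<in>UNIV. c y \<le> c x" using assms by (simp add: cutoff_def)
  ultimately have "(\<bullet>) (X x) = (\<lambda>v. 0)"
    using differential_zero_maxmin[of x UNIV c "(\<bullet>) (X x)"] by auto
  then have "X x \<bullet> X x = 0" by metis
  then show ?thesis by simp
qed

text \<open>In coordinate \<open>i\<close> both step functions take the same value, 1 or 0, with
  derivative zero. Hence row \<open>i\<close> of the Jacobian of the blend vanishes, including the
  term with the gradient of the cutoff.\<close>

definition same_side :: "real \<Rightarrow> real^'n \<Rightarrow> real \<Rightarrow> real^'n \<Rightarrow> bool" where
  "same_side \<delta> z \<delta>' z' \<longleftrightarrow> (\<exists>i. (\<delta> \<le> z $ i \<and> \<delta>' \<le> z' $ i) \<or> (z $ i \<le> 0 \<and> z' $ i \<le> 0))"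

lemma det_blendm_same_side:
  assumes "same_side \<delta> z \<delta>' z'" "0 < \<delta>" "0 < \<delta>'"
  shows "det (blendm c X (stepv \<delta> z) (stepm \<delta> z A) (stepv \<delta>' z') (stepm \<delta>' z' A')) = 0"
proof -
  obtain i where "(\<delta> \<le> z $ i \<and> \<delta>' \<le> z' $ i) \<or> (z $ i \<le> 0 \<and> z' $ i \<le> 0)"
    using assms(1) by (auto simp: same_side_def)
  then have "dpsi (z $ i / \<delta>) = 0" "dpsi (z' $ i / \<delta>') = 0" "psi (z $ i / \<delta>) = psi (z' $ i / \<delta>')"
    using assms by (auto intro!: dpsi_outside simp: psi_below psi_above divide_le_0_iff)
  then have "row i (blendm c X (stepv \<delta> z) (stepm \<delta> z A) (stepv \<delta>' z') (stepm \<delta>' z' A')) = 0"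
    by (simp add: row_def blendm_def stepv_def stepm_def vec_eq_iff)
  then show ?thesis by (rule det_zero_row)
qed

lemma det_stepm_same_side:
  assumes "same_side \<delta> z \<delta>' z'" "0 < \<delta>" "0 < \<delta>'"
  shows "det (stepm \<delta> z A) = 0"
  using det_blendm_same_side[OF assms, of 1 0 A] by (simp add: blendm_1)

text \<open>Off \<open>\<Omega>\<close> the cutoff vanishes, so the blend and the second step map
  have the same values there, as \<open>null_lagrangian\<close> requires.\<close>

lemma integral_det_blend:
  assumes \<Omega>: "open \<Omega>" "bounded \<Omega>" and c: "cutoff \<Omega> c X"
    and g: "C1_map g G" and g': "C1_map g' G'" and \<delta>: "0 < \<delta>" "0 < \<delta>'"
  shows "(LINT x:\<Omega>|lborel. det (blendm (c x) (X x) (stepv \<delta> (g x)) (stepm \<delta> (g x) (G x))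
              (stepv \<delta>' (g' x)) (stepm \<delta>' (g' x) (G' x))))
       = (LINT x:\<Omega>|lborel. det (stepm \<delta>' (g' x) (G' x)))"
proof (rule null_lagrangian[OF \<Omega>])
  show "C1_map (\<lambda>x. blend (c x) (stepv \<delta> (g x)) (stepv \<delta>' (g' x)))
     (\<lambda>x. blendm (c x) (X x) (stepv \<delta> (g x)) (stepm \<delta> (g x) (G x))
              (stepv \<delta>' (g' x)) (stepm \<delta>' (g' x) (G' x)))"
    using c g g' \<delta> by (intro C1_map_blend C1_map_step) (auto simp: cutoff_def)
  show "C1_map (\<lambda>x. stepv \<delta>' (g' x)) (\<lambda>x. stepm \<delta>' (g' x) (G' x))"
    using g' \<delta> by (intro C1_map_step) auto
  show "blend (c x) (stepv \<delta> (g x)) (stepv \<delta>' (g' x)) = stepv \<delta>' (g' x)" if "x \<notin> \<Omega>" for x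
    using c that by (simp add: cutoff_def blend_def)
qed

text \<open>The determinant of the blend equals that of \<open>g\<close> pointwise: either the
  cutoff is 1, or both vanish because the two points lie on the same side.\<close>

lemma integral_det_homotopy:
  assumes \<Omega>: "open \<Omega>" "bounded \<Omega>" and c: "cutoff \<Omega> c X"
    and g: "C1_map g G" and g': "C1_map g' G'" and \<delta>: "0 < \<delta>"
    and side: "\<And>x. x \<in> \<Omega> \<Longrightarrow> c x \<noteq> 1 \<Longrightarrow> same_side \<delta> (g x) \<delta> (g' x)"
  shows "(LINT x:\<Omega>|lborel. det (stepm \<delta> (g x) (G x))) = (LINT x:\<Omega>|lborel. det (stepm \<delta> (g' x) (G' x)))"
proof -
  have "det (blendm (c x) (X x) (stepv \<delta> (g x)) (stepm \<delta> (g x) (G x))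
      (stepv \<delta> (g' x)) (stepm \<delta> (g' x) (G' x))) = det (stepm \<delta> (g x) (G x))" if "x \<in> \<Omega>" for x
  proof (cases "c x = 1")
    case True
    then show ?thesis using cutoff_gradient_eq_0[OF c True] by (simp add: blendm_1)
  next
    case False
    then show ?thesis
      using det_blendm_same_side[OF side[OF that False] \<delta> \<delta>] det_stepm_same_side[OF side[OF that False] \<delta> \<delta>]
      by simp
  qed
  then show ?thesis
    unfolding integral_det_blend[OF \<Omega> c g g' \<delta> \<delta>, symmetric]
    using \<Omega>(1) by (intro set_lebesgue_integral_cong) auto
qed

subsection \<open>The degree integral at a regular value\<close>

text \<open>The inverse function theorem, on a neighbourhood so small that the sign of the Jacobian
  determinant is constant.\<close>

lemma C1_map_local_homeo:
  fixes w :: "real^'n \<Rightarrow> real^'n"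
  assumes w: "C1_map w W" and z: "det (W z) \<noteq> 0" "open O1" "z \<in> O1"
  obtains U V where "open U" "z \<in> U" "U \<subseteq> O1" "open V" "w z \<in> V" "inj_on w U" "w ` U = V"
    "\<And>x. x \<in> U \<Longrightarrow> sgn (det (W x)) = sgn (det (W z))"
proof -
  define O2 where "O2 = O1 \<inter> {x. 0 < det (W x) * det (W z)}"
  have "open {x. 0 < det (W x) * det (W z)}"
    by (intro open_Collect_less continuous_intros C1_map_continuous'[OF w])
  then have O2: "open O2" "z \<in> O2"
    using z by (auto simp: O2_def open_Int zero_less_mult_iff)
  define f' where "f' x = Blinfun (\<lambda>h. W x *v h)" for x
  have f': "blinfun_apply (f' x) = (\<lambda>h. W x *v h)" for x
    unfolding f'_def by (rule bounded_linear_Blinfun_apply) (simp add: matrix_vector_mul_bounded_linear)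
  have contf: "continuous_on O2 f'"
  proof (rule continuous_on_blinfun_componentwise)
    fix i :: "real^'n" assume "i \<in> Basis"
    have "continuous_on O2 (\<lambda>x. \<chi> k. W x $ k \<bullet> i)"
      by (intro continuous_intros C1_map_continuous'[OF w])
    then show "continuous_on O2 (\<lambda>x. blinfun_apply (f' x) i)"
      by (simp add: f' matrix_vector_mult_def inner_vec_def)
  qed
  obtain B where B: "B ** W z = mat 1"
    using z(1) invertible_det_nz invertible_left_inverse by blast
  define invf where "invf = Blinfun (\<lambda>h. B *v h)"
  have invf: "blinfun_apply invf = (\<lambda>h. B *v h)"
    unfolding invf_def by (rule bounded_linear_Blinfun_apply) (simp add: matrix_vector_mul_bounded_linear)
  have "invf o\<^sub>L f' z = id_blinfun"
    by (rule blinfun_eqI) (simp add: invf f' matrix_vector_mul_assoc B)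
  then obtain U V g g' where U: "open U" "U \<subseteq> O2" "z \<in> U" "open V" "w z \<in> V" "homeomorphism U V w g"
    using inverse_function_theorem[OF O2(1) _ contf O2(2), of w invf] C1_map_derivative[OF w]
    unfolding f' by metis
  have "inj_on w U" "w ` U = V"
    using U(6) by (auto simp: homeomorphism_def intro: inj_on_inverseI)
  moreover have "sgn (det (W x)) = sgn (det (W z))" if "x \<in> U" for x
    using that U(2) by (auto simp: O2_def zero_less_mult_iff sgn_if)
  ultimately show ?thesis using that U O2_def by blast
qed

section \<open>Cubes and the contribution of a single preimage\<close>

definition open_cube :: "real \<Rightarrow> (real^'n) set" where
  "open_cube \<delta> = {z. \<forall>i. 0 < z $ i \<and> z $ i < \<delta>}"

lemma open_cube_eq_box: "open_cube \<delta> = box 0 (\<chi> i. \<delta>)"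
  by (auto simp: open_cube_def mem_box_cart)

lemma open_open_cube: "open (open_cube \<delta>)"
  unfolding open_cube_eq_box by (rule open_box)

lemma measure_open_cube_1: "measure lborel (open_cube 1 :: (real^'n) set) = 1"
  unfolding open_cube_eq_box measure_lborel_box_eq
  by (auto simp: Basis_vec_def inner_axis intro!: prod.neutral)

lemma open_cube_subset_ball: "0 < \<delta> \<Longrightarrow> open_cube \<delta> \<subseteq> ball (0::real^'n) (real (CARD('n) + 1) * \<delta>)"
proof
  fix z :: "real^'n" assume \<delta>: "0 < \<delta>" and z: "z \<in> open_cube \<delta>"
  have "norm z \<le> real CARD('n) * \<delta>"
    using z by (intro norm_le_card_bound) (auto simp: open_cube_def less_imp_le)
  then show "z \<in> ball 0 (real (CARD('n) + 1) * \<delta>)" using \<delta> by (simp add: algebra_simps)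
qed

lemma stepv_cube:
  assumes \<delta>: "0 < \<delta>"
  shows "inj_on (stepv \<delta>) (open_cube \<delta> :: (real^'n) set)"
    and "stepv \<delta> ` (open_cube \<delta> :: (real^'n) set) = open_cube 1"
proof -
  show "inj_on (stepv \<delta>) (open_cube \<delta> :: (real^'n) set)"
  proof (rule inj_onI)
    fix a b :: "real^'n" assume ab: "a \<in> open_cube \<delta>" "b \<in> open_cube \<delta>" "stepv \<delta> a = stepv \<delta> b"
    have "a $ i / \<delta> = b $ i / \<delta>" for i
    proof (rule ccontr)
      assume "a $ i / \<delta> \<noteq> b $ i / \<delta>"
      moreover have "0 < a $ i / \<delta>" "a $ i / \<delta> < 1" "0 < b $ i / \<delta>" "b $ i / \<delta> < 1"
        using ab \<delta> by (auto simp: open_cube_def)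
      moreover have "psi (a $ i / \<delta>) = psi (b $ i / \<delta>)" using ab(3) by (simp add: stepv_def vec_eq_iff)
      ultimately show False
        using psi_strict_mono[of "a $ i / \<delta>" "b $ i / \<delta>"] psi_strict_mono[of "b $ i / \<delta>" "a $ i / \<delta>"] by linarith
    qed
    then show "a = b" using \<delta> by (simp add: vec_eq_iff)
  qed
  show "stepv \<delta> ` (open_cube \<delta> :: (real^'n) set) = open_cube 1"
  proof (intro subset_antisym subsetI)
    fix r :: "real^'n" assume "r \<in> stepv \<delta> ` open_cube \<delta>"
    then obtain a where a: "a \<in> open_cube \<delta>" "r = stepv \<delta> a" by auto
    then have "0 < a $ i / \<delta>" "a $ i / \<delta> < 1" for i using \<delta> by (auto simp: open_cube_def)
    then have "psi 0 < psi (a $ i / \<delta>)" "psi (a $ i / \<delta>) < psi 1" for i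
      by (auto intro!: psi_strict_mono simp: less_imp_le)
    then show "r \<in> open_cube 1" using a(2) by (simp add: open_cube_def stepv_def psi_below psi_above)
  next
    fix r :: "real^'n" assume "r \<in> open_cube 1"
    then have "\<exists>s. 0 < s \<and> s < 1 \<and> psi s = r $ i" for i
      using psi_surj[of "r $ i"] by (metis (mono_tags, lifting) mem_Collect_eq open_cube_def)
    then obtain s where s: "\<And>i. 0 < s i \<and> s i < 1 \<and> psi (s i) = r $ i" by metis
    have "r = stepv \<delta> (\<chi> i. \<delta> * s i)" using s \<delta> by (simp add: stepv_def vec_eq_iff)
    moreover have "(\<chi> i. \<delta> * s i) \<in> open_cube \<delta>" using s \<delta> by (simp add: open_cube_def)
    ultimately show "r \<in> stepv \<delta> ` open_cube \<delta>" by blast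
  qed
qed

lemma det_stepm_outside:
  assumes "z \<notin> open_cube \<delta>" "0 < \<delta>" shows "det (stepm \<delta> z A) = 0"
proof -
  obtain i where "z $ i \<le> 0 \<or> \<delta> \<le> z $ i" using assms(1) by (auto simp: open_cube_def not_less)
  then have "dpsi (z $ i / \<delta>) / \<delta> = 0" using assms(2) by (auto simp: dpsi_outside divide_le_0_iff)
  then have "(\<Prod>i\<in>UNIV. dpsi (z $ i / \<delta>) / \<delta>) = 0" by (intro prod_zero) auto
  then show ?thesis by (simp add: det_stepm)
qed

lemma sgn_det_stepm:
  assumes "z \<in> open_cube \<delta>" "0 < \<delta>" shows "sgn (det (stepm \<delta> z A)) = sgn (det A)"
proof -
  have "0 < (\<Prod>i\<in>UNIV. dpsi (z $ i / \<delta>) / \<delta>)"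
    using assms by (intro prod_pos divide_pos_pos dpsi_pos) (auto simp: open_cube_def)
  then show ?thesis by (simp add: det_stepm sgn_mult)
qed

text \<open>The step map after the shift takes \<open>P\<close> bijectively onto the unit cube,
  whose volume is one. The area formula gives the integral of the absolute determinant, and the
  constant sign comes out of the integral.\<close>

lemma integral_det_step_local:
  assumes w: "C1_map w W" and P: "open P" "bounded P" and inj: "inj_on w P"
    and img: "(\<lambda>x. w x - y) ` P = open_cube \<delta>" and \<delta>: "0 < \<delta>"
    and sgn: "\<And>x. x \<in> P \<Longrightarrow> sgn (det (W x)) = s"
  shows "(LINT x:P|lborel. det (stepm \<delta> (w x - y) (W x))) = s"
    and "set_integrable lborel P (\<lambda>x. det (stepm \<delta> (w x - y) (W x)))"
proof -
  let ?g = "\<lambda>x. w x - y"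
  let ?f = "\<lambda>x. stepv \<delta> (?g x)" and ?F = "\<lambda>x. stepm \<delta> (?g x) (W x)"
  have g: "C1_map ?g W"
    using w by (auto simp: C1_map_def intro!: derivative_eq_intros)
  have f: "C1_map ?f ?F" using C1_map_step[OF g] \<delta> by simp
  have "bounded ((\<lambda>x. det (?F x)) ` closure P)"
    using P(2) by (intro compact_imp_bounded compact_continuous_image continuous_intros C1_map_continuous'[OF f])
      (simp add: compact_closure)
  then obtain B where B: "\<And>x. x \<in> P \<Longrightarrow> \<bar>det (?F x)\<bar> \<le> B"
    by (auto simp: bounded_iff) (meson closure_subset subsetD)
  show int: "set_integrable lborel P (\<lambda>x. det (?F x))"
    by (intro set_integrable_bounded_continuous[OF P _ B] continuous_intros C1_map_continuous'[OF f])
  have img': "?f ` P = open_cube 1"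
    using img stepv_cube(2)[OF \<delta>] by (metis image_image)
  have cube: "?g x \<in> open_cube \<delta>" if "x \<in> P" for x using that img by blast
  have "inj_on ?g P" using inj by (auto simp: inj_on_def)
  then have "inj_on (stepv \<delta> \<circ> ?g) P"
    using stepv_cube(1)[OF \<delta>] img by (intro comp_inj_on) auto
  then have "inj_on ?f P" by (simp add: comp_def)
  then have m: "measure lborel (?f ` P) = (LINT x:P|lborel. \<bar>det (?F x)\<bar>)"
    using P img' set_integrable_abs[OF int]
    by (intro measure_injective_image C1_map_derivative[OF f]) (auto simp: open_open_cube)
  have "det (?F x) = s * \<bar>det (?F x)\<bar>" if "x \<in> P" for x
    using sgn_det_stepm[OF cube[OF that] \<delta>, of "W x"] sgn[OF that] by (metis sgn_mult_abs)
  then have "(LINT x:P|lborel. det (?F x)) = (LINT x:P|lborel. s * \<bar>det (?F x)\<bar>)"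
    using P(1) by (intro set_lebesgue_integral_cong) auto
  also have "\<dots> = s" using m img' by (simp add: measure_open_cube_1)
  finally show "(LINT x:P|lborel. det (?F x)) = s" .
qed

text \<open>For small \<open>\<delta>\<close> the support of the integrand splits into disjoint
  patches, one around each preimage of \<open>y\<close>, and each patch contributes its
  sign.\<close>

lemma integral_det_step_regular:
  fixes w :: "real^'n \<Rightarrow> real^'n"
  assumes \<Omega>: "open \<Omega>" "bounded \<Omega>" and w: "C1_map w W" and y: "y \<notin> w ` frontier \<Omega>"
    and reg: "\<And>x. x \<in> \<Omega> \<Longrightarrow> w x = y \<Longrightarrow> det (W x) \<noteq> 0"
  obtains \<delta>0 where "\<delta>0 > 0" "\<And>\<delta>. 0 < \<delta> \<Longrightarrow> \<delta> \<le> \<delta>0 \<Longrightarrow>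
     (LINT x:\<Omega>|lborel. det (stepm \<delta> (w x - y) (W x))) = (\<Sum>x\<in>{x \<in> \<Omega>. w x = y}. sgn (det (W x)))"
proof -
  define Z where "Z = {x \<in> \<Omega>. w x = y}"
  have fr: "frontier \<Omega> = closure \<Omega> - \<Omega>" using \<Omega>(1) by (simp add: frontier_def interior_open)
  \<comment> \<open>The frontier contains no preimage of \<open>y\<close>, so \<open>Z\<close> is
    closed in the compact closure.\<close>
  have Zeq: "Z = closure \<Omega> \<inter> w -` {y}"
    using y closure_subset[of \<Omega>] fr unfolding Z_def by blast
  have "compact (closure \<Omega>)" using \<Omega>(2) by (simp add: compact_closure)
  then have "compact Z"
    unfolding Zeq using C1_map_continuous[OF w]
    by (metis closed_singleton closed_vimage compact_Int_closed)
  have ex: "\<exists>U. open U \<and> z \<in> U \<and> U \<subseteq> ball z r \<inter> \<Omega> \<and> open (w ` U) \<and> inj_on w U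
      \<and> (\<forall>x\<in>U. sgn (det (W x)) = sgn (det (W z)))" if "z \<in> Z" "r > 0" for z r
  proof -
    have z: "w z = y" "det (W z) \<noteq> 0" "open (ball z r \<inter> \<Omega>)" "z \<in> ball z r \<inter> \<Omega>"
      using that reg \<Omega>(1) by (auto simp: Z_def)
    show ?thesis by (rule C1_map_local_homeo[OF w z(2-4)]) (use z(1) in blast)
  qed
  \<comment> \<open>\<open>w\<close> is injective near each point of the compact set
    \<open>Z\<close>, on which it is constant; so each member of a finite subcover contains no point
    of \<open>Z\<close> but its centre.\<close>
  have fin: "finite Z"
  proof -
    have "\<forall>z\<in>Z. \<exists>U. open U \<and> z \<in> U \<and> inj_on w U"
    proof
      fix z assume "z \<in> Z"
      from ex[OF this zero_less_one] show "\<exists>U. open U \<and> z \<in> U \<and> inj_on w U"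
        by (elim exE conjE) (intro exI conjI)
    qed
    then obtain U where U: "\<And>z. z \<in> Z \<Longrightarrow> open (U z) \<and> z \<in> U z \<and> inj_on w (U z)"
      by (auto dest!: bchoice)
    obtain D where D: "D \<subseteq> Z" "finite D" "Z \<subseteq> (\<Union>z\<in>D. U z)"
      by (rule compactE_image[OF \<open>compact Z\<close>, of Z U]) (use U in auto)
    have "z \<in> D" if zZ: "z \<in> Z" for z
    proof -
      obtain d where d: "d \<in> D" "z \<in> U d" using D zZ by blast
      then have "w z = w d" using D zZ by (auto simp: Z_def)
      moreover have "inj_on w (U d)" "z \<in> U d" "d \<in> U d" using U d D by auto
      ultimately have "z = d" by (meson inj_onD)
      then show ?thesis using d by simp
    qed
    then show ?thesis using D(2) by (meson finite_subset subsetI)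
  qed
  obtain r where r: "r > 0" "\<And>z z'. z \<in> Z \<Longrightarrow> z' \<in> Z \<Longrightarrow> z \<noteq> z' \<Longrightarrow> r \<le> dist z z'"
  proof -
    have "\<forall>z. \<exists>d>0. \<forall>z'\<in>Z. z' \<noteq> z \<longrightarrow> d \<le> dist z z'"
      by (intro allI finite_set_avoid[OF fin])
    from choice[OF this] obtain d
      where d: "\<And>z. d z > 0" "\<And>z z'. z' \<in> Z \<Longrightarrow> z' \<noteq> z \<Longrightarrow> d z \<le> dist z z'" by auto
    define r where "r = Min (insert 1 (d ` Z))"
    have "r > 0" "\<And>z. z \<in> Z \<Longrightarrow> r \<le> d z" unfolding r_def using fin d by auto
    then have "r \<le> dist z z'" if "z \<in> Z" "z' \<in> Z" "z \<noteq> z'" for z z'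
      using d(2)[of z' z] that by force
    with \<open>r > 0\<close> show ?thesis by (rule that)
  qed
  have "\<forall>z\<in>Z. \<exists>U. open U \<and> z \<in> U \<and> U \<subseteq> ball z (r/2) \<inter> \<Omega> \<and> open (w ` U) \<and> inj_on w U
      \<and> (\<forall>x\<in>U. sgn (det (W x)) = sgn (det (W z)))"
    using ex[OF _ half_gt_zero[OF r(1)]] by (intro ballI)
  from bchoice[OF this] obtain U where U': "\<forall>z\<in>Z. open (U z) \<and> z \<in> U z \<and> U z \<subseteq> ball z (r/2) \<inter> \<Omega>
      \<and> open (w ` U z) \<and> inj_on w (U z) \<and> (\<forall>x\<in>U z. sgn (det (W x)) = sgn (det (W z)))" ..
  define V where "V z = w ` U z" for z
  have UV: "open (U z)" "z \<in> U z" "U z \<subseteq> ball z (r/2) \<inter> \<Omega>" "open (V z)" "y \<in> V z"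
    "inj_on w (U z)" "w ` U z = V z" if "z \<in> Z" for z
    using bspec[OF U' that] that unfolding V_def Z_def by auto
  have UV8: "sgn (det (W x)) = sgn (det (W z))" if "z \<in> Z" "x \<in> U z" for z x
    using bspec[OF U' that(1)] that(2) by blast
  \<comment> \<open>Away from the chosen neighbourhoods \<open>w\<close> keeps a positive distance
    from \<open>y\<close>; this confines the preimage of a small cube at \<open>y\<close> to
    them.\<close>
  define K where "K = closure \<Omega> - (\<Union>z\<in>Z. U z)"
  have "compact K" unfolding K_def
    using \<open>compact (closure \<Omega>)\<close> UV(1) by (intro compact_diff) auto
  then have "closed (w ` K)"
    by (intro compact_imp_closed compact_continuous_image C1_map_continuous[OF w])
  moreover have "y \<notin> w ` K" using UV(2) by (auto simp: K_def Zeq)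
  ultimately have "open ((- (w ` K)) \<inter> (\<Inter>z\<in>Z. V z))" "y \<in> (- (w ` K)) \<inter> (\<Inter>z\<in>Z. V z)"
    using fin UV(4,5) by (auto intro!: open_Int open_INT)
  then obtain \<rho> where \<rho>: "\<rho> > 0" "ball y \<rho> \<subseteq> (- (w ` K)) \<inter> (\<Inter>z\<in>Z. V z)"
    by (meson openE)
  \<comment> \<open>From \<open>open_cube_subset_ball\<close>: a cube of side at most
    \<open>\<delta>0\<close> fits into the ball of radius \<open>\<rho>\<close>.\<close>
  define \<delta>0 where "\<delta>0 = \<rho> / real (CARD('n) + 1)"
  have "\<delta>0 > 0" using \<rho> by (simp add: \<delta>0_def)
  moreover have "(LINT x:\<Omega>|lborel. det (stepm \<delta> (w x - y) (W x))) = (\<Sum>x\<in>Z. sgn (det (W x)))"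
    if \<delta>: "0 < \<delta>" "\<delta> \<le> \<delta>0" for \<delta>
  proof -
    have sub: "y + z \<in> ball y \<rho>" if "z \<in> open_cube \<delta>" for z
    proof -
      have "norm z < real (CARD('n) + 1) * \<delta>" using open_cube_subset_ball[OF \<delta>(1)] that by auto
      also have "\<dots> \<le> real (CARD('n) + 1) * \<delta>0" using \<delta> by (intro mult_left_mono) auto
      also have "\<dots> = \<rho>" by (simp add: \<delta>0_def)
      finally show ?thesis by (simp add: dist_norm)
    qed
    define P where "P z = U z \<inter> {x. w x - y \<in> open_cube \<delta>}" for z
    have opP: "open (P z)" if "z \<in> Z" for z
    proof -
      have "open ((\<lambda>x. w x - y) -` open_cube \<delta>)"
        by (intro open_vimage open_open_cube continuous_intros C1_map_continuous[OF w])
      then show ?thesis using UV(1)[OF that] by (auto simp: P_def vimage_def)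
    qed
    have imgP: "(\<lambda>x. w x - y) ` P z = open_cube \<delta>" if "z \<in> Z" for z
    proof (intro subset_antisym subsetI)
      fix c :: "real^'n" assume c: "c \<in> open_cube \<delta>"
      then have "y + c \<in> V z" using sub \<rho>(2) that by blast
      then have "y + c \<in> w ` U z" using UV(7)[OF that] by simp
      then obtain x where x: "x \<in> U z" "w x = y + c" by auto
      then show "c \<in> (\<lambda>x. w x - y) ` P z" using c by (intro image_eqI[of _ _ x]) (auto simp: P_def)
    qed (auto simp: P_def)
    have bdP: "bounded (P z)" if "z \<in> Z" for z
      using UV(3)[OF that] \<Omega>(2) by (auto simp: P_def intro: bounded_subset)
    have injP: "inj_on w (P z)" if "z \<in> Z" for z
      using UV(6)[OF that] by (rule inj_on_subset) (auto simp: P_def)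
    note loc = integral_det_step_local[OF w opP bdP injP imgP \<delta>(1)]
    have L: "(LINT x:P z|lborel. det (stepm \<delta> (w x - y) (W x))) = sgn (det (W z))"
      "set_integrable lborel (P z) (\<lambda>x. det (stepm \<delta> (w x - y) (W x)))" if "z \<in> Z" for z
    proof -
      have s: "sgn (det (W x)) = sgn (det (W z))" if "x \<in> P z" for x
        using UV8[OF \<open>z \<in> Z\<close>] that by (auto simp: P_def)
      show "(LINT x:P z|lborel. det (stepm \<delta> (w x - y) (W x))) = sgn (det (W z))"
        by (rule loc(1)[OF that that that that s])
      show "set_integrable lborel (P z) (\<lambda>x. det (stepm \<delta> (w x - y) (W x)))"
        by (rule loc(2)[OF that that that that s])
    qed
    have disj: "z = z'" if "x \<in> P z" "x \<in> P z'" "z \<in> Z" "z' \<in> Z" for x z z'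
    proof (rule ccontr)
      assume "z \<noteq> z'"
      then have "r \<le> dist z z'" using r that by blast
      moreover have "x \<in> ball z (r/2)" "x \<in> ball z' (r/2)"
        using that UV(3)[of z] UV(3)[of z'] by (auto simp: P_def simp del: mem_ball)
      then have "dist z x < r/2" "dist z' x < r/2" by simp_all
      ultimately show False using dist_triangle2[of z z' x] by linarith
    qed
    have cover: "\<exists>z\<in>Z. x \<in> P z" if "x \<in> \<Omega>" "w x - y \<in> open_cube \<delta>" for x
    proof -
      have "w x \<in> ball y \<rho>" using sub[OF that(2)] by simp
      then have "x \<notin> K" using \<rho>(2) by blast
      moreover have "x \<in> closure \<Omega>" using that(1) closure_subset by blast
      ultimately show ?thesis using that by (auto simp: K_def P_def)
    qed
    have "indicator \<Omega> x *\<^sub>R det (stepm \<delta> (w x - y) (W x)) =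
        (\<Sum>z\<in>Z. indicator (P z) x *\<^sub>R det (stepm \<delta> (w x - y) (W x)))" for x
    proof (cases "x \<in> \<Omega> \<and> w x - y \<in> open_cube \<delta>")
      case True
      then obtain z where z: "z \<in> Z" "x \<in> P z" using cover by blast
      have "(\<Sum>z'\<in>Z. indicator (P z') x *\<^sub>R det (stepm \<delta> (w x - y) (W x)))
          = (\<Sum>z'\<in>Z. if z' = z then det (stepm \<delta> (w x - y) (W x)) else 0)"
        using z disj by (intro sum.cong) (auto simp: indicator_def)
      then show ?thesis using True z fin by simp
    next
      case False
      then have "x \<notin> P z" if "z \<in> Z" for z using UV(3)[OF that] by (auto simp: P_def)
      then show ?thesis using False \<delta>(1) det_stepm_outside by (auto simp: indicator_def)
    qed
    then have "(LINT x:\<Omega>|lborel. det (stepm \<delta> (w x - y) (W x))) =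
        (LINT x|lborel. (\<Sum>z\<in>Z. indicator (P z) x *\<^sub>R det (stepm \<delta> (w x - y) (W x))))"
      by (simp add: set_lebesgue_integral_def)
    also have "\<dots> = (\<Sum>z\<in>Z. (LINT x:P z|lborel. det (stepm \<delta> (w x - y) (W x))))"
      unfolding set_lebesgue_integral_def
      using L(2) by (intro Bochner_Integration.integral_sum) (simp add: set_integrable_def)
    also have "\<dots> = (\<Sum>z\<in>Z. sgn (det (W z)))" using L(1) by simp
    finally show ?thesis .
  qed
  ultimately show ?thesis using that by (simp add: Z_def)
qed

subsection \<open>Smooth interpolation on cubical grids\<close>

text \<open>A difference of shifted steps, so that sums over integer translates telescope
  (\<open>sum_bump\<close>). This yields a C^1 partition of unity whose members vanish outside the
  interval from -1 to 1.\<close>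

definition bump :: "real \<Rightarrow> real" where
  "bump s = psi (s + 1) - psi s"

definition dbump :: "real \<Rightarrow> real" where
  "dbump s = dpsi (s + 1) - dpsi s"

lemma has_real_derivative_bump: "(bump has_real_derivative dbump s) (at s)"
proof -
  have "((\<lambda>s. s + 1) has_real_derivative 1) (at s)" by (auto intro!: derivative_eq_intros)
  from DERIV_chain2[where f=psi, OF has_real_derivative_psi this]
  have "((\<lambda>s. psi (s + 1)) has_real_derivative dpsi (s + 1)) (at s)" by simp
  then show ?thesis unfolding bump_def[abs_def] dbump_def by (intro DERIV_diff has_real_derivative_psi)
qed

lemma continuous_on_dbump [continuous_intros]:
  "continuous_on S f \<Longrightarrow> continuous_on S (\<lambda>x. dbump (f x))"
  unfolding dbump_def by (intro continuous_intros)

lemma bump_bounds: "0 \<le> bump s" "bump s \<le> 1"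
  using psi_mono[of s "s + 1"] psi_bounds[of s] psi_bounds[of "s + 1"] by (auto simp: bump_def)

lemma abs_dbump_le: "\<bar>dbump s\<bar> \<le> 2"
  using dpsi_bounds[of s] dpsi_bounds[of "s + 1"] by (auto simp: dbump_def)

lemma bump_outside: "1 \<le> \<bar>s\<bar> \<Longrightarrow> bump s = 0" "1 \<le> \<bar>s\<bar> \<Longrightarrow> dbump s = 0"
  by (auto simp: bump_def dbump_def psi_below psi_above dpsi_outside abs_if split: if_splits)

lemma sum_bump: "(\<Sum>m\<in>{-int N..int N}. bump (s - of_int m)) = psi (s + real N + 1) - psi (s - real N)"
proof (induction N)
  case 0
  then show ?case by (simp add: bump_def)
next
  case (Suc N)
  let ?f = "\<lambda>m::int. bump (s - of_int m)"
  have *: "{-int (Suc N)..int (Suc N)} = insert (-int (Suc N)) (insert (int (Suc N)) {-int N..int N})" by auto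
  have "sum ?f {-int (Suc N)..int (Suc N)} = ?f (-int (Suc N)) + (?f (int (Suc N)) + sum ?f {-int N..int N})"
    unfolding * by (subst sum.insert; (subst sum.insert)?; auto)
  also have "\<dots> = psi (s + real (Suc N) + 1) - psi (s - real (Suc N))"
    unfolding Suc by (simp add: bump_def algebra_simps)
  finally show ?case .
qed

section \<open>Hat functions on the cubical grid\<close>

definition grid :: "nat \<Rightarrow> ('n \<Rightarrow> int) set" where
  "grid N = PiE UNIV (\<lambda>_. {-int N..int N})"

definition node :: "real \<Rightarrow> ('n \<Rightarrow> int) \<Rightarrow> real^'n" where
  "node \<epsilon> m = (\<chi> i. \<epsilon> * of_int (m i))"

definition hat :: "real \<Rightarrow> ('n \<Rightarrow> int) \<Rightarrow> real^'n \<Rightarrow> real" where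
  "hat \<epsilon> m x = (\<Prod>i\<in>UNIV. bump (x $ i / \<epsilon> - of_int (m i)))"

definition hat_grad :: "real \<Rightarrow> ('n \<Rightarrow> int) \<Rightarrow> real^'n \<Rightarrow> real^'n" where
  "hat_grad \<epsilon> m x = (\<chi> j. dbump (x $ j / \<epsilon> - of_int (m j)) / \<epsilon> *
     (\<Prod>i\<in>UNIV - {j}. bump (x $ i / \<epsilon> - of_int (m i))))"

definition near :: "real \<Rightarrow> ('n \<Rightarrow> int) \<Rightarrow> real^'n \<Rightarrow> bool" where
  "near \<epsilon> m x \<longleftrightarrow> (\<forall>i. \<bar>x $ i / \<epsilon> - of_int (m i)\<bar> < 1)"

lemma finite_grid: "finite (grid N :: ('n::finite \<Rightarrow> int) set)"
  unfolding grid_def by (intro finite_PiE) auto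

lemma C1_hat:
  fixes m :: "'n::finite \<Rightarrow> int"
  assumes \<epsilon>: "\<epsilon> > 0" shows "C1_fun (hat \<epsilon> m) (hat_grad \<epsilon> m)"
  unfolding C1_fun_def
proof (intro conjI allI)
  fix x :: "real^'n"
  have D: "((\<lambda>x. bump (x $ i / \<epsilon> - of_int (m i))) has_derivative
      (\<lambda>h. dbump (x $ i / \<epsilon> - of_int (m i)) / \<epsilon> * h $ i)) (at x)" for i
  proof -
    have "((\<lambda>x. x $ i / \<epsilon> - of_int (m i)) has_derivative (\<lambda>h. h $ i / \<epsilon>)) (at x)"
    proof -
      have "((\<lambda>x. (1 / \<epsilon>) *\<^sub>R (x $ i) - of_int (m i)) has_derivative (\<lambda>h. (1 / \<epsilon>) *\<^sub>R (h $ i) - 0)) (at x)"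
        by (intro has_derivative_diff has_derivative_scaleR_right has_derivative_const
            bounded_linear.has_derivative[OF bounded_linear_vec_nth] has_derivative_ident)
      then show ?thesis by simp
    qed
    from has_derivative_compose[OF this has_real_derivative_bump[unfolded has_field_derivative_def]]
    show ?thesis by simp
  qed
  have "(hat \<epsilon> m has_derivative (\<lambda>h. \<Sum>j\<in>UNIV. dbump (x $ j / \<epsilon> - of_int (m j)) / \<epsilon> * h $ j *
      (\<Prod>i\<in>UNIV - {j}. bump (x $ i / \<epsilon> - of_int (m i))))) (at x)"
    unfolding hat_def[abs_def] by (rule has_derivative_prod) (rule D)
  then show "(hat \<epsilon> m has_derivative (\<bullet>) (hat_grad \<epsilon> m x)) (at x)"
    by (rule has_derivative_eq_rhs) (auto simp: fun_eq_iff hat_grad_def inner_vec_def algebra_simps intro!: sum.cong)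
  have cb: "continuous_on S f \<Longrightarrow> continuous_on S (\<lambda>x. bump (f x))" for S and f :: "real^'n \<Rightarrow> real"
    unfolding bump_def by (intro continuous_intros)
  show "continuous_on UNIV (hat_grad \<epsilon> m)"
    unfolding hat_grad_def[abs_def] using \<epsilon> by (intro continuous_intros cb) auto
qed

lemma hat_nonneg: "0 \<le> hat \<epsilon> m x"
  unfolding hat_def by (intro prod_nonneg) (simp add: bump_bounds)

lemma hat_far: "\<not> near \<epsilon> m x \<Longrightarrow> hat \<epsilon> m x = 0" "\<not> near \<epsilon> m x \<Longrightarrow> hat_grad \<epsilon> m x = 0"
proof -
  assume "\<not> near \<epsilon> m x"
  then obtain i where i: "1 \<le> \<bar>x $ i / \<epsilon> - of_int (m i)\<bar>" by (auto simp: near_def not_less)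
  then show "hat \<epsilon> m x = 0" unfolding hat_def by (intro prod_zero bexI[of _ i]) (auto simp: bump_outside)
  have "hat_grad \<epsilon> m x $ j = 0" for j
  proof (cases "j = i")
    case True
    then show ?thesis using i by (simp add: hat_grad_def bump_outside)
  next
    case False
    then have "(\<Prod>k\<in>UNIV - {j}. bump (x $ k / \<epsilon> - of_int (m k))) = 0"
      using i by (intro prod_zero bexI[of _ i]) (auto simp: bump_outside)
    then show ?thesis by (simp add: hat_grad_def)
  qed
  then show "hat_grad \<epsilon> m x = 0" by (simp add: vec_eq_iff)
qed

lemma abs_hat_grad_le: "\<epsilon> > 0 \<Longrightarrow> \<bar>hat_grad \<epsilon> m x $ j\<bar> \<le> 2 / \<epsilon>"
proof -
  assume \<epsilon>: "\<epsilon> > 0"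
  have "\<bar>\<Prod>i\<in>UNIV - {j}. bump (x $ i / \<epsilon> - of_int (m i))\<bar> \<le> 1"
    unfolding abs_prod by (intro prod_le_1) (auto simp: bump_bounds)
  then have "\<bar>dbump (x $ j / \<epsilon> - of_int (m j))\<bar> / \<epsilon> * \<bar>\<Prod>i\<in>UNIV - {j}. bump (x $ i / \<epsilon> - of_int (m i))\<bar>
      \<le> 2 / \<epsilon> * 1"
    using abs_dbump_le \<epsilon> by (intro mult_mono divide_right_mono) auto
  then show ?thesis using \<epsilon> by (simp add: hat_grad_def abs_mult)
qed

lemma norm_diff_node_le:
  fixes x :: "real^'n"
  assumes "near \<epsilon> m x" "\<epsilon> > 0" shows "norm (x - node \<epsilon> m) \<le> real CARD('n) * \<epsilon>"
proof -
  have "\<bar>(x - node \<epsilon> m) $ i\<bar> \<le> \<epsilon>" for i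
  proof -
    have "(x - node \<epsilon> m) $ i = \<epsilon> * (x $ i / \<epsilon> - of_int (m i))"
      using assms(2) by (simp add: node_def field_simps)
    moreover have "\<bar>x $ i / \<epsilon> - of_int (m i)\<bar> \<le> 1" using assms(1) by (simp add: near_def less_imp_le)
    ultimately show ?thesis using assms(2) by (simp add: abs_mult mult_left_le)
  qed
  then show ?thesis by (rule norm_le_card_bound)
qed

text \<open>In each coordinate only the floor of \<open>x $ i / \<epsilon>\<close> and its successor
  are possible.\<close>

lemma card_near_le:
  fixes x :: "real^'n"
  shows "card {m \<in> grid N. near \<epsilon> m x} \<le> 2 ^ CARD('n)"
proof -
  let ?S = "PiE UNIV (\<lambda>i. {\<lfloor>x $ i / \<epsilon>\<rfloor>, \<lfloor>x $ i / \<epsilon>\<rfloor> + 1})"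
  have "{m \<in> grid N. near \<epsilon> m x} \<subseteq> ?S"
  proof
    fix m assume "m \<in> {m \<in> grid N. near \<epsilon> m x}"
    then have "\<bar>x $ i / \<epsilon> - of_int (m i)\<bar> < 1" for i by (simp add: near_def)
    then have "real_of_int (m i) < x $ i / \<epsilon> + 1" "x $ i / \<epsilon> < real_of_int (m i) + 1" for i
      unfolding abs_less_iff by (smt (verit))+
    note * = this
    have "m i - 1 \<le> \<lfloor>x $ i / \<epsilon>\<rfloor>" "\<lfloor>x $ i / \<epsilon>\<rfloor> < m i + 1" for i
      unfolding le_floor_iff floor_less_iff using *(1)[of i] *(2)[of i] by simp_all
    then have "m i = \<lfloor>x $ i / \<epsilon>\<rfloor> \<or> m i = \<lfloor>x $ i / \<epsilon>\<rfloor> + 1" for i by (smt (verit))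
    then show "m \<in> ?S" by auto
  qed
  moreover have "finite ?S" by (intro finite_PiE) auto
  ultimately have "card {m \<in> grid N. near \<epsilon> m x} \<le> card ?S" by (intro card_mono)
  also have "\<dots> = 2 ^ CARD('n)" by (subst card_PiE) (auto simp: numeral_2_eq_2)
  finally show ?thesis .
qed

lemma sum_hat:
  fixes x :: "real^'n"
  shows "(\<Sum>m\<in>grid N. hat \<epsilon> m x) = (\<Prod>i\<in>UNIV. psi (x $ i / \<epsilon> + real N + 1) - psi (x $ i / \<epsilon> - real N))"
proof -
  have "(\<Prod>i\<in>(UNIV::'n set). \<Sum>k\<in>{-int N..int N}. bump (x $ i / \<epsilon> - of_int k))
     = (\<Sum>m\<in>PiE UNIV (\<lambda>_. {-int N..int N}). \<Prod>i\<in>UNIV. bump (x $ i / \<epsilon> - of_int (m i)))"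
    by (rule prod_sum_PiE) auto
  then show ?thesis by (simp add: sum_bump grid_def hat_def)
qed

lemma sum_hat_le_1: "(\<Sum>m\<in>grid N. hat \<epsilon> m x) \<le> 1"
  unfolding sum_hat
proof (intro prod_le_1 conjI)
  fix i
  show "0 \<le> psi (x $ i / \<epsilon> + real N + 1) - psi (x $ i / \<epsilon> - real N)"
    using psi_mono[of "x $ i / \<epsilon> - real N" "x $ i / \<epsilon> + real N + 1"] by simp
  show "psi (x $ i / \<epsilon> + real N + 1) - psi (x $ i / \<epsilon> - real N) \<le> 1"
    using psi_bounds[of "x $ i / \<epsilon> + real N + 1"] psi_bounds[of "x $ i / \<epsilon> - real N"] by linarith
qed

text \<open>The added 1 makes \<open>gridsize_gt\<close> strict: the hats then add up to one on a
  neighbourhood of the ball of radius \<open>R\<close>, as \<open>sum_hat_grad_eq_0\<close>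
  needs.\<close>

definition gridsize :: "real \<Rightarrow> real \<Rightarrow> nat" where
  "gridsize R \<epsilon> = nat \<lceil>R / \<epsilon>\<rceil> + 1"

lemma gridsize_gt: "\<epsilon> > 0 \<Longrightarrow> R < \<epsilon> * real (gridsize R \<epsilon>)"
proof -
  assume "\<epsilon> > 0"
  have "R / \<epsilon> < real (gridsize R \<epsilon>)" unfolding gridsize_def by linarith
  with \<open>\<epsilon> > 0\<close> show ?thesis by (simp add: field_simps)
qed

lemma sum_hat_eq_1:
  assumes "\<epsilon> > 0" "norm x \<le> \<epsilon> * real N" shows "(\<Sum>m\<in>grid N. hat \<epsilon> m x) = 1"
proof -
  have "\<bar>x $ i / \<epsilon>\<bar> \<le> real N" for i
    using component_le_norm_cart[of x i] assms by (simp add: abs_divide divide_le_eq mult.commute)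
  then have "1 \<le> x $ i / \<epsilon> + real N + 1" "x $ i / \<epsilon> - real N \<le> 0" for i
    unfolding abs_le_iff by (smt (verit))+
  then show ?thesis by (simp only: sum_hat psi_above psi_below) simp
qed

text \<open>The sum of the hats is constantly one near \<open>x\<close>.\<close>

lemma sum_hat_grad_eq_0:
  fixes x :: "real^'n"
  assumes \<epsilon>: "\<epsilon> > 0" and x: "norm x < \<epsilon> * real N" shows "(\<Sum>m\<in>grid N. hat_grad \<epsilon> m x) = 0"
proof -
  let ?s = "\<lambda>x::real^'n. \<Sum>m\<in>grid N. hat \<epsilon> m x"
  have "C1_fun ?s (\<lambda>x. \<Sum>m\<in>grid N. hat_grad \<epsilon> m x)"
    by (intro C1_fun_sum C1_hat \<epsilon>)
  then have 1: "(?s has_derivative (\<bullet>) (\<Sum>m\<in>grid N. hat_grad \<epsilon> m x)) (at x)" by (simp add: C1_fun_def)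
  have "((\<lambda>x. 1::real) has_derivative (\<lambda>h. 0)) (at x)" by simp
  then have 2: "(?s has_derivative (\<lambda>h. 0)) (at x)"
    by (rule has_derivative_transform_within_open[OF _ open_ball[of 0 "\<epsilon> * real N"]])
       (use x \<epsilon> in \<open>auto simp: sum_hat_eq_1\<close>)
  have "(\<bullet>) (\<Sum>m\<in>grid N. hat_grad \<epsilon> m x) = (\<lambda>h. 0)" using 1 2 by (rule has_derivative_unique)
  then have "(\<Sum>m\<in>grid N. hat_grad \<epsilon> m x) \<bullet> (\<Sum>m\<in>grid N. hat_grad \<epsilon> m x) = 0" by (rule fun_cong)
  then show ?thesis by (simp only: inner_eq_zero_iff)
qed

text \<open>At most \<open>2 ^ CARD('n)\<close> nodes are near \<open>x\<close>, and each gradient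
  entry is at most \<open>2 / \<epsilon>\<close>. The absolute value of \<open>A\<close> covers the
  case without near nodes, where \<open>A\<close> may be negative.\<close>

lemma abs_sum_hat_grad_le:
  fixes x :: "real^'n"
  assumes \<epsilon>: "\<epsilon> > 0" and a: "\<And>m. near \<epsilon> m x \<Longrightarrow> \<bar>a m\<bar> \<le> A"
  shows "\<bar>\<Sum>m\<in>grid N. hat_grad \<epsilon> m x $ j * a m\<bar> \<le> 2 ^ (CARD('n) + 1) / \<epsilon> * \<bar>A\<bar>"
proof -
  let ?S = "{m \<in> grid N. near \<epsilon> m x}"
  have "(\<Sum>m\<in>grid N. hat_grad \<epsilon> m x $ j * a m) = (\<Sum>m\<in>?S. hat_grad \<epsilon> m x $ j * a m)"
    using finite_grid by (intro sum.mono_neutral_right) (auto simp: hat_far)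
  also have "\<bar>\<dots>\<bar> \<le> (\<Sum>m\<in>?S. 2 / \<epsilon> * \<bar>A\<bar>)"
  proof (intro order.trans[OF sum_abs] sum_mono)
    fix m assume "m \<in> ?S"
    then have "\<bar>a m\<bar> \<le> \<bar>A\<bar>" using a[of m] by auto
    then show "\<bar>hat_grad \<epsilon> m x $ j * a m\<bar> \<le> 2 / \<epsilon> * \<bar>A\<bar>"
      unfolding abs_mult using abs_hat_grad_le[OF \<epsilon>] \<epsilon> by (intro mult_mono) auto
  qed
  also have "\<dots> = real (card ?S) * (2 / \<epsilon> * \<bar>A\<bar>)" by simp
  also have "\<dots> \<le> 2 ^ CARD('n) * (2 / \<epsilon> * \<bar>A\<bar>)"
    using card_near_le[of N \<epsilon> x] \<epsilon>
    by (intro mult_right_mono) (auto simp flip: of_nat_le_iff)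
  finally show ?thesis by (simp add: mult_ac)
qed

text \<open>Interpolates the indicator of those nodes whose ball of radius
  \<open>CARD('n) * \<epsilon>\<close> lies in \<open>\<Omega>\<close>. A hat reaches at most that
  far from its node; the way from \<open>x\<close> to a node and on to the edge of its ball gives
  the factor 2.\<close>

lemma ex_cutoff:
  fixes \<Omega> :: "(real^'n) set"
  assumes \<Omega>: "bounded \<Omega>" and \<epsilon>: "\<epsilon> > 0"
  obtains c X where "cutoff \<Omega> c X" "\<And>x. cball x (2 * real CARD('n) * \<epsilon>) \<subseteq> \<Omega> \<Longrightarrow> c x = 1"
    "\<And>x j. \<bar>X x $ j\<bar> \<le> 2 ^ (CARD('n) + 1) / \<epsilon>"
proof -
  obtain R where R: "\<And>x. x \<in> \<Omega> \<Longrightarrow> norm x \<le> R" using \<Omega> by (auto simp: bounded_iff)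
  define N where "N = gridsize R \<epsilon>"
  define g :: "real^'n \<Rightarrow> real" where "g z = (if cball z (real CARD('n) * \<epsilon>) \<subseteq> \<Omega> then 1 else 0)" for z
  define c where "c x = (\<Sum>m\<in>grid N. hat \<epsilon> m x * g (node \<epsilon> m))" for x
  define X where "X x = (\<Sum>m\<in>grid N. g (node \<epsilon> m) *\<^sub>R hat_grad \<epsilon> m x)" for x
  have g: "0 \<le> g z" "g z \<le> 1" for z by (auto simp: g_def)
  have "C1_fun c X"
  proof -
    have "C1_fun (\<lambda>x. \<Sum>m\<in>grid N. hat \<epsilon> m x * g (node \<epsilon> m))
        (\<lambda>x. \<Sum>m\<in>grid N. hat \<epsilon> m x *\<^sub>R 0 + g (node \<epsilon> m) *\<^sub>R hat_grad \<epsilon> m x)"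
      by (intro C1_fun_sum C1_fun_mult C1_hat C1_fun_const \<epsilon>)
    then show ?thesis by (simp add: c_def[abs_def] X_def[abs_def])
  qed
  moreover have "0 \<le> c x \<and> c x \<le> 1" for x
  proof
    show "0 \<le> c x" unfolding c_def by (intro sum_nonneg mult_nonneg_nonneg hat_nonneg g)
    have "c x \<le> (\<Sum>m\<in>grid N. hat \<epsilon> m x * 1)"
      unfolding c_def by (intro sum_mono mult_left_mono hat_nonneg g)
    then show "c x \<le> 1" using sum_hat_le_1[of \<epsilon> x N] by simp
  qed
  moreover have "c x = 0" if "x \<notin> \<Omega>" for x
    unfolding c_def
  proof (intro sum.neutral ballI)
    fix m :: "'n \<Rightarrow> int" assume "m \<in> grid N"
    show "hat \<epsilon> m x * g (node \<epsilon> m) = 0"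
    proof (cases "near \<epsilon> m x")
      case True
      then have "x \<in> cball (node \<epsilon> m) (real CARD('n) * \<epsilon>)"
        using norm_diff_node_le[OF True \<epsilon>] by (simp add: dist_norm norm_minus_commute)
      then show ?thesis using that by (auto simp: g_def)
    qed (simp add: hat_far)
  qed
  moreover have "c x = 1" if x: "cball x (2 * real CARD('n) * \<epsilon>) \<subseteq> \<Omega>" for x
  proof -
    have "x \<in> \<Omega>" using x \<epsilon> by auto
    then have "norm x \<le> \<epsilon> * real N" using R gridsize_gt[OF \<epsilon>, of R] by (force simp: N_def)
    then have 1: "(\<Sum>m\<in>grid N. hat \<epsilon> m x) = 1" by (rule sum_hat_eq_1[OF \<epsilon>])
    have "hat \<epsilon> m x * g (node \<epsilon> m) = hat \<epsilon> m x" for m :: "'n \<Rightarrow> int"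
    proof (cases "near \<epsilon> m x")
      case True
      have "cball (node \<epsilon> m) (real CARD('n) * \<epsilon>) \<subseteq> cball x (2 * real CARD('n) * \<epsilon>)"
      proof
        fix z assume "z \<in> cball (node \<epsilon> m) (real CARD('n) * \<epsilon>)"
        then show "z \<in> cball x (2 * real CARD('n) * \<epsilon>)"
          using norm_diff_node_le[OF True \<epsilon>] dist_triangle[of x z "node \<epsilon> m"] by (simp add: dist_norm)
      qed
      then have "g (node \<epsilon> m) = 1" using x by (auto simp: g_def)
      then show ?thesis by simp
    qed (simp add: hat_far)
    then show ?thesis by (simp only: c_def 1)
  qed
  moreover have "\<bar>X x $ j\<bar> \<le> 2 ^ (CARD('n) + 1) / \<epsilon>" for x j
  proof -
    have "X x $ j = (\<Sum>m\<in>grid N. hat_grad \<epsilon> m x $ j * g (node \<epsilon> m))"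
      by (simp add: X_def sum_component mult.commute)
    then show ?thesis
      using abs_sum_hat_grad_le[OF \<epsilon>, where x=x and a="\<lambda>m. g (node \<epsilon> m)" and A=1 and N=N and j=j] g by simp
  qed
  ultimately show ?thesis by (intro that[of c X]) (simp_all add: cutoff_def)
qed

text \<open>Nodal values averaged by the partition of unity. At fixed \<open>\<epsilon>\<close> only
  finitely many values of \<open>V\<close> enter, so uniform closeness of two maps gives closeness
  of the Jacobians \<open>qim\<close> too.\<close>

definition qi :: "real \<Rightarrow> real \<Rightarrow> (real^'n \<Rightarrow> real^'n) \<Rightarrow> real^'n \<Rightarrow> real^'n" where
  "qi R \<epsilon> V x = (\<Sum>m\<in>grid (gridsize R \<epsilon>). hat \<epsilon> m x *\<^sub>R V (node \<epsilon> m))"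

definition qim :: "real \<Rightarrow> real \<Rightarrow> (real^'n \<Rightarrow> real^'n) \<Rightarrow> real^'n \<Rightarrow> real^'n^'n" where
  "qim R \<epsilon> V x = (\<chi> i j. \<Sum>m\<in>grid (gridsize R \<epsilon>). hat_grad \<epsilon> m x $ j * V (node \<epsilon> m) $ i)"

lemma C1_map_qi: "\<epsilon> > 0 \<Longrightarrow> C1_map (qi R \<epsilon> V) (qim R \<epsilon> V)"
proof (rule C1_mapI)
  fix i assume \<epsilon>: "\<epsilon> > 0"
  have "C1_fun (\<lambda>x. \<Sum>m\<in>grid (gridsize R \<epsilon>). hat \<epsilon> m x * V (node \<epsilon> m) $ i)
      (\<lambda>x. \<Sum>m\<in>grid (gridsize R \<epsilon>). hat \<epsilon> m x *\<^sub>R 0 + V (node \<epsilon> m) $ i *\<^sub>R hat_grad \<epsilon> m x)"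
    by (intro C1_fun_sum C1_fun_mult C1_hat C1_fun_const \<epsilon>)
  moreover have "(\<lambda>x. \<Sum>m\<in>grid (gridsize R \<epsilon>). hat \<epsilon> m x *\<^sub>R 0 + V (node \<epsilon> m) $ i *\<^sub>R hat_grad \<epsilon> m x)
      = (\<lambda>x. qim R \<epsilon> V x $ i)"
    by (auto simp: fun_eq_iff qim_def vec_eq_iff sum_component mult.commute)
  ultimately show "C1_fun (\<lambda>x. qi R \<epsilon> V x $ i) (\<lambda>x. qim R \<epsilon> V x $ i)"
    by (simp add: qi_def sum_component)
qed

lemma norm_qi_diff_le:
  assumes "\<And>z. norm (V z - V' z) \<le> \<eta>"
  shows "norm (qi R \<epsilon> V x - qi R \<epsilon> V' x) \<le> \<eta>"
proof -
  have \<eta>: "0 \<le> \<eta>" using assms order.trans norm_ge_zero by blast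
  have "norm (qi R \<epsilon> V x - qi R \<epsilon> V' x) \<le> (\<Sum>m\<in>grid (gridsize R \<epsilon>). hat \<epsilon> m x * \<eta>)"
    unfolding qi_def sum_subtractf[symmetric] scaleR_diff_right[symmetric]
    by (intro sum_norm_le) (auto simp: hat_nonneg intro!: mult_left_mono assms)
  also have "\<dots> \<le> 1 * \<eta>"
    unfolding sum_distrib_right[symmetric] by (intro mult_right_mono sum_hat_le_1 \<eta>)
  finally show ?thesis by simp
qed

lemma abs_qim_diff_le:
  fixes V V' :: "real^'n \<Rightarrow> real^'n"
  assumes "\<And>z. norm (V z - V' z) \<le> \<eta>" "\<epsilon> > 0"
  shows "\<bar>qim R \<epsilon> V x $ i $ j - qim R \<epsilon> V' x $ i $ j\<bar> \<le> 2 ^ (CARD('n) + 1) / \<epsilon> * \<bar>\<eta>\<bar>"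
proof -
  have "qim R \<epsilon> V x $ i $ j - qim R \<epsilon> V' x $ i $ j
     = (\<Sum>m\<in>grid (gridsize R \<epsilon>). hat_grad \<epsilon> m x $ j * (V (node \<epsilon> m) - V' (node \<epsilon> m)) $ i)"
    by (simp add: qim_def sum_subtractf[symmetric] algebra_simps)
  moreover have "\<bar>(V z - V' z) $ i\<bar> \<le> \<eta>" for z
    using component_le_norm_cart[of "V z - V' z" i] assms(1)[of z] by linarith
  ultimately show ?thesis
    using abs_sum_hat_grad_le[OF assms(2), where x=x and j=j and N="gridsize R \<epsilon>" and A=\<eta>
      and a="\<lambda>m. (V (node \<epsilon> m) - V' (node \<epsilon> m)) $ i"] by simp
qed

definition holder_on_space :: "real \<Rightarrow> real \<Rightarrow> (real^'n \<Rightarrow> real^'n) \<Rightarrow> bool" where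
  "holder_on_space \<alpha> H V \<longleftrightarrow> 0 \<le> H \<and> (\<forall>x y. norm (V x - V y) \<le> H * norm (x - y) powr \<alpha>)"

lemma holder_near:
  fixes V :: "real^'n \<Rightarrow> real^'n"
  assumes V: "holder_on_space \<alpha> H V" and \<epsilon>: "\<epsilon> > 0" and \<alpha>: "\<alpha> \<ge> 0" and m: "near \<epsilon> m x"
  shows "norm (V (node \<epsilon> m) - V x) \<le> H * (real CARD('n) * \<epsilon>) powr \<alpha>"
proof -
  have "norm (V (node \<epsilon> m) - V x) \<le> H * norm (node \<epsilon> m - x) powr \<alpha>"
    using V by (simp add: holder_on_space_def)
  also have "\<dots> \<le> H * (real CARD('n) * \<epsilon>) powr \<alpha>"
    using norm_diff_node_le[OF m \<epsilon>] V \<alpha>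
    by (intro mult_left_mono powr_mono2) (auto simp: norm_minus_commute holder_on_space_def)
  finally show ?thesis .
qed

lemma norm_qi_approx:
  fixes V :: "real^'n \<Rightarrow> real^'n"
  assumes V: "holder_on_space \<alpha> H V" and \<epsilon>: "\<epsilon> > 0" and \<alpha>: "\<alpha> \<ge> 0" and x: "norm x \<le> R"
  shows "norm (qi R \<epsilon> V x - V x) \<le> H * (real CARD('n) * \<epsilon>) powr \<alpha>"
proof -
  let ?M = "H * (real CARD('n) * \<epsilon>) powr \<alpha>"
  have 1: "(\<Sum>m\<in>grid (gridsize R \<epsilon>). hat \<epsilon> m x) = 1"
    using x gridsize_gt[OF \<epsilon>, of R] by (intro sum_hat_eq_1 \<epsilon>) auto
  have "qi R \<epsilon> V x - V x = (\<Sum>m\<in>grid (gridsize R \<epsilon>). hat \<epsilon> m x *\<^sub>R (V (node \<epsilon> m) - V x))"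
    using 1 by (simp add: qi_def scaleR_diff_right sum_subtractf flip: scaleR_sum_left)
  also have "norm \<dots> \<le> (\<Sum>m\<in>grid (gridsize R \<epsilon>). hat \<epsilon> m x * ?M)"
  proof (intro sum_norm_le)
    fix m
    show "norm (hat \<epsilon> m x *\<^sub>R (V (node \<epsilon> m) - V x)) \<le> hat \<epsilon> m x * ?M"
      using holder_near[OF V \<epsilon> \<alpha>, of m x] hat_far(1)[of \<epsilon> m x] hat_nonneg[of \<epsilon> m x]
      by (cases "near \<epsilon> m x") (auto intro: mult_left_mono)
  qed
  also have "\<dots> = ?M" by (simp add: 1 flip: sum_distrib_right)
  finally show ?thesis .
qed

text \<open>The hat gradients add up to zero, so \<open>V x\<close> may be subtracted from all nodal
  values; what remains is the oscillation of \<open>V\<close> over a distance of order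
  \<open>\<epsilon>\<close>.\<close>

lemma abs_qim_le:
  fixes V :: "real^'n \<Rightarrow> real^'n"
  assumes V: "holder_on_space \<alpha> H V" and \<epsilon>: "\<epsilon> > 0" and \<alpha>: "\<alpha> \<ge> 0" and x: "norm x \<le> R"
  shows "\<bar>qim R \<epsilon> V x $ i $ j\<bar> \<le> 2 ^ (CARD('n) + 1) / \<epsilon> * (H * (real CARD('n) * \<epsilon>) powr \<alpha>)"
proof -
  let ?M = "H * (real CARD('n) * \<epsilon>) powr \<alpha>"
  have M: "0 \<le> ?M" using V by (simp add: holder_on_space_def)
  have "(\<Sum>m\<in>grid (gridsize R \<epsilon>). hat_grad \<epsilon> m x) $ j = 0"
    using x gridsize_gt[OF \<epsilon>, of R] by (subst sum_hat_grad_eq_0[OF \<epsilon>]) auto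
  then have "(\<Sum>m\<in>grid (gridsize R \<epsilon>). hat_grad \<epsilon> m x $ j * V x $ i) = 0"
    by (simp add: sum_component flip: sum_distrib_right)
  then have "qim R \<epsilon> V x $ i $ j = (\<Sum>m\<in>grid (gridsize R \<epsilon>). hat_grad \<epsilon> m x $ j * (V (node \<epsilon> m) - V x) $ i)"
    by (simp add: qim_def sum_subtractf right_diff_distrib)
  moreover have "\<bar>(V (node \<epsilon> m) - V x) $ i\<bar> \<le> ?M" if "near \<epsilon> m x" for m
    using holder_near[OF V \<epsilon> \<alpha> that] component_le_norm_cart order.trans by blast
  ultimately show ?thesis
    using abs_sum_hat_grad_le[OF \<epsilon>, where x=x and a="\<lambda>m. (V (node \<epsilon> m) - V x) $ i" and A="?M"
      and N="gridsize R \<epsilon>" and j=j] M by simp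
qed

subsection \<open>Estimates for the approximate degrees\<close>

text \<open>Exchanges the factors one at a time. The differences are measured in units of
  \<open>a\<close>, which makes the bound a multiple of \<open>a ^ card I\<close>.\<close>

lemma abs_prod_diff_le:
  fixes f g :: "'a \<Rightarrow> real"
  assumes "finite I" "\<And>i. i \<in> I \<Longrightarrow> \<bar>f i\<bar> \<le> a" "\<And>i. i \<in> I \<Longrightarrow> \<bar>g i\<bar> \<le> a"
    "\<And>i. i \<in> I \<Longrightarrow> \<bar>f i - g i\<bar> \<le> a * b" "0 \<le> a" "0 \<le> b"
  shows "\<bar>prod f I - prod g I\<bar> \<le> real (card I) * a ^ card I * b"
  using assms(1-4)
proof (induction I rule: finite_induct)
  case (insert i I)
  have IH: "\<bar>prod f I - prod g I\<bar> \<le> real (card I) * a ^ card I * b" using insert by auto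
  have gI: "\<bar>prod g I\<bar> \<le> a ^ card I"
  proof -
    have "(\<Prod>j\<in>I. \<bar>g j\<bar>) \<le> (\<Prod>j\<in>I. a)" using insert.prems by (intro prod_mono) auto
    then show ?thesis by (simp add: abs_prod)
  qed
  have "prod f (insert i I) - prod g (insert i I) = f i * (prod f I - prod g I) + (f i - g i) * prod g I"
    using insert.hyps by (simp add: algebra_simps)
  also have "\<bar>\<dots>\<bar> \<le> \<bar>f i\<bar> * \<bar>prod f I - prod g I\<bar> + \<bar>f i - g i\<bar> * \<bar>prod g I\<bar>"
    by (rule order.trans[OF abs_triangle_ineq]) (simp add: abs_mult)
  also have "\<dots> \<le> a * (real (card I) * a ^ card I * b) + (a * b) * a ^ card I"
    using insert.prems IH gI assms(5,6) by (intro add_mono mult_mono) auto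
  finally show ?case using insert.hyps by (simp add: algebra_simps)
qed simp

lemma abs_det_diff_le:
  fixes A A' :: "real^'n^'n"
  assumes "\<And>i j. \<bar>A $ i $ j\<bar> \<le> a" "\<And>i j. \<bar>A' $ i $ j\<bar> \<le> a" "\<And>i j. \<bar>A $ i $ j - A' $ i $ j\<bar> \<le> a * b"
    "0 \<le> a" "0 \<le> b"
  shows "\<bar>det A - det A'\<bar> \<le> fact CARD('n) * real CARD('n) * a ^ CARD('n) * b"
proof -
  have "\<bar>det A - det A'\<bar> \<le> (\<Sum>p\<in>{p. p permutes (UNIV::'n set)}.
      \<bar>of_int (sign p) * (\<Prod>i\<in>UNIV. A$i$p i) - of_int (sign p) * (\<Prod>i\<in>UNIV. A'$i$p i)\<bar>)"
    unfolding det_def sum_subtractf[symmetric] by (rule sum_abs)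
  also have "\<dots> \<le> (\<Sum>p\<in>{p. p permutes (UNIV::'n set)}. real CARD('n) * a ^ CARD('n) * b)"
  proof (rule sum_mono)
    fix p :: "'n \<Rightarrow> 'n"
    have "\<bar>(\<Prod>i\<in>UNIV. A$i$p i) - (\<Prod>i\<in>UNIV. A'$i$p i)\<bar> \<le> real CARD('n) * a ^ CARD('n) * b"
      using assms by (intro abs_prod_diff_le) auto
    then show "\<bar>of_int (sign p) * (\<Prod>i\<in>UNIV. A$i$p i) - of_int (sign p) * (\<Prod>i\<in>UNIV. A'$i$p i)\<bar>
        \<le> real CARD('n) * a ^ CARD('n) * b"
      unfolding right_diff_distrib[symmetric] abs_mult by (simp flip: of_int_abs)
  qed
  also have "\<dots> = fact CARD('n) * real CARD('n) * a ^ CARD('n) * b"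
    by (simp add: card_permutations)
  finally show ?thesis .
qed

text \<open>The bumps of the overview: radius of the support, height, and Lipschitz constant in
  \<open>y\<close>. The centre is left unspecified because it varies with \<open>x\<close> and the
  energies are translation invariant.\<close>

definition tame :: "real \<Rightarrow> real \<Rightarrow> real \<Rightarrow> (real^'n \<Rightarrow> real) \<Rightarrow> bool" where
  "tame r M L f \<longleftrightarrow> (\<exists>c. \<forall>y. r < norm (y - c) \<longrightarrow> f y = 0) \<and> (\<forall>y. \<bar>f y\<bar> \<le> M) \<and>
     (\<forall>y y'. \<bar>f y - f y'\<bar> \<le> L * norm (y - y'))"

lemma stepm_bounds:
  fixes A A' :: "real^'n^'n"
  assumes A: "\<And>i j. \<bar>A $ i $ j\<bar> \<le> a" "\<And>i j. \<bar>A' $ i $ j\<bar> \<le> a" "\<And>i j. \<bar>A $ i $ j - A' $ i $ j\<bar> \<le> b"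
    and z: "norm (z - z') \<le> t" and \<delta>: "0 < \<delta>"
  shows "\<bar>stepm \<delta> z A $ i $ j\<bar> \<le> 2 * a / \<delta>"
    "\<bar>stepm \<delta> z A $ i $ j - stepm \<delta> z' A' $ i $ j\<bar> \<le> 16 * t * a / \<delta>\<^sup>2 + 2 * b / \<delta>"
proof -
  have "\<bar>dpsi s\<bar> \<le> 2" for s using dpsi_bounds[of s] by simp
  then have "\<bar>dpsi (z $ i / \<delta>)\<bar> * \<bar>A $ i $ j\<bar> \<le> 2 * a" by (intro mult_mono A) auto
  then show "\<bar>stepm \<delta> z A $ i $ j\<bar> \<le> 2 * a / \<delta>"
    using \<delta> by (simp add: stepm_def abs_mult divide_right_mono)
  have "\<bar>z $ i - z' $ i\<bar> \<le> t" using component_le_norm_cart[of "z - z'" i] z by simp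
  then have "\<bar>z $ i / \<delta> - z' $ i / \<delta>\<bar> \<le> t / \<delta>"
    using \<delta> by (simp add: divide_right_mono flip: diff_divide_distrib)
  then have "\<bar>dpsi (z $ i / \<delta>) - dpsi (z' $ i / \<delta>)\<bar> \<le> 16 * (t / \<delta>)"
    by (intro order.trans[OF dpsi_lipschitz] mult_left_mono) auto
  then have 1: "\<bar>(dpsi (z $ i / \<delta>) - dpsi (z' $ i / \<delta>)) * A $ i $ j\<bar> \<le> 16 * (t / \<delta>) * a"
    unfolding abs_mult by (intro mult_mono A) (auto intro: order.trans[OF abs_ge_zero])
  have 2: "\<bar>dpsi (z' $ i / \<delta>) * (A $ i $ j - A' $ i $ j)\<bar> \<le> 2 * b"
    unfolding abs_mult using \<open>\<And>s. \<bar>dpsi s\<bar> \<le> 2\<close> by (intro mult_mono A) auto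
  have "stepm \<delta> z A $ i $ j - stepm \<delta> z' A' $ i $ j =
      ((dpsi (z $ i / \<delta>) - dpsi (z' $ i / \<delta>)) * A $ i $ j + dpsi (z' $ i / \<delta>) * (A $ i $ j - A' $ i $ j)) / \<delta>"
    using \<delta> by (simp add: stepm_def field_simps)
  also have "\<bar>\<dots>\<bar> \<le> (16 * (t / \<delta>) * a + 2 * b) / \<delta>"
    using 1 2 \<delta> by (simp add: abs_divide divide_right_mono)
  also have "\<dots> = 16 * t * a / \<delta>\<^sup>2 + 2 * b / \<delta>"
    by (simp add: power2_eq_square add_divide_distrib)
  finally show "\<bar>stepm \<delta> z A $ i $ j - stepm \<delta> z' A' $ i $ j\<bar> \<le> 16 * t * a / \<delta>\<^sup>2 + 2 * b / \<delta>" .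
qed

lemma abs_stepv_diff_le:
  assumes "0 < \<delta>" shows "\<bar>stepv \<delta> z $ i - stepv \<delta> z' $ i\<bar> \<le> 2 * norm (z - z') / \<delta>"
proof -
  have "\<bar>z $ i / \<delta> - z' $ i / \<delta>\<bar> \<le> norm (z - z') / \<delta>"
    using assms component_le_norm_cart[of "z - z'" i]
    by (simp add: divide_right_mono flip: diff_divide_distrib)
  then show ?thesis using psi_lipschitz[of "z $ i / \<delta>" "z' $ i / \<delta>"] by (simp add: stepv_def)
qed

lemma blendm_bounds:
  fixes A B :: "real^'n^'n"
  assumes c: "0 \<le> c" "c \<le> 1" and X: "\<And>j. \<bar>X $ j\<bar> \<le> x"
    and A: "\<bar>A $ i $ j\<bar> \<le> m" "\<bar>B $ i $ j\<bar> \<le> m" and a: "\<bar>a $ i - b $ i\<bar> \<le> 1"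
  shows "\<bar>blendm c X a A b B $ i $ j\<bar> \<le> m + x"
proof -
  have "\<bar>(1 - c) * B $ i $ j\<bar> \<le> (1 - c) * m" "\<bar>c * A $ i $ j\<bar> \<le> c * m"
    using c A by (auto simp: abs_mult intro!: mult_left_mono)
  moreover have "\<bar>X $ j * (a $ i - b $ i)\<bar> \<le> x * 1"
    unfolding abs_mult using X[of j] a by (intro mult_mono) auto
  moreover have "blendm c X a A b B $ i $ j = (1 - c) * B $ i $ j + c * A $ i $ j + X $ j * (a $ i - b $ i)"
    by (simp add: blendm_def algebra_simps)
  ultimately show ?thesis by (simp add: algebra_simps)
qed

lemma blendm_diff:
  fixes A B :: "real^'n^'n"
  assumes c: "0 \<le> c" "c \<le> 1" and X: "\<And>j. \<bar>X $ j\<bar> \<le> x"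
    and A: "\<bar>A $ i $ j - A' $ i $ j\<bar> \<le> m" "\<bar>B $ i $ j - B' $ i $ j\<bar> \<le> m"
    and a: "\<bar>a $ i - a' $ i\<bar> \<le> k" "\<bar>b $ i - b' $ i\<bar> \<le> k"
  shows "\<bar>blendm c X a A b B $ i $ j - blendm c X a' A' b' B' $ i $ j\<bar> \<le> m + x * (2 * k)"
proof -
  have "\<bar>(1 - c) * (B $ i $ j - B' $ i $ j)\<bar> \<le> (1 - c) * m" "\<bar>c * (A $ i $ j - A' $ i $ j)\<bar> \<le> c * m"
    using c A by (auto simp: abs_mult intro!: mult_left_mono)
  moreover have "\<bar>X $ j * ((a $ i - a' $ i) - (b $ i - b' $ i))\<bar> \<le> x * (2 * k)"
    unfolding abs_mult using X[of j] a by (intro mult_mono) auto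
  moreover have "blendm c X a A b B $ i $ j - blendm c X a' A' b' B' $ i $ j =
      (1 - c) * (B $ i $ j - B' $ i $ j) + c * (A $ i $ j - A' $ i $ j)
      + X $ j * ((a $ i - a' $ i) - (b $ i - b' $ i))"
    by (simp add: blendm_def algebra_simps)
  ultimately show ?thesis by (simp add: algebra_simps)
qed

section \<open>Dyadic scales and the Jacobians on them\<close>

definition eps :: "nat \<Rightarrow> real" where "eps j = (1/2) ^ j"

lemma eps_pos: "0 < eps j" and eps_le_1: "eps j \<le> 1" and eps_Suc: "eps (Suc j) = eps j / 2"
  by (simp_all add: eps_def power_le_one)

text \<open>The map \<open>V\<close> is not fixed here but an argument throughout, so every constant
  depends on the domain and the Hoelder bound only and serves a whole sequence of maps.\<close>

locale degree_scales =
  fixes \<Omega> :: "(real^'n) set" and R \<alpha> H :: real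
  assumes open_\<Omega>: "open \<Omega>" and bounded_\<Omega>: "bounded \<Omega>"
    and \<Omega>_R: "\<And>x. x \<in> \<Omega> \<Longrightarrow> norm x \<le> R"
    and \<alpha>: "0 < \<alpha>" "\<alpha> \<le> 1" and H: "0 \<le> H"
begin

text \<open>Makes the interpolation error at most half a step width (\<open>holder_scale\<close>),
  so that consecutive interpolants differ by at most one width. The added 1 keeps the widths
  positive when \<open>H\<close> is 0.\<close>

definition "K = 2 * H * real CARD('n) powr \<alpha> + 1"
definition "dl j = K * eps j powr \<alpha>"
definition "C1 = (2 ^ (CARD('n) + 1) :: real)"

lemma K_ge_1: "1 \<le> K" using H by (simp add: K_def)

lemma dl_pos: "0 < dl j" using K_ge_1 eps_pos[of j] by (simp add: dl_def)

lemma C1_ge_1: "1 \<le> C1" unfolding C1_def by (rule one_le_power) simp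

lemma dl_Suc: "dl (Suc j) \<le> dl j" "dl j \<le> 2 * dl (Suc j)"
proof -
  have e: "eps (Suc j) powr \<alpha> = eps j powr \<alpha> / 2 powr \<alpha>"
    using eps_pos[of j] by (simp add: eps_Suc powr_divide)
  have t: "1 \<le> 2 powr \<alpha>" "2 powr \<alpha> \<le> 2"
    using \<alpha> ge_one_powr_ge_zero[of 2 \<alpha>] powr_mono[of \<alpha> 1 "2::real"] by auto
  then have *: "eps j powr \<alpha> / 2 powr \<alpha> \<le> eps j powr \<alpha>" "eps j powr \<alpha> \<le> 2 * (eps j powr \<alpha> / 2 powr \<alpha>)"
    using mult_left_mono[OF t(1), of "eps j powr \<alpha>"] mult_left_mono[OF t(2), of "eps j powr \<alpha>"]
    by (auto simp: divide_le_eq le_divide_eq mult.commute)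
  show "dl (Suc j) \<le> dl j" "dl j \<le> 2 * dl (Suc j)"
    using mult_left_mono[OF *(1), of K] mult_left_mono[OF *(2), of K] K_ge_1
    unfolding dl_def e by (simp_all add: mult_ac)
qed

lemma holder_scale: "H * (real CARD('n) * eps j) powr \<alpha> \<le> dl j / 2"
  using eps_pos[of j] by (simp add: dl_def K_def powr_mult algebra_simps)

text \<open>One cutoff is chosen per scale; the layers are thus the same for all
  \<open>V\<close>.\<close>

definition "cg j = (SOME cX. cutoff \<Omega> (fst cX) (snd cX) \<and>
   (\<forall>x. cball x (2 * real CARD('n) * eps j) \<subseteq> \<Omega> \<longrightarrow> fst cX x = 1) \<and> (\<forall>x k. \<bar>snd cX x $ k\<bar> \<le> C1 / eps j))"

definition "cutf j = fst (cg j)"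
definition "cutg j = snd (cg j)"

lemma cut: "cutoff \<Omega> (cutf j) (cutg j)"
  and cut_eq_1: "cball x (2 * real CARD('n) * eps j) \<subseteq> \<Omega> \<Longrightarrow> cutf j x = 1"
  and cutg_le: "\<bar>cutg j x $ k\<bar> \<le> C1 / eps j"
proof -
  obtain c X where cX: "cutoff \<Omega> c X" "\<And>x. cball x (2 * real CARD('n) * eps j) \<subseteq> \<Omega> \<Longrightarrow> c x = 1"
    "\<And>x k. \<bar>X x $ k\<bar> \<le> 2 ^ (CARD('n) + 1) / eps j"
    by (rule ex_cutoff[OF bounded_\<Omega> eps_pos[of j]]) blast
  have "\<exists>cX. cutoff \<Omega> (fst cX) (snd cX) \<and> (\<forall>x. cball x (2 * real CARD('n) * eps j) \<subseteq> \<Omega> \<longrightarrow> fst cX x = 1)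
      \<and> (\<forall>x k. \<bar>snd cX x $ k\<bar> \<le> C1 / eps j)"
    using cX by (intro exI[of _ "(c, X)"]) (simp add: C1_def)
  from someI_ex[OF this] have *: "cutoff \<Omega> (cutf j) (cutg j)"
    "\<forall>x. cball x (2 * real CARD('n) * eps j) \<subseteq> \<Omega> \<longrightarrow> cutf j x = 1" "\<forall>x k. \<bar>cutg j x $ k\<bar> \<le> C1 / eps j"
    unfolding cutf_def cutg_def cg_def by blast+
  then show "cutoff \<Omega> (cutf j) (cutg j)" "\<bar>cutg j x $ k\<bar> \<le> C1 / eps j"
    "cball x (2 * real CARD('n) * eps j) \<subseteq> \<Omega> \<Longrightarrow> cutf j x = 1" by blast+
qed

abbreviation u :: "(real^'n \<Rightarrow> real^'n) \<Rightarrow> nat \<Rightarrow> real^'n \<Rightarrow> real^'n" where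
  "u V j \<equiv> qi R (eps j) V"
abbreviation U :: "(real^'n \<Rightarrow> real^'n) \<Rightarrow> nat \<Rightarrow> real^'n \<Rightarrow> real^'n^'n" where
  "U V j \<equiv> qim R (eps j) V"

text \<open>\<open>A\<close> is the integrand of the mollified degree; \<open>B\<close>, the
  determinant of \<open>BM\<close>, belongs to the blend of scale \<open>j\<close> inside with scale
  \<open>Suc j\<close> near the boundary.\<close>

definition "A V j y x = det (stepm (dl j) (u V j x - y) (U V j x))"
definition "BM V j x y = blendm (cutf j x) (cutg j x)
     (stepv (dl j) (u V j x - y)) (stepm (dl j) (u V j x - y) (U V j x))
     (stepv (dl (Suc j)) (u V (Suc j) x - y)) (stepm (dl (Suc j)) (u V (Suc j) x - y) (U V (Suc j) x))"
definition "B V j y x = det (BM V j x y)"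
definition "F V j y = (LINT x:\<Omega>|lborel. A V j y x)"
definition "layer j = {x \<in> \<Omega>. cutf j x \<noteq> 1}"

lemma C1_map_shift: "C1_map g G \<Longrightarrow> C1_map (\<lambda>x. g x - y) G"
  by (auto simp: C1_map_def intro!: derivative_eq_intros)

lemma u_approx: "holder_on_space \<alpha> H V \<Longrightarrow> x \<in> \<Omega> \<Longrightarrow> norm (u V j x - V x) \<le> dl j / 2"
  using norm_qi_approx[OF _ eps_pos, of \<alpha> H V x R j] holder_scale[of j] \<Omega>_R[of x] \<alpha> by simp

lemma u_Suc: "holder_on_space \<alpha> H V \<Longrightarrow> x \<in> \<Omega> \<Longrightarrow> norm (u V j x - u V (Suc j) x) \<le> dl j"
  using norm_triangle_ineq4[of "u V j x - V x" "u V (Suc j) x - V x"]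
    u_approx[of V x j] u_approx[of V x "Suc j"] dl_Suc(1)[of j] by simp

lemma U_le: "holder_on_space \<alpha> H V \<Longrightarrow> x \<in> \<Omega> \<Longrightarrow> \<bar>U V j x $ i $ k\<bar> \<le> C1 * dl j / eps j"
proof -
  assume V: "holder_on_space \<alpha> H V" and x: "x \<in> \<Omega>"
  have "\<bar>U V j x $ i $ k\<bar> \<le> C1 / eps j * (H * (real CARD('n) * eps j) powr \<alpha>)"
    using abs_qim_le[OF V eps_pos _ \<Omega>_R[OF x]] \<alpha> by (simp add: C1_def)
  also have "\<dots> \<le> C1 / eps j * dl j"
    using holder_scale[of j] dl_pos[of j] eps_pos[of j] C1_ge_1 by (intro mult_left_mono) auto
  finally show ?thesis by simp
qed

lemma continuous_on_stepm [continuous_intros]: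
  assumes "continuous_on S z" "continuous_on S M" "\<delta> \<noteq> 0"
  shows "continuous_on S (\<lambda>x. stepm \<delta> (z x) (M x))"
  unfolding stepm_def using assms by (intro continuous_intros) auto

lemma continuous_on_stepv [continuous_intros]:
  assumes "continuous_on S z" "\<delta> \<noteq> 0"
  shows "continuous_on S (\<lambda>x. stepv \<delta> (z x))"
  unfolding stepv_def using assms by (intro continuous_intros) auto

lemma continuous_on_blendm [continuous_intros]:
  assumes "continuous_on S c" "continuous_on S X" "continuous_on S a" "continuous_on S M"
    "continuous_on S b" "continuous_on S N"
  shows "continuous_on S (\<lambda>x. blendm (c x) (X x) (a x) (M x) (b x) (N x))"
  unfolding blendm_def using assms by (intro continuous_intros) auto

lemma cont_u: "continuous_on S (u V j)" and cont_U: "continuous_on S (U V j)"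
  using C1_map_continuous[OF C1_map_qi[OF eps_pos]] C1_map_continuous'[OF C1_map_qi[OF eps_pos]] by auto

lemma cont_cut: "continuous_on S (cutf j)" "continuous_on S (cutg j)"
  using cut[of j] C1_fun_continuous C1_fun_continuous' by (auto simp: cutoff_def)

lemma dl_nz: "dl j \<noteq> 0" using dl_pos[of j] by simp

lemma continuous_A: "continuous_on UNIV (\<lambda>(y, x). A V j y x)"
  unfolding A_def split_beta
  by (intro continuous_intros continuous_on_compose2[OF cont_u] continuous_on_compose2[OF cont_U] dl_nz)
    auto

lemma continuous_B: "continuous_on UNIV (\<lambda>(y, x). B V j y x)"
  unfolding B_def BM_def split_beta
  by (intro continuous_intros continuous_on_compose2[OF cont_u] continuous_on_compose2[OF cont_U]
      continuous_on_compose2[OF cont_cut(1)] continuous_on_compose2[OF cont_cut(2)] dl_nz) auto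

text \<open>\<open>E j\<close> bounds the entries of the Jacobian matrices at scale \<open>j\<close>, \<open>Mb j\<close> their determinants and,
  divided by \<open>dl j\<close>, the Lipschitz constants of the determinants in \<open>y\<close>.\<close>

definition "E j = 5 * C1 / eps j"
definition "Mb j = 30 * fact CARD('n) * real CARD('n) * E j ^ CARD('n)"

lemma E_pos: "0 < E j" using C1_ge_1 eps_pos[of j] by (simp add: E_def)

lemma Mb_pos: "0 < Mb j" using E_pos[of j] by (simp add: Mb_def)

lemma stepm_le:
  assumes "holder_on_space \<alpha> H V" "x \<in> \<Omega>"
  shows "\<bar>stepm (dl j) z (U V j x) $ i $ k\<bar> \<le> 2 * C1 / eps j"
    and "\<bar>stepm (dl j) z (U V j x) $ i $ k - stepm (dl j) z' (U V j x) $ i $ k\<bar>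
      \<le> 16 * C1 / eps j * (norm (z - z') / dl j)"
  using stepm_bounds[of "U V j x" "C1 * dl j / eps j" "U V j x" 0 z z' "norm (z - z')" "dl j" i k]
    U_le[OF assms] dl_pos[of j] eps_pos[of j]
  by (simp_all add: power2_eq_square field_simps)

text \<open>Lets \<open>Mb\<close> bound the determinants as well as their Lipschitz constants,
  which carry the additional factor \<open>15 * CARD('n)\<close>.\<close>

lemma Mb_aux: "fact CARD('n) * E j ^ CARD('n) \<le> 15 * real CARD('n) * (fact CARD('n) * E j ^ CARD('n))"
proof -
  have "1 \<le> CARD('n)" by (simp add: Suc_le_eq)
  then have "1 \<le> 15 * real CARD('n)" by linarith
  moreover have "0 \<le> fact CARD('n) * E j ^ CARD('n)" using E_pos[of j] by simp
  ultimately show ?thesis using mult_right_mono by fastforce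
qed

text \<open>Half of \<open>Mb j\<close>, as for \<open>B\<close>, so that the difference of
  \<open>B\<close> and \<open>A\<close> is bounded by the full \<open>Mb j\<close>.\<close>

lemma A_le: "holder_on_space \<alpha> H V \<Longrightarrow> x \<in> \<Omega> \<Longrightarrow> \<bar>A V j y x\<bar> \<le> Mb j / 2"
proof -
  assume V: "holder_on_space \<alpha> H V" and x: "x \<in> \<Omega>"
  have "\<bar>stepm (dl j) (u V j x - y) (U V j x) $ i $ k\<bar> \<le> E j" for i k
    using stepm_le(1)[OF V x, of j "u V j x - y" i k] C1_ge_1 eps_pos[of j]
    by (auto simp: E_def intro: order.trans divide_right_mono)
  then have "\<bar>A V j y x\<bar> \<le> fact CARD('n) * E j ^ CARD('n)"
    unfolding A_def by (intro abs_det_le)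
  also have "\<dots> \<le> 15 * real CARD('n) * (fact CARD('n) * E j ^ CARD('n))"
    by (rule Mb_aux)
  finally show ?thesis by (simp add: Mb_def mult_ac)
qed

lemma A_lipschitz:
  "holder_on_space \<alpha> H V \<Longrightarrow> x \<in> \<Omega> \<Longrightarrow> \<bar>A V j y x - A V j y' x\<bar> \<le> Mb j / 2 / dl j * norm (y - y')"
proof -
  assume V: "holder_on_space \<alpha> H V" and x: "x \<in> \<Omega>"
  note e = eps_pos[of j] dl_pos[of j] C1_ge_1
  let ?b = "15 * (norm (y - y') / dl j)"
  have "\<bar>A V j y x - A V j y' x\<bar> \<le> fact CARD('n) * real CARD('n) * E j ^ CARD('n) * ?b"
    unfolding A_def
  proof (rule abs_det_diff_le)
    fix i k
    have "2 * C1 / eps j \<le> E j" using e by (simp add: E_def divide_right_mono)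
    then show "\<bar>stepm (dl j) (u V j x - y) (U V j x) $ i $ k\<bar> \<le> E j"
      "\<bar>stepm (dl j) (u V j x - y') (U V j x) $ i $ k\<bar> \<le> E j"
      using stepm_le(1)[OF V x] order.trans by blast+
    have "\<bar>stepm (dl j) (u V j x - y) (U V j x) $ i $ k - stepm (dl j) (u V j x - y') (U V j x) $ i $ k\<bar>
        \<le> 16 * C1 / eps j * (norm (y - y') / dl j)"
      using stepm_le(2)[OF V x, of j "u V j x - y" i k "u V j x - y'"] by (simp add: norm_minus_commute)
    also have "\<dots> \<le> 75 * C1 / eps j * (norm (y - y') / dl j)"
      using e by (intro mult_right_mono divide_right_mono) auto
    finally show "\<bar>stepm (dl j) (u V j x - y) (U V j x) $ i $ k - stepm (dl j) (u V j x - y') (U V j x) $ i $ k\<bar>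
        \<le> E j * ?b" by (simp add: E_def)
  qed (use e E_pos[of j] in auto)
  then show ?thesis by (simp add: Mb_def mult_ac)
qed

lemma B_entries:
  assumes V: "holder_on_space \<alpha> H V" and x: "x \<in> \<Omega>"
  shows "\<bar>BM V j x y $ i $ k\<bar> \<le> E j" "\<bar>BM V j x y $ i $ k - BM V j x y' $ i $ k\<bar> \<le> E j * (15 * (norm (y - y') / dl j))"
proof -
  note e = eps_pos[of j] dl_pos[of j] dl_pos[of "Suc j"] C1_ge_1
  have c: "0 \<le> cutf j x" "cutf j x \<le> 1" using cut[of j] by (auto simp: cutoff_def)
  \<comment> \<open>Entries at scale \<open>j\<close> are at most \<open>2 * C1 / eps j\<close>,
    those at the finer scale at most twice that; the gradient of the cutoff adds
    \<open>C1 / eps j\<close>. This is the 5 in \<open>E\<close>.\<close>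
  have "\<bar>BM V j x y $ i $ k\<bar> \<le> 4 * C1 / eps j + C1 / eps j"
    unfolding BM_def
  proof (rule blendm_bounds[OF c cutg_le])
    show "\<bar>stepm (dl j) (u V j x - y) (U V j x) $ i $ k\<bar> \<le> 4 * C1 / eps j"
      using stepm_le(1)[OF V x, of j "u V j x - y" i k] e
      by (auto intro: order.trans divide_right_mono)
    show "\<bar>stepm (dl (Suc j)) (u V (Suc j) x - y) (U V (Suc j) x) $ i $ k\<bar> \<le> 4 * C1 / eps j"
      using stepm_le(1)[OF V x, of "Suc j" "u V (Suc j) x - y" i k] by (simp add: eps_Suc)
    show "\<bar>stepv (dl j) (u V j x - y) $ i - stepv (dl (Suc j)) (u V (Suc j) x - y) $ i\<bar> \<le> 1"
      using psi_bounds unfolding stepv_def by (simp add: abs_le_iff add_increasing2 diff_le_eq)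
  qed
  then show "\<bar>BM V j x y $ i $ k\<bar> \<le> E j" by (simp add: E_def add_divide_distrib[symmetric])
  let ?t = "norm (y - y')"
  have dt: "?t / dl (Suc j) \<le> 2 * (?t / dl j)"
    using dl_Suc(2)[of j] e mult_left_mono[OF dl_Suc(2)[of j], of ?t] by (simp add: field_simps)
  \<comment> \<open>Passing to the finer scale costs a factor 2 for \<open>eps\<close> and at most 2
    for \<open>dl\<close>, so 16 becomes 64; the cutoff term adds 8. The total 72 is rounded up to
    75, that is 5 times 15.\<close>
  have "\<bar>BM V j x y $ i $ k - BM V j x y' $ i $ k\<bar> \<le> 64 * C1 / eps j * (?t / dl j) + C1 / eps j * (2 * (4 * (?t / dl j)))"
    unfolding BM_def
  proof (rule blendm_diff[OF c cutg_le])
    have "\<bar>stepm (dl j) (u V j x - y) (U V j x) $ i $ k - stepm (dl j) (u V j x - y') (U V j x) $ i $ k\<bar>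
       \<le> 16 * C1 / eps j * (?t / dl j)"
      using stepm_le(2)[OF V x, of j "u V j x - y" i k "u V j x - y'"] by (simp add: norm_minus_commute)
    also have "\<dots> \<le> 64 * C1 / eps j * (?t / dl j)"
      using e by (intro mult_right_mono divide_right_mono) auto
    finally show "\<bar>stepm (dl j) (u V j x - y) (U V j x) $ i $ k - stepm (dl j) (u V j x - y') (U V j x) $ i $ k\<bar>
       \<le> 64 * C1 / eps j * (?t / dl j)" .
    have "\<bar>stepm (dl (Suc j)) (u V (Suc j) x - y) (U V (Suc j) x) $ i $ k
        - stepm (dl (Suc j)) (u V (Suc j) x - y') (U V (Suc j) x) $ i $ k\<bar>
       \<le> 32 * C1 / eps j * (?t / dl (Suc j))"
      using stepm_le(2)[OF V x, of "Suc j" "u V (Suc j) x - y" i k "u V (Suc j) x - y'"]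
      by (simp add: norm_minus_commute eps_Suc)
    also have "\<dots> \<le> 32 * C1 / eps j * (2 * (?t / dl j))"
      using e by (intro mult_left_mono dt) auto
    finally show "\<bar>stepm (dl (Suc j)) (u V (Suc j) x - y) (U V (Suc j) x) $ i $ k
        - stepm (dl (Suc j)) (u V (Suc j) x - y') (U V (Suc j) x) $ i $ k\<bar>
       \<le> 64 * C1 / eps j * (?t / dl j)" by simp
    show "\<bar>stepv (dl j) (u V j x - y) $ i - stepv (dl j) (u V j x - y') $ i\<bar> \<le> 4 * (?t / dl j)"
      using abs_stepv_diff_le[OF dl_pos[of j], of "u V j x - y" i "u V j x - y'"] e
      by (simp add: norm_minus_commute divide_le_cancel)
    show "\<bar>stepv (dl (Suc j)) (u V (Suc j) x - y) $ i - stepv (dl (Suc j)) (u V (Suc j) x - y') $ i\<bar> \<le> 4 * (?t / dl j)"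
      using abs_stepv_diff_le[OF dl_pos[of "Suc j"], of "u V (Suc j) x - y" i "u V (Suc j) x - y'"] dt
      by (simp add: norm_minus_commute)
  qed
  also have "\<dots> = 72 * C1 / eps j * (?t / dl j)" using e by (simp add: field_simps)
  also have "\<dots> \<le> 75 * C1 / eps j * (?t / dl j)"
    using e by (intro mult_right_mono divide_right_mono) auto
  finally show "\<bar>BM V j x y $ i $ k - BM V j x y' $ i $ k\<bar> \<le> E j * (15 * (?t / dl j))" by (simp add: E_def)
qed

lemma B_le: "holder_on_space \<alpha> H V \<Longrightarrow> x \<in> \<Omega> \<Longrightarrow> \<bar>B V j y x\<bar> \<le> Mb j / 2"
proof -
  assume V: "holder_on_space \<alpha> H V" and x: "x \<in> \<Omega>"
  have "\<bar>B V j y x\<bar> \<le> fact CARD('n) * E j ^ CARD('n)"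
    unfolding B_def by (intro abs_det_le B_entries(1) V x)
  also have "\<dots> \<le> 15 * real CARD('n) * (fact CARD('n) * E j ^ CARD('n))"
    by (rule Mb_aux)
  finally show ?thesis by (simp add: Mb_def mult_ac)
qed

lemma B_lipschitz:
  "holder_on_space \<alpha> H V \<Longrightarrow> x \<in> \<Omega> \<Longrightarrow> \<bar>B V j y x - B V j y' x\<bar> \<le> Mb j / 2 / dl j * norm (y - y')"
proof -
  assume V: "holder_on_space \<alpha> H V" and x: "x \<in> \<Omega>"
  have "\<bar>B V j y x - B V j y' x\<bar>
      \<le> fact CARD('n) * real CARD('n) * E j ^ CARD('n) * (15 * (norm (y - y') / dl j))"
    unfolding B_def using E_pos[of j] dl_pos[of j]
    by (intro abs_det_diff_le B_entries V x) auto
  then show ?thesis by (simp add: Mb_def mult_ac)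
qed

lemma ex_large_component:
  fixes z :: "real^'n"
  assumes "real CARD('n) * t < norm z" obtains i where "t < \<bar>z $ i\<bar>"
  using assms norm_le_card_bound[of z t] by (meson not_less)

text \<open>Beyond this distance some coordinate exceeds \<open>2 * dl j\<close>: one width is lost
  to the distance between the two maps compared, one is left to pass the step.\<close>

definition "rad j = 2 * real CARD('n) * dl j"

lemma A_far:
  assumes "norm (u V j x - u' ) \<le> dl j" "rad j < norm (y - u')" shows "A V j y x = 0"
proof -
  have "real CARD('n) * (2 * dl j) < norm (u' - y)" using assms(2) by (simp add: rad_def norm_minus_commute mult_ac)
  then obtain i where i: "2 * dl j < \<bar>(u' - y) $ i\<bar>" by (rule ex_large_component)
  moreover have "\<bar>(u V j x - u') $ i\<bar> \<le> dl j" using component_le_norm_cart assms(1) order.trans by blast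
  ultimately have "dl j \<le> \<bar>(u V j x - y) $ i\<bar>" by simp
  then have "u V j x - y \<notin> open_cube (dl j)" using dl_pos[of j]
    by (auto intro!: exI[of _ i] simp: open_cube_def abs_if split: if_splits)
  then show ?thesis unfolding A_def by (rule det_stepm_outside) (rule dl_pos)
qed

text \<open>A coordinate of \<open>u V j x - y\<close> larger than \<open>2 * dl j\<close> in
  absolute value keeps its sign at the finer scale and stays beyond the step, so both points are on
  the same side.\<close>

lemma B_far:
  assumes V: "holder_on_space \<alpha> H V" and x: "x \<in> \<Omega>" and y: "rad j < norm (y - u V j x)"
  shows "B V j y x = 0"
proof -
  have "real CARD('n) * (2 * dl j) < norm (u V j x - y)" using y by (simp add: rad_def norm_minus_commute mult_ac)
  then obtain i where i: "2 * dl j < \<bar>(u V j x - y) $ i\<bar>" by (rule ex_large_component)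
  have "\<bar>(u V j x - u V (Suc j) x) $ i\<bar> \<le> dl j"
    using component_le_norm_cart u_Suc[OF V x] order.trans by blast
  with i have "(dl j \<le> (u V j x - y) $ i \<and> dl (Suc j) \<le> (u V (Suc j) x - y) $ i) \<or>
      ((u V j x - y) $ i \<le> 0 \<and> (u V (Suc j) x - y) $ i \<le> 0)"
    using dl_Suc(1)[of j] dl_pos[of j] by (simp add: abs_if split: if_splits) 
  then have "same_side (dl j) (u V j x - y) (dl (Suc j)) (u V (Suc j) x - y)"
    unfolding same_side_def by blast
  then show ?thesis unfolding B_def BM_def by (rule det_blendm_same_side) (rule dl_pos)+
qed

lemma tame_A:
  assumes V: "holder_on_space \<alpha> H V" and x: "x \<in> \<Omega>"
  shows "tame (rad j) (Mb j) (Mb j / dl j) (\<lambda>y. A V j y x)"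
  unfolding tame_def
proof (intro conjI allI exI impI)
  fix y y'
  show "A V j y x = 0" if "rad j < norm (y - u V j x)"
    by (rule A_far[OF _ that]) (use dl_pos[of j] in simp)
  show "\<bar>A V j y x\<bar> \<le> Mb j" using A_le[OF V x, of j y] Mb_pos[of j] by simp
  have "Mb j / 2 / dl j * norm (y - y') \<le> Mb j / dl j * norm (y - y')"
    using Mb_pos[of j] dl_pos[of j] by (intro mult_right_mono divide_right_mono) auto
  then show "\<bar>A V j y x - A V j y' x\<bar> \<le> Mb j / dl j * norm (y - y')"
    using A_lipschitz[OF V x, of j y y'] by linarith
qed

lemma tame_BA:
  assumes V: "holder_on_space \<alpha> H V" and x: "x \<in> \<Omega>"
  shows "tame (rad j) (Mb j) (Mb j / dl j) (\<lambda>y. B V j y x - A V j y x)"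
  unfolding tame_def
proof (intro conjI allI exI impI)
  fix y y'
  show "B V j y x - A V j y x = 0" if "rad j < norm (y - u V j x)"
    using A_far[OF _ that] B_far[OF V x that] dl_pos[of j] by simp
  show "\<bar>B V j y x - A V j y x\<bar> \<le> Mb j" using A_le[OF V x, of j y] B_le[OF V x, of j y] by simp
  have "Mb j / 2 / dl j * norm (y - y') + Mb j / 2 / dl j * norm (y - y') = Mb j / dl j * norm (y - y')"
    by (simp add: field_simps)
  then show "\<bar>B V j y x - A V j y x - (B V j y' x - A V j y' x)\<bar> \<le> Mb j / dl j * norm (y - y')"
    using A_lipschitz[OF V x, of j y y'] B_lipschitz[OF V x, of j y y'] by linarith
qed

text \<open>Only the height becomes small with \<open>\<eta>\<close>; the Lipschitz constant is the
  sum of those of the two maps.\<close>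

lemma tame_A_diff:
  assumes V: "holder_on_space \<alpha> H V" "holder_on_space \<alpha> H V'" and x: "x \<in> \<Omega>"
    and \<eta>: "\<And>z. norm (V z - V' z) \<le> \<eta>" "\<eta> \<le> dl j"
  shows "tame (rad j) (Mb j * (\<eta> / dl j)) (Mb j / dl j) (\<lambda>y. A V j y x - A V' j y x)"
  unfolding tame_def
proof (intro conjI allI exI impI)
  note e = eps_pos[of j] dl_pos[of j] C1_ge_1
  have \<eta>0: "0 \<le> \<eta>" using \<eta>(1) norm_ge_zero order.trans by blast
  have uu: "norm (u V j x - u V' j x) \<le> \<eta>" by (rule norm_qi_diff_le[OF \<eta>(1)])
  fix y y'
  show "A V j y x - A V' j y x = 0" if "rad j < norm (y - u V j x)"
  proof -
    have "A V j y x = 0" by (rule A_far[OF _ that]) (use dl_pos[of j] in simp)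
    moreover have "A V' j y x = 0"
      by (rule A_far[OF _ that]) (use uu \<eta>(2) in \<open>simp add: norm_minus_commute\<close>)
    ultimately show ?thesis by simp
  qed
  have "\<bar>A V j y x - A V' j y x\<bar> \<le> fact CARD('n) * real CARD('n) * E j ^ CARD('n) * (15 * (\<eta> / dl j))"
    unfolding A_def
  proof (rule abs_det_diff_le)
    fix i k
    have "2 * C1 / eps j \<le> E j" using e by (simp add: E_def divide_right_mono)
    then show "\<bar>stepm (dl j) (u V j x - y) (U V j x) $ i $ k\<bar> \<le> E j"
      "\<bar>stepm (dl j) (u V' j x - y) (U V' j x) $ i $ k\<bar> \<le> E j"
      using stepm_le(1)[OF V(1) x] stepm_le(1)[OF V(2) x] order.trans by blast+
    have "\<bar>U V j x $ i $ k - U V' j x $ i $ k\<bar> \<le> C1 / eps j * \<eta>" for i k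
      using abs_qim_diff_le[OF \<eta>(1) eps_pos[of j]] \<eta>0 by (simp add: C1_def)
    then have "\<bar>stepm (dl j) (u V j x - y) (U V j x) $ i $ k - stepm (dl j) (u V' j x - y) (U V' j x) $ i $ k\<bar>
        \<le> 16 * \<eta> * (C1 * dl j / eps j) / (dl j)\<^sup>2 + 2 * (C1 / eps j * \<eta>) / dl j"
      using U_le[OF V(1) x] U_le[OF V(2) x] uu dl_pos[of j]
      by (intro stepm_bounds(2)) auto
    also have "\<dots> = 18 * C1 / eps j * (\<eta> / dl j)" using e by (simp add: power2_eq_square field_simps)
    also have "\<dots> \<le> 75 * C1 / eps j * (\<eta> / dl j)"
      using e \<eta>0 by (intro mult_right_mono divide_right_mono) auto
    finally show "\<bar>stepm (dl j) (u V j x - y) (U V j x) $ i $ k - stepm (dl j) (u V' j x - y) (U V' j x) $ i $ k\<bar>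
        \<le> E j * (15 * (\<eta> / dl j))" by (simp add: E_def)
  qed (use e E_pos[of j] \<eta>0 in auto)
  also have "\<dots> \<le> Mb j * (\<eta> / dl j)"
    using e E_pos[of j] \<eta>0 unfolding Mb_def
    by (auto simp: mult_ac intro!: mult_right_mono divide_right_mono)
  finally show "\<bar>A V j y x - A V' j y x\<bar> \<le> Mb j * (\<eta> / dl j)" .
  have "Mb j / 2 / dl j * norm (y - y') + Mb j / 2 / dl j * norm (y - y') = Mb j / dl j * norm (y - y')"
    by (simp add: field_simps)
  then show "\<bar>A V j y x - A V' j y x - (A V j y' x - A V' j y' x)\<bar> \<le> Mb j / dl j * norm (y - y')"
    using A_lipschitz[OF V(1) x, of j y y'] A_lipschitz[OF V(2) x, of j y y'] by linarith
qed

lemma open_layer: "open (layer j)"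
proof -
  have "open ({x. cutf j x \<noteq> 1})" by (intro open_Collect_neq cont_cut continuous_intros)
  then have "open (\<Omega> \<inter> {x. cutf j x \<noteq> 1})" using open_\<Omega> by auto
  then show ?thesis by (simp add: layer_def Int_def)
qed

lemma integrable_A:
  assumes "holder_on_space \<alpha> H V" shows "set_integrable lborel \<Omega> (\<lambda>x. A V j y x)"
proof (rule set_integrable_bounded_continuous[OF open_\<Omega> bounded_\<Omega> _ A_le[OF assms]])
  have "continuous_on \<Omega> (\<lambda>x. (\<lambda>(y, x). A V j y x) (y, x))"
    by (rule continuous_on_compose2[OF continuous_A]) (auto intro!: continuous_intros)
  then show "continuous_on \<Omega> (\<lambda>x. A V j y x)" by simp
qed

lemma integrable_B:
  assumes "holder_on_space \<alpha> H V" shows "set_integrable lborel \<Omega> (\<lambda>x. B V j y x)"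
proof (rule set_integrable_bounded_continuous[OF open_\<Omega> bounded_\<Omega> _ B_le[OF assms]])
  have "continuous_on \<Omega> (\<lambda>x. (\<lambda>(y, x). B V j y x) (y, x))"
    by (rule continuous_on_compose2[OF continuous_B]) (auto intro!: continuous_intros)
  then show "continuous_on \<Omega> (\<lambda>x. B V j y x)" by simp
qed

text \<open>The blend has the integral of the finer scale (\<open>integral_det_blend\<close>) but
  the integrand of the coarser one wherever the cutoff is 1; only the layer survives in the
  difference.\<close>

lemma F_Suc_diff:
  assumes V: "holder_on_space \<alpha> H V"
  shows "F V (Suc j) y - F V j y = (LINT x:layer j|lborel. B V j y x - A V j y x)"
proof -
  have "F V (Suc j) y = (LINT x:\<Omega>|lborel. B V j y x)"
    unfolding F_def A_def B_def BM_def
    by (intro integral_det_blend[symmetric] open_\<Omega> bounded_\<Omega> cut dl_pos C1_map_shift C1_map_qi eps_pos)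
  then have "F V (Suc j) y - F V j y = (LINT x:\<Omega>|lborel. B V j y x - A V j y x)"
    using set_integral_diff(2)[OF integrable_B[OF V] integrable_A[OF V]] by (simp add: F_def)
  also have "\<dots> = (LINT x:layer j|lborel. B V j y x - A V j y x)"
    unfolding set_lebesgue_integral_def
  proof (intro Bochner_Integration.integral_cong refl)
    fix x
    have "B V j y x = A V j y x" if "cutf j x = 1"
      using cutoff_gradient_eq_0[OF cut that] that by (simp add: A_def B_def BM_def blendm_1)
    then show "indicator \<Omega> x *\<^sub>R (B V j y x - A V j y x) = indicator (layer j) x *\<^sub>R (B V j y x - A V j y x)"
      by (auto simp: layer_def indicator_def)
  qed
  finally show ?thesis .
qed

text \<open>The ball around \<open>x\<close> is connected and meets both \<open>\<Omega>\<close> and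
  its complement.\<close>

lemma layer_near_frontier:
  assumes "x \<in> layer j" obtains z where "z \<in> frontier \<Omega>" "dist x z \<le> 2 * real CARD('n) * eps j"
proof -
  let ?B = "cball x (2 * real CARD('n) * eps j)"
  have "x \<in> \<Omega>" "cutf j x \<noteq> 1" using assms by (auto simp: layer_def)
  then have "\<not> ?B \<subseteq> \<Omega>" using cut_eq_1 by blast
  moreover have "x \<in> ?B" using eps_pos[of j] by simp
  ultimately have "?B \<inter> \<Omega> \<noteq> {}" "?B - \<Omega> \<noteq> {}" using \<open>x \<in> \<Omega>\<close> by blast+
  then have "?B \<inter> frontier \<Omega> \<noteq> {}"
    by (intro connected_Int_frontier connected_cball)
  then show ?thesis using that by auto
qed

end

subsection \<open>Energies\<close>

text \<open>A convex function lies above its tangent at \<open>c\<close>. After scaling to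
  \<open>t / c\<close> this is the weighted Young inequality with second factor 1.\<close>

lemma powr_tangent:
  fixes t c p :: real
  assumes "0 \<le> t" "0 < c" "1 \<le> p"
  shows "c powr p + p * c powr (p - 1) * (t - c) \<le> t powr p"
proof (cases "t = 0")
  case True
  have "c powr (p - 1) * c = c powr p" using assms by (simp add: powr_mult_base mult.commute)
  then have "c powr p + p * c powr (p - 1) * (t - c) = (1 - p) * c powr p"
    using True by (simp add: algebra_simps)
  also have "\<dots> \<le> 0" using assms by (intro mult_nonpos_nonneg) auto
  finally show ?thesis using True by simp
next
  case False
  then have t: "t > 0" using assms by simp
  define x where "x = t / c"
  have x: "x > 0" "t = c * x" using t assms by (auto simp: x_def)
  have "(x powr p) powr (1/p) * 1 powr (1 - 1/p) \<le> 1/p * x powr p + (1 - 1/p) * 1"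
    using x assms by (intro Youngs_inequality_0) (auto simp: field_simps)
  then have "x \<le> 1/p * x powr p + (1 - 1/p)" using x assms by (simp add: powr_powr)
  then have "p * x \<le> p * (1/p * x powr p + (1 - 1/p))" using assms by (intro mult_left_mono) auto
  also have "\<dots> = x powr p + (p - 1)" using assms by (simp add: right_diff_distrib distrib_left)
  finally have "p * x \<le> x powr p + (p - 1)" .
  then have "c powr p * (1 + p * (x - 1)) \<le> c powr p * x powr p"
    by (intro mult_left_mono) (auto simp: algebra_simps)
  moreover have "c powr p * (1 + p * (x - 1)) = c powr p + p * c powr (p - 1) * (t - c)"
  proof -
    have "c powr (p - 1) * c = c powr p" using assms by (simp add: powr_mult_base mult.commute)
    then have "p * c powr (p - 1) * (t - c) = p * (c powr p) * (x - 1)"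
      unfolding x(2) by (simp add: algebra_simps)
    then show ?thesis by (simp add: algebra_simps)
  qed
  moreover have "c powr p * x powr p = t powr p" using x assms by (simp add: powr_mult)
  ultimately show ?thesis by simp
qed

text \<open>Jensen's inequality for the weights \<open>l\<close>. They are kept free so that terms
  of geometric decay can be summed with a bound independent of their number.\<close>

lemma jensen_sum:
  fixes a l :: "'a \<Rightarrow> real"
  assumes J: "finite J" and l: "\<And>j. j \<in> J \<Longrightarrow> 0 < l j" and p: "1 \<le> p"
  shows "\<bar>\<Sum>j\<in>J. a j\<bar> powr p \<le> (\<Sum>j\<in>J. l j) powr (p - 1) * (\<Sum>j\<in>J. l j powr (1 - p) * \<bar>a j\<bar> powr p)"
proof (cases "(\<Sum>j\<in>J. \<bar>a j\<bar>) = 0")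
  case True
  then have "\<And>j. j \<in> J \<Longrightarrow> a j = 0" using J by (simp add: sum_nonneg_eq_0_iff)
  then show ?thesis by simp
next
  case False
  define I where "I = (\<Sum>j\<in>J. \<bar>a j\<bar>)"
  define L where "L = (\<Sum>j\<in>J. l j)"
  have I: "0 < I" using False sum_nonneg[of J "\<lambda>j. \<bar>a j\<bar>"] by (simp add: I_def less_le)
  then have "J \<noteq> {}" by (auto simp: I_def)
  then have L: "0 < L" unfolding L_def using J l by (intro sum_pos) auto
  \<comment> \<open>The tangent is taken at the weighted mean, where the linear terms
    cancel.\<close>
  define c where "c = I / L"
  have c: "0 < c" using I L by (simp add: c_def)
  have "L * c powr p + p * c powr (p - 1) * (I - L * c)
      = (\<Sum>j\<in>J. l j * (c powr p + p * c powr (p - 1) * (\<bar>a j\<bar> / l j - c)))"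
  proof -
    have "l j * (c powr p + p * c powr (p - 1) * (\<bar>a j\<bar> / l j - c))
        = l j * c powr p + p * c powr (p - 1) * (\<bar>a j\<bar> - l j * c)" if "j \<in> J" for j
      using l[OF that] by (simp add: field_simps)
    then show ?thesis
      by (simp add: sum.distrib sum_subtractf I_def L_def flip: sum_distrib_left sum_distrib_right)
  qed
  also have "\<dots> \<le> (\<Sum>j\<in>J. l j * (\<bar>a j\<bar> / l j) powr p)"
    using l c p by (intro sum_mono mult_left_mono powr_tangent) (auto simp: less_imp_le)
  also have "\<dots> = (\<Sum>j\<in>J. l j powr (1 - p) * \<bar>a j\<bar> powr p)"
  proof (rule sum.cong[OF refl])
    fix j assume "j \<in> J"
    then have "0 < l j" by (rule l)
    then show "l j * (\<bar>a j\<bar> / l j) powr p = l j powr (1 - p) * \<bar>a j\<bar> powr p"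
      by (simp add: powr_divide powr_diff field_simps)
  qed
  finally have 1: "L * c powr p \<le> (\<Sum>j\<in>J. l j powr (1 - p) * \<bar>a j\<bar> powr p)"
    using L by (simp add: c_def)
  have "\<bar>\<Sum>j\<in>J. a j\<bar> powr p \<le> I powr p"
    unfolding I_def using p by (intro powr_mono2 sum_abs) auto
  also have "\<dots> = L powr (p - 1) * (L * c powr p)"
    using I L by (simp add: c_def powr_divide powr_diff field_simps)
  also have "\<dots> \<le> L powr (p - 1) * (\<Sum>j\<in>J. l j powr (1 - p) * \<bar>a j\<bar> powr p)"
    by (intro mult_left_mono 1) auto
  finally show ?thesis by (simp add: L_def)
qed

text \<open>As in \<open>jensen_sum\<close>, by the tangent at the mean of the absolute value of
  \<open>g\<close> over \<open>S\<close>.\<close>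

lemma jensen_integral:
  fixes g :: "'a::euclidean_space \<Rightarrow> real"
  assumes S: "S \<in> sets borel" "emeasure lborel S < \<infinity>" and g: "set_integrable lborel S g" and p: "1 \<le> p"
  shows "ennreal (\<bar>LINT x:S|lborel. g x\<bar> powr p) \<le>
    ennreal (measure lborel S powr (p - 1)) * (\<integral>\<^sup>+x\<in>S. ennreal (\<bar>g x\<bar> powr p) \<partial>lborel)"
proof -
  define I where "I = (LINT x:S|lborel. \<bar>g x\<bar>)"
  define m where "m = measure lborel S"
  have mem: "emeasure lborel S = ennreal m" using S(2) by (simp add: m_def emeasure_eq_ennreal_measure)
  have gI: "set_integrable lborel S (\<lambda>x. \<bar>g x\<bar>)" using set_integrable_abs[OF g] .
  have "\<bar>LINT x:S|lborel. g x\<bar> \<le> I"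
    unfolding I_def set_lebesgue_integral_def
    using integral_norm_bound[of lborel "\<lambda>x. indicator S x *\<^sub>R g x"] by (simp add: abs_mult)
  then have le: "\<bar>LINT x:S|lborel. g x\<bar> powr p \<le> I powr p" using p by (intro powr_mono2) auto
  have I0: "0 \<le> I" unfolding I_def set_lebesgue_integral_def by (intro Bochner_Integration.integral_nonneg) auto
  show ?thesis
  proof (cases "I = 0")
    case True
    then show ?thesis using le by (simp add: ennreal_neg)
  next
    case False
    have gm: "(\<lambda>x. indicator S x *\<^sub>R g x) \<in> borel_measurable lborel"
      using g unfolding set_integrable_def by (rule borel_measurable_integrable)
    have "m \<noteq> 0"
    proof
      assume "m = 0"
      then have "AE x in lborel. indicator S x *\<^sub>R \<bar>g x\<bar> = 0"
        using mem S(1) AE_not_in[of S lborel] by (auto simp: null_sets_def indicator_def elim!: eventually_mono)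
      then have "I = 0" unfolding I_def set_lebesgue_integral_def by (subst integral_eq_zero_AE) auto
      then show False using False by simp
    qed
    then have m: "0 < m" by (simp add: m_def less_le)
    define c where "c = I / m"
    have c: "0 < c" using m I0 False by (simp add: c_def)
    have conv: "ennreal (m * c powr p) + 0 \<le> (\<integral>\<^sup>+x\<in>S. ennreal (\<bar>g x\<bar> powr p) \<partial>lborel)"
    proof (cases "(\<integral>\<^sup>+x\<in>S. ennreal (\<bar>g x\<bar> powr p) \<partial>lborel) = \<infinity>")
      case False
      let ?h = "\<lambda>x. indicator S x * \<bar>g x\<bar> powr p"
      have hm: "?h \<in> borel_measurable lborel"
      proof -
        have "?h = (\<lambda>x. \<bar>indicator S x *\<^sub>R g x\<bar> powr p)" using p by (auto simp: fun_eq_iff indicator_def)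
        then show ?thesis using gm by simp
      qed
      have nn: "(\<integral>\<^sup>+x. ennreal (?h x) \<partial>lborel) = (\<integral>\<^sup>+x\<in>S. ennreal (\<bar>g x\<bar> powr p) \<partial>lborel)"
        by (intro nn_integral_cong) (auto simp: indicator_def)
      have hi: "integrable lborel ?h"
        using hm nn False by (intro integrableI_nonneg) (auto simp: less_top)
      have "(LINT x|lborel. indicator S x * c powr p + p * c powr (p - 1) * (indicator S x *\<^sub>R \<bar>g x\<bar> - indicator S x * c))
          \<le> (LINT x|lborel. ?h x)"
      proof (rule integral_mono)
        show "integrable lborel (\<lambda>x. indicator S x * c powr p + p * c powr (p - 1) * (indicator S x *\<^sub>R \<bar>g x\<bar> - indicator S x * c))"
          using gI S unfolding set_integrable_def
          by (intro Bochner_Integration.integrable_add integrable_mult_left integrable_mult_right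
              Bochner_Integration.integrable_diff integrable_real_indicator) auto
        show "indicator S x * c powr p + p * c powr (p - 1) * (indicator S x *\<^sub>R \<bar>g x\<bar> - indicator S x * c) \<le> ?h x" for x
          using powr_tangent[OF abs_ge_zero c p, of "g x"] by (auto simp: indicator_def)
      qed (rule hi)
      also have "(LINT x|lborel. indicator S x * c powr p + p * c powr (p - 1) * (indicator S x *\<^sub>R \<bar>g x\<bar> - indicator S x * c))
          = m * c powr p + p * c powr (p - 1) * (I - m * c)"
        using gI S unfolding set_integrable_def I_def set_lebesgue_integral_def m_def
        by (simp add: Bochner_Integration.integral_add Bochner_Integration.integral_diff)
      also have "\<dots> = m * c powr p" using m by (simp add: c_def)
      finally have "ennreal (m * c powr p) \<le> ennreal (LINT x|lborel. ?h x)" by (rule ennreal_leI)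
      also have "\<dots> = (\<integral>\<^sup>+x. ennreal (?h x) \<partial>lborel)"
        by (rule nn_integral_eq_integral[symmetric, OF hi]) simp
      finally show ?thesis unfolding nn by simp
    qed simp
    have "ennreal (\<bar>LINT x:S|lborel. g x\<bar> powr p) \<le> ennreal (I powr p)" using le by (rule ennreal_leI)
    also have "I powr p = m powr (p - 1) * (m * c powr p)"
      using m I0 by (simp add: c_def powr_divide powr_diff field_simps)
    also have "ennreal \<dots> = ennreal (m powr (p - 1)) * ennreal (m * c powr p)"
      using m by (intro ennreal_mult) auto
    also have "\<dots> \<le> ennreal (m powr (p - 1)) * (\<integral>\<^sup>+x\<in>S. ennreal (\<bar>g x\<bar> powr p) \<partial>lborel)"
      using conv by (intro mult_left_mono) auto
    finally show ?thesis by (simp add: m_def)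
  qed
qed

text \<open>The p-th power of a weighted norm; no roots of extended reals are taken until the end.
  The weight is kept apart from \<open>Q\<close>, which can then be Lebesgue measure or its product
  with itself.\<close>

definition energy :: "'z measure \<Rightarrow> ('z \<Rightarrow> ennreal) \<Rightarrow> real \<Rightarrow> ('z \<Rightarrow> real) \<Rightarrow> ennreal" where
  "energy Q k p h = (\<integral>\<^sup>+z. ennreal (\<bar>h z\<bar> powr p) * k z \<partial>Q)"

text \<open>Minkowski's integral inequality with a uniform bound on the integrands: Jensen in
  \<open>x\<close>, then Tonelli.\<close>

lemma energy_integral_le:
  fixes g :: "'z \<Rightarrow> 'a::euclidean_space \<Rightarrow> real"
  assumes Q: "sigma_finite_measure Q" and k: "k \<in> borel_measurable Q"
    and g: "(\<lambda>(z, x). g z x) \<in> borel_measurable (Q \<Otimes>\<^sub>M lborel)"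
    and S: "S \<in> sets borel" "emeasure lborel S < \<infinity>"
    and int: "\<And>z. set_integrable lborel S (g z)" and p: "1 \<le> p"
    and C: "\<And>x. x \<in> S \<Longrightarrow> energy Q k p (\<lambda>z. g z x) \<le> C"
  shows "energy Q k p (\<lambda>z. LINT x:S|lborel. g z x) \<le> ennreal (measure lborel S powr p) * C"
proof -
  interpret sigma_finite_measure Q by fact
  interpret P: pair_sigma_finite Q "lborel :: 'a measure" ..
  note [measurable] = k g S(1)
  let ?m = "measure lborel S"
  have gm: "(\<lambda>w. g (fst w) (snd w)) \<in> borel_measurable (Q \<Otimes>\<^sub>M lborel)"
    using g by (simp add: split_beta')
  have "energy Q k p (\<lambda>z. LINT x:S|lborel. g z x)
      \<le> (\<integral>\<^sup>+z. ennreal (?m powr (p - 1)) * (\<integral>\<^sup>+x. ennreal (\<bar>g z x\<bar> powr p) * indicator S x * k z \<partial>lborel) \<partial>Q)"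
    unfolding energy_def
  proof (rule nn_integral_mono)
    fix z assume "z \<in> space Q"
    then have [measurable]: "g z \<in> borel_measurable lborel"
      using measurable_compose_Pair1[OF _ gm, of z] by simp
    have "ennreal (\<bar>LINT x:S|lborel. g z x\<bar> powr p) * k z
      \<le> ennreal (?m powr (p - 1)) * (\<integral>\<^sup>+x\<in>S. ennreal (\<bar>g z x\<bar> powr p) \<partial>lborel) * k z"
      by (intro mult_right_mono jensen_integral S int p) auto
    also have "\<dots> = ennreal (?m powr (p - 1)) * (\<integral>\<^sup>+x. ennreal (\<bar>g z x\<bar> powr p) * indicator S x * k z \<partial>lborel)"
      by (subst nn_integral_multc) (auto simp: mult.assoc)
    finally show "ennreal (\<bar>LINT x:S|lborel. g z x\<bar> powr p) * k z
      \<le> ennreal (?m powr (p - 1)) * (\<integral>\<^sup>+x. ennreal (\<bar>g z x\<bar> powr p) * indicator S x * k z \<partial>lborel)" .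
  qed
  also have "\<dots> = ennreal (?m powr (p - 1)) * (\<integral>\<^sup>+z. (\<integral>\<^sup>+x. ennreal (\<bar>g z x\<bar> powr p) * indicator S x * k z \<partial>lborel) \<partial>Q)"
    by (intro nn_integral_cmult) measurable
  also have "(\<integral>\<^sup>+z. (\<integral>\<^sup>+x. ennreal (\<bar>g z x\<bar> powr p) * indicator S x * k z \<partial>lborel) \<partial>Q)
      = (\<integral>\<^sup>+x. (\<integral>\<^sup>+z. ennreal (\<bar>g z x\<bar> powr p) * indicator S x * k z \<partial>Q) \<partial>lborel)"
    by (rule P.Fubini'[symmetric]) measurable
  also have "\<dots> \<le> (\<integral>\<^sup>+x. C * indicator S x \<partial>lborel)"
  proof (rule nn_integral_mono)
    fix x
    show "(\<integral>\<^sup>+z. ennreal (\<bar>g z x\<bar> powr p) * indicator S x * k z \<partial>Q) \<le> C * indicator S x"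
      using C[of x] by (cases "x \<in> S") (auto simp: energy_def)
  qed
  also have "\<dots> = C * ennreal ?m"
    using S by (simp add: nn_integral_cmult_indicator emeasure_eq_ennreal_measure)
  also have "ennreal (?m powr (p - 1)) * (C * ennreal ?m) = ennreal (?m powr p) * C"
  proof -
    have "?m powr (p - 1) * ?m = ?m powr p"
      by (cases "?m = 0") (auto simp: powr_diff)
    then have "ennreal (?m powr (p - 1)) * ennreal ?m = ennreal (?m powr p)"
      by (metis ennreal_mult'' measure_nonneg)
    then show ?thesis by (metis mult.assoc mult.commute)
  qed
  finally show ?thesis by (simp add: mult_left_mono)
qed

text \<open>Minkowski's inequality for p-th powers: norms of size
  \<open>C powr (1 / p) * l j\<close> add up. It follows from \<open>jensen_sum\<close> with the
  same weights.\<close>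

lemma energy_sum_le:
  assumes J: "finite J" and l: "\<And>j. j \<in> J \<Longrightarrow> 0 < l j" and p: "1 \<le> p"
    and k: "k \<in> borel_measurable Q" and h: "\<And>j. j \<in> J \<Longrightarrow> h j \<in> borel_measurable Q"
    and C: "\<And>j. j \<in> J \<Longrightarrow> energy Q k p (h j) \<le> ennreal (C * l j powr p)" and C0: "0 \<le> C"
  shows "energy Q k p (\<lambda>z. \<Sum>j\<in>J. h j z) \<le> ennreal (C * (\<Sum>j\<in>J. l j) powr p)"
proof -
  note [measurable] = k h
  let ?L = "\<Sum>j\<in>J. l j"
  have L0: "0 \<le> ?L" using l by (intro sum_nonneg) (auto simp: less_imp_le)
  have "energy Q k p (\<lambda>z. \<Sum>j\<in>J. h j z)
     \<le> (\<integral>\<^sup>+z. ennreal (?L powr (p - 1)) * (\<Sum>j\<in>J. ennreal (l j powr (1 - p)) * (ennreal (\<bar>h j z\<bar> powr p) * k z)) \<partial>Q)"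
    unfolding energy_def
  proof (rule nn_integral_mono)
    fix z
    have "ennreal (\<bar>\<Sum>j\<in>J. h j z\<bar> powr p) * k z
       \<le> ennreal (?L powr (p - 1) * (\<Sum>j\<in>J. l j powr (1 - p) * \<bar>h j z\<bar> powr p)) * k z"
      by (intro mult_right_mono ennreal_leI jensen_sum J l p) auto
    also have "\<dots> = ennreal (?L powr (p - 1)) * (\<Sum>j\<in>J. ennreal (l j powr (1 - p)) * (ennreal (\<bar>h j z\<bar> powr p) * k z))"
      by (simp add: ennreal_mult sum_nonneg sum_ennreal[symmetric] sum_distrib_right mult.assoc del: sum_ennreal)
    finally show "ennreal (\<bar>\<Sum>j\<in>J. h j z\<bar> powr p) * k z \<le>
       ennreal (?L powr (p - 1)) * (\<Sum>j\<in>J. ennreal (l j powr (1 - p)) * (ennreal (\<bar>h j z\<bar> powr p) * k z))" .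
  qed
  also have "\<dots> = ennreal (?L powr (p - 1)) * (\<Sum>j\<in>J. ennreal (l j powr (1 - p)) * energy Q k p (h j))"
    unfolding energy_def by (simp add: nn_integral_cmult nn_integral_sum)
  also have "\<dots> \<le> ennreal (?L powr (p - 1)) * (\<Sum>j\<in>J. ennreal (l j powr (1 - p)) * ennreal (C * l j powr p))"
    by (intro mult_left_mono sum_mono C) auto
  also have "(\<Sum>j\<in>J. ennreal (l j powr (1 - p)) * ennreal (C * l j powr p)) = (\<Sum>j\<in>J. ennreal (C * l j))"
  proof (rule sum.cong[OF refl])
    fix j assume "j \<in> J"
    then have "0 < l j" by (rule l)
    then have "l j powr (1 - p) * (C * l j powr p) = C * l j" by (simp add: powr_diff)
    then show "ennreal (l j powr (1 - p)) * ennreal (C * l j powr p) = ennreal (C * l j)"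
      by (metis ennreal_mult' powr_ge_zero)
  qed
  also have "\<dots> = ennreal (C * ?L)"
    using l C0 by (subst sum_ennreal) (auto simp: sum_distrib_left less_imp_le)
  also have "ennreal (?L powr (p - 1)) * ennreal (C * ?L) = ennreal (C * ?L powr p)"
  proof -
    have "?L powr (p - 1) * ?L = ?L powr p" using L0 by (cases "?L = 0") (auto simp: powr_diff)
    then have "?L powr (p - 1) * (C * ?L) = C * ?L powr p" by (metis mult.left_commute)
    then show ?thesis by (metis ennreal_mult' powr_ge_zero)
  qed
  finally show ?thesis .
qed

lemma energy_fatou:
  assumes k: "k \<in> borel_measurable Q" and h: "\<And>m. h m \<in> borel_measurable Q"
    and lim: "AE z in Q. (\<lambda>m. h m z) \<longlonglongrightarrow> g z" and p: "1 \<le> p"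
    and C: "\<And>m. energy Q k p (h m) \<le> C"
  shows "energy Q k p g \<le> C"
proof -
  note [measurable] = k h
  have "energy Q k p g \<le> (\<integral>\<^sup>+z. liminf (\<lambda>m. ennreal (\<bar>h m z\<bar> powr p) * k z) \<partial>Q)"
    unfolding energy_def
  proof (rule nn_integral_mono_AE)
    show "AE z in Q. ennreal (\<bar>g z\<bar> powr p) * k z \<le> liminf (\<lambda>m. ennreal (\<bar>h m z\<bar> powr p) * k z)"
      using lim
    proof eventually_elim
      case (elim z)
      have lim1: "(\<lambda>m. ennreal (\<bar>h m z\<bar> powr p)) \<longlonglongrightarrow> ennreal (\<bar>g z\<bar> powr p)"
        using elim p by (intro tendsto_ennrealI tendsto_powr2 tendsto_rabs tendsto_const) auto
      \<comment> \<open>The weight may be infinite, so multiplication by it need not be continuous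
        at 0; when \<open>g z\<close> is 0 the left side is 0 anyway.\<close>
      show ?case
      proof (cases "g z = 0")
        case False
        then have "ennreal (\<bar>g z\<bar> powr p) \<noteq> 0" by simp
        then have "(\<lambda>m. ennreal (\<bar>h m z\<bar> powr p) * k z) \<longlonglongrightarrow> ennreal (\<bar>g z\<bar> powr p) * k z"
          using lim1 by (intro tendsto_mult_ennreal tendsto_const) auto
        then show ?thesis by (simp add: lim_imp_Liminf)
      qed simp
    qed
  qed
  also have "\<dots> \<le> liminf (\<lambda>m. energy Q k p (h m))"
    unfolding energy_def by (intro nn_integral_liminf) measurable
  also have "\<dots> \<le> C"
  proof -
    have "liminf (\<lambda>m. energy Q k p (h m)) \<le> liminf (\<lambda>m. C)"
      by (intro Liminf_mono always_eventually allI C)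
    then show ?thesis by (simp add: Liminf_const)
  qed
  finally show ?thesis .
qed

section \<open>Lebesgue and Gagliardo energies of bumps\<close>

lemma emeasure_cball_le:
  fixes c :: "real^'n"
  assumes r: "0 \<le> r" shows "emeasure lborel (cball c r) \<le> ennreal ((2 * r) ^ CARD('n))"
proof -
  let ?l = "c - (\<chi> i. r)" and ?u = "c + (\<chi> i. r)"
  have "cball c r \<subseteq> cbox ?l ?u"
  proof
    fix x assume "x \<in> cball c r"
    then have "\<bar>(x - c) $ i\<bar> \<le> r" for i
      using component_le_norm_cart[of "x - c" i] by (simp add: dist_norm norm_minus_commute)
    then have "x $ i - c $ i \<le> r" "c $ i - x $ i \<le> r" for i
      unfolding abs_le_iff by (simp_all add: vector_minus_component)
    then show "x \<in> cbox ?l ?u" by (simp add: mem_box_cart algebra_simps)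
  qed
  then have "emeasure lborel (cball c r) \<le> emeasure lborel (cbox ?l ?u)"
    by (intro emeasure_mono) auto
  also have "\<dots> = (\<Prod>b\<in>Basis. (?u - ?l) \<bullet> b)"
    using r by (intro emeasure_lborel_cbox) (auto simp: Basis_vec_def inner_axis)
  also have "(\<Prod>b\<in>Basis. (?u - ?l) \<bullet> b) = (\<Prod>b\<in>(Basis::(real^'n) set). 2 * r)"
    by (intro prod.cong) (auto simp: Basis_vec_def inner_axis)
  also have "\<dots> = (2 * r) ^ CARD('n)" by simp
  finally show ?thesis .
qed

lemma nn_integral_lborel_affine:
  fixes g :: "'a::euclidean_space \<Rightarrow> ennreal"
  assumes g [measurable]: "g \<in> borel_measurable borel" and c: "c \<noteq> 0"
  shows "(\<integral>\<^sup>+x. g x \<partial>lborel) = ennreal (\<bar>c\<bar> ^ DIM('a)) * (\<integral>\<^sup>+x. g (t + c *\<^sub>R x) \<partial>lborel)"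
proof -
  have "(\<integral>\<^sup>+x. g x \<partial>lborel) = (\<integral>\<^sup>+x. g x \<partial>density (distr lborel borel (\<lambda>x. t + c *\<^sub>R x)) (\<lambda>_. \<bar>c\<bar> ^ DIM('a)))"
    using lborel_affine[OF c, of t] by simp
  also have "\<dots> = ennreal (\<bar>c\<bar> ^ DIM('a)) * (\<integral>\<^sup>+x. g (t + c *\<^sub>R x) \<partial>lborel)"
    by (simp add: nn_integral_density nn_integral_distr nn_integral_cmult)
  finally show ?thesis .
qed

text \<open>Majorant of the Gagliardo integrand in \<open>h = x - y\<close> for a function of height
  \<open>M\<close> and Lipschitz constant \<open>L\<close>.\<close>

definition kern :: "real \<Rightarrow> real \<Rightarrow> real \<Rightarrow> real \<Rightarrow> real^'n \<Rightarrow> real" where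
  "kern p s M L h = min (2 * M) (L * norm h) powr p / norm h powr s"

lemma kern_measurable [measurable]: "kern p s M L \<in> borel_measurable borel"
  unfolding kern_def[abs_def] by measurable

lemma summable_powr_geometric: "0 < a \<Longrightarrow> summable (\<lambda>m. (2 powr (- a) :: real) ^ m)"
  by (intro summable_geometric) (simp add: powr_minus field_simps)

lemma powr_nat_shift:
  fixes a :: real
  shows "((1/2) ^ m) powr a = (2 powr (- a)) ^ m" "(2 ^ m) powr (- a) = (2 powr (- a)) ^ m"
proof -
  have "(2 powr (- a)) ^ m = 2 powr (- a * real m)" by (simp add: powr_powr flip: powr_realpow)
  moreover have "((1/2::real) ^ m) powr a = 2 powr (- a * real m)"
    by (simp add: power_one_over powr_powr powr_minus_divide powr_divide mult.commute flip: powr_realpow)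
  moreover have "((2::real) ^ m) powr (- a) = 2 powr (- a * real m)"
    by (simp add: powr_powr mult.commute flip: powr_realpow)
  ultimately show "((1/2) ^ m) powr a = (2 powr (- a)) ^ m" "(2 ^ m) powr (- a) = (2 powr (- a)) ^ m" by simp_all
qed

text \<open>With \<open>n\<close> the dimension, the kernel behaves like
  \<open>norm h powr (p * (1 - \<beta>) - n)\<close> at the origin and like
  \<open>norm h powr (- n - \<beta> * p)\<close> at infinity. Dyadic shells turn both ends into
  geometric series, convergent because \<open>\<beta>\<close> lies strictly between 0 and 1.\<close>

lemma kern_integral_finite:
  assumes \<beta>: "0 < \<beta>" "\<beta> < 1" and p: "1 \<le> p"
  shows "(\<integral>\<^sup>+h. ennreal (kern p (real CARD('n) + \<beta> * p) 1 1 (h :: real^'n)) \<partial>lborel) < \<infinity>"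
proof -
  let ?n = "CARD('n)" and ?s = "real CARD('n) + \<beta> * p"
  let ?k = "kern p ?s 1 1 :: real^'n \<Rightarrow> real"
  \<comment> \<open>\<open>a\<close> and \<open>b\<close> bound the kernel on the shells from
    \<open>(1/2) ^ Suc m\<close> to \<open>(1/2) ^ m\<close> and from \<open>2 ^ m\<close> to
    \<open>2 ^ Suc m\<close>; the volume of a shell is estimated by that of the ball containing
    it.\<close>
  define a where "a m = ((1/2) ^ m) powr (p * (1 - \<beta>)) / ((1/2) ^ Suc m) ^ ?n" for m :: nat
  define b where "b m = 2 powr p / (2 ^ m) powr ?s" for m :: nat
  have pos: "0 \<le> a m" "0 \<le> b m" for m by (auto simp: a_def b_def)
  let ?A = "\<lambda>m h. ennreal (a m) * indicator (cball (0::real^'n) ((1/2) ^ m)) h"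
  let ?B = "\<lambda>m h. ennreal (b m) * indicator (cball (0::real^'n) (2 ^ Suc m)) h"
  have single: "sum f {m} = f m" for f :: "nat \<Rightarrow> ennreal" and m by simp
  have le: "ennreal (?k h) \<le> (\<Sum>m. ?A m h) + (\<Sum>m. ?B m h)" for h
  proof -
    consider "h = 0" | "0 < norm h" "norm h \<le> 1" | "1 < norm h" by force
    then show ?thesis
    proof cases
      case 1
      then show ?thesis by (simp add: kern_def)
    next
      case 2
      define m where "m = (LEAST m. (1/2) ^ Suc m < norm h)"
      obtain k where "(1/2) ^ k < norm h" using real_arch_pow_inv[OF 2(1), of "1/2"] by auto
      then have "(1/2) ^ Suc k < norm h" by (rule le_less_trans[rotated]) simp
      then have m: "(1/2) ^ Suc m < norm h" unfolding m_def by (rule LeastI)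
      have m': "norm h \<le> (1/2) ^ m"
      proof (cases m)
        case (Suc l)
        then have "\<not> (1/2) ^ Suc l < norm h" using not_less_Least[of l] unfolding m_def by (metis lessI)
        then show ?thesis using Suc by simp
      qed (use 2 in simp)
      have "?k h = norm h powr (p * (1 - \<beta>)) / norm h ^ ?n"
      proof -
        have "?k h = norm h powr p / (norm h powr real ?n * norm h powr (\<beta> * p))"
          using 2 by (simp add: kern_def min_def powr_add)
        also have "\<dots> = norm h powr p / norm h powr (\<beta> * p) / norm h ^ ?n"
          using 2 by (simp add: powr_realpow field_simps)
        also have "norm h powr p / norm h powr (\<beta> * p) = norm h powr (p * (1 - \<beta>))"
          by (simp add: powr_diff[symmetric] algebra_simps)
        finally show ?thesis .
      qed
      also have "\<dots> \<le> a m"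
        unfolding a_def using m m' 2 p \<beta>
        by (intro frac_le powr_mono2 power_mono) auto
      finally have "ennreal (?k h) \<le> ?A m h" using m' by (simp add: ennreal_leI)
      also have "\<dots> = (\<Sum>i\<in>{m}. ?A i h)" by (rule single[symmetric])
      also have "\<dots> \<le> (\<Sum>i. ?A i h)" by (intro sum_le_suminf) auto
      finally show ?thesis by (simp add: add_increasing2)
    next
      case 3
      define m where "m = (LEAST m. norm h \<le> 2 ^ Suc m)"
      obtain k where "norm h < 2 ^ k" using real_arch_pow[of 2 "norm h"] by auto
      then have "norm h \<le> 2 ^ Suc k" by (simp add: less_imp_le) (smt (verit) norm_ge_zero)
      then have m: "norm h \<le> 2 ^ Suc m" unfolding m_def by (rule LeastI)
      have m': "2 ^ m \<le> norm h"
      proof (cases m)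
        case (Suc l)
        then have "\<not> norm h \<le> 2 ^ Suc l" using not_less_Least[of l] unfolding m_def by (metis lessI)
        then show ?thesis using Suc by simp
      qed (use 3 in simp)
      have "?k h \<le> b m"
        unfolding b_def kern_def using m' 3 p \<beta>
        by (intro frac_le powr_mono2) auto
      then have "ennreal (?k h) \<le> ?B m h" using m by (simp add: ennreal_leI)
      also have "\<dots> = (\<Sum>i\<in>{m}. ?B i h)" by (rule single[symmetric])
      also have "\<dots> \<le> (\<Sum>i. ?B i h)" by (intro sum_le_suminf) auto
      finally show ?thesis by (simp add: add_increasing)
    qed
  qed
  have finA: "(\<Sum>m. \<integral>\<^sup>+h. ?A m h \<partial>lborel) < \<infinity>"
  proof -
    let ?q = "2 powr (- (p * (1 - \<beta>)))"
    have "(\<integral>\<^sup>+h. ?A m h \<partial>lborel) \<le> ennreal (4 ^ ?n * ?q ^ m)" for m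
    proof -
      have "(\<integral>\<^sup>+h. ?A m h \<partial>lborel) = ennreal (a m) * emeasure lborel (cball (0::real^'n) ((1/2) ^ m))"
        by (rule nn_integral_cmult_indicator) simp
      also have "\<dots> \<le> ennreal (a m) * ennreal ((2 * (1/2) ^ m) ^ ?n)"
        by (intro mult_left_mono emeasure_cball_le) simp_all
      also have "\<dots> = ennreal (a m * (2 * (1/2) ^ m) ^ ?n)" using pos by (simp add: ennreal_mult)
      also have "a m * (2 * (1/2) ^ m) ^ ?n = 4 ^ ?n * ?q ^ m"
      proof -
        have "(2 * (1/2) ^ m) ^ ?n = 4 ^ ?n * ((1/2 :: real) ^ Suc m) ^ ?n"
        proof -
          have "2 * (1/2) ^ m = 4 * (1/2 :: real) ^ Suc m" by simp
          then show ?thesis by (simp only: power_mult_distrib)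
        qed
        then show ?thesis unfolding a_def powr_nat_shift(1) by simp
      qed
      finally show ?thesis .
    qed
    then have "(\<Sum>m. \<integral>\<^sup>+h. ?A m h \<partial>lborel) \<le> (\<Sum>m. ennreal (4 ^ ?n * ?q ^ m))"
      by (intro suminf_le) auto
    also have "\<dots> = ennreal (\<Sum>m. 4 ^ ?n * ?q ^ m)"
      using p \<beta> by (intro suminf_ennreal2 summable_mult summable_powr_geometric) auto
    finally show ?thesis by (rule le_less_trans) simp
  qed
  have finB: "(\<Sum>m. \<integral>\<^sup>+h. ?B m h \<partial>lborel) < \<infinity>"
  proof -
    let ?q = "2 powr (- (\<beta> * p))"
    have "(\<integral>\<^sup>+h. ?B m h \<partial>lborel) \<le> ennreal (2 powr p * 4 ^ ?n * ?q ^ m)" for m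
    proof -
      have "(\<integral>\<^sup>+h. ?B m h \<partial>lborel) = ennreal (b m) * emeasure lborel (cball (0::real^'n) (2 ^ Suc m))"
        by (rule nn_integral_cmult_indicator) simp
      also have "\<dots> \<le> ennreal (b m) * ennreal ((2 * 2 ^ Suc m) ^ ?n)"
        by (intro mult_left_mono emeasure_cball_le) simp_all
      also have "\<dots> = ennreal (b m * (2 * 2 ^ Suc m) ^ ?n)" using pos by (simp add: ennreal_mult)
      also have "b m * (2 * 2 ^ Suc m) ^ ?n = 2 powr p * 4 ^ ?n * ?q ^ m"
      proof -
        have "2 * 2 ^ Suc m = 4 * (2::real) ^ m" by simp
        then have 1: "(2 * 2 ^ Suc m) ^ ?n = 4 ^ ?n * ((2::real) ^ m) ^ ?n" by (simp only: power_mult_distrib)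
        have 2: "((2::real) ^ m) powr ?s = (2 ^ m) ^ ?n * (2 ^ m) powr (\<beta> * p)"
          by (simp add: powr_add powr_realpow)
        show ?thesis unfolding b_def 1 2 powr_nat_shift(2)[symmetric] by (simp add: powr_minus field_simps)
      qed
      finally show ?thesis .
    qed
    then have "(\<Sum>m. \<integral>\<^sup>+h. ?B m h \<partial>lborel) \<le> (\<Sum>m. ennreal (2 powr p * 4 ^ ?n * ?q ^ m))"
      by (intro suminf_le) auto
    also have "\<dots> = ennreal (\<Sum>m. 2 powr p * 4 ^ ?n * ?q ^ m)"
      using p \<beta> by (intro suminf_ennreal2 summable_mult summable_powr_geometric) auto
    finally show ?thesis by (rule le_less_trans) simp
  qed
  have mA [measurable]: "(\<lambda>h. ?A m h) \<in> borel_measurable lborel" for m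
    by (intro borel_measurable_times_ennreal borel_measurable_const borel_measurable_indicator) simp
  have mB [measurable]: "(\<lambda>h. ?B m h) \<in> borel_measurable lborel" for m
    by (intro borel_measurable_times_ennreal borel_measurable_const borel_measurable_indicator) simp
  have "(\<integral>\<^sup>+h. ennreal (?k h) \<partial>lborel) \<le> (\<integral>\<^sup>+h. (\<Sum>m. ?A m h) + (\<Sum>m. ?B m h) \<partial>lborel)"
    by (intro nn_integral_mono le)
  also have "\<dots> = (\<Sum>m. \<integral>\<^sup>+h. ?A m h \<partial>lborel) + (\<Sum>m. \<integral>\<^sup>+h. ?B m h \<partial>lborel)"
    unfolding nn_integral_suminf[OF mA, symmetric] nn_integral_suminf[OF mB, symmetric]
    by (rule nn_integral_add) (rule borel_measurable_suminf_order[OF mA] borel_measurable_suminf_order[OF mB])+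
  also have "\<dots> < \<infinity>" using finA finB by simp
  finally show ?thesis .
qed

text \<open>The substitution scales \<open>h\<close> by \<open>M / L\<close>, the length at which
  \<open>M\<close> and \<open>L * norm h\<close> balance.\<close>

lemma kern_integral_scale:
  assumes M: "0 < M" and L: "0 < L" and \<beta>: "0 < \<beta>" "\<beta> < 1" and p: "1 \<le> p"
  shows "(\<integral>\<^sup>+h. ennreal (kern p (real CARD('n) + \<beta> * p) M L (h :: real^'n)) \<partial>lborel) =
     ennreal (M powr p * (M / L) powr (- (\<beta> * p))) *
     (\<integral>\<^sup>+h. ennreal (kern p (real CARD('n) + \<beta> * p) 1 1 (h :: real^'n)) \<partial>lborel)"
proof -
  let ?s = "real CARD('n) + \<beta> * p" and ?\<rho> = "M / L"
  have \<rho>: "0 < ?\<rho>" using M L by simp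
  have k: "kern p ?s M L (?\<rho> *\<^sub>R h) = M powr p * ?\<rho> powr (- ?s) * kern p ?s 1 1 h" for h :: "real^'n"
  proof -
    have n: "norm (?\<rho> *\<^sub>R h) = ?\<rho> * norm h" using M L by simp
    have "min (2 * M) (L * norm (?\<rho> *\<^sub>R h)) = M * min (2 * 1) (1 * norm h)"
      using M L by (simp add: min_def)
    then have m: "min (2 * M) (L * norm (?\<rho> *\<^sub>R h)) powr p = M powr p * min (2 * 1) (1 * norm h) powr p"
      using M by (simp add: powr_mult)
    have d: "norm (?\<rho> *\<^sub>R h) powr ?s = ?\<rho> powr ?s * norm h powr ?s"
      unfolding n by (rule powr_mult)
    have "kern p ?s M L (?\<rho> *\<^sub>R h) = M powr p * min (2 * 1) (1 * norm h) powr p / (?\<rho> powr ?s * norm h powr ?s)"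
      by (simp only: kern_def m d)
    then show ?thesis unfolding kern_def powr_minus by (simp only: divide_inverse inverse_mult_distrib mult_ac)
  qed
  have r: "\<bar>?\<rho>\<bar> ^ CARD('n) * (M powr p * ?\<rho> powr (- ?s)) = M powr p * ?\<rho> powr (- (\<beta> * p))"
  proof -
    have "?\<rho> powr (- ?s) = ?\<rho> powr (- real CARD('n)) * ?\<rho> powr (- (\<beta> * p))"
      by (simp flip: powr_add)
    moreover have "\<bar>?\<rho>\<bar> ^ CARD('n) * ?\<rho> powr (- real CARD('n)) = 1"
      using M L by (simp add: powr_minus powr_realpow)
    ultimately show ?thesis by (simp add: mult.left_commute mult.assoc[symmetric])
  qed
  have "(\<integral>\<^sup>+h. ennreal (kern p ?s M L (h :: real^'n)) \<partial>lborel) =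
      ennreal (\<bar>?\<rho>\<bar> ^ DIM(real^'n)) * (\<integral>\<^sup>+h. ennreal (kern p ?s M L (0 + ?\<rho> *\<^sub>R h :: real^'n)) \<partial>lborel)"
    using \<rho> by (intro nn_integral_lborel_affine) auto
  also have "\<dots> = ennreal (\<bar>?\<rho>\<bar> ^ CARD('n)) *
      (\<integral>\<^sup>+h. ennreal (M powr p * ?\<rho> powr (- ?s)) * ennreal (kern p ?s 1 1 (h :: real^'n)) \<partial>lborel)"
    by (simp add: k ennreal_mult' flip: ennreal_mult')
  also have "\<dots> = ennreal (\<bar>?\<rho>\<bar> ^ CARD('n)) * (ennreal (M powr p * ?\<rho> powr (- ?s)) *
      (\<integral>\<^sup>+h. ennreal (kern p ?s 1 1 (h :: real^'n)) \<partial>lborel))"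
    by (subst nn_integral_cmult) auto
  also have "\<dots> = ennreal (\<bar>?\<rho>\<bar> ^ CARD('n) * (M powr p * ?\<rho> powr (- ?s))) *
      (\<integral>\<^sup>+h. ennreal (kern p ?s 1 1 (h :: real^'n)) \<partial>lborel)"
    by (subst ennreal_mult) (auto simp: mult.assoc)
  finally show ?thesis unfolding r .
qed

definition lp_energy :: "real \<Rightarrow> (real^'n \<Rightarrow> real) \<Rightarrow> ennreal" where
  "lp_energy p f = energy lborel (\<lambda>_. 1) p f"

definition gag_kernel :: "real \<Rightarrow> (real^'n) \<times> (real^'n) \<Rightarrow> ennreal" where
  "gag_kernel s z = ennreal (1 / norm (fst z - snd z) powr s)"

definition gag_energy :: "real \<Rightarrow> real \<Rightarrow> (real^'n \<Rightarrow> real) \<Rightarrow> ennreal" where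
  "gag_energy s p f = energy (lborel \<Otimes>\<^sub>M lborel) (gag_kernel s) p (\<lambda>z. f (fst z) - f (snd z))"

lemma gag_kernel_measurable [measurable]: "gag_kernel s \<in> borel_measurable (lborel \<Otimes>\<^sub>M lborel)"
  unfolding gag_kernel_def[abs_def] by measurable

lemma tame_lp_energy:
  fixes f :: "real^'n \<Rightarrow> real"
  assumes f: "tame r M L f" and r: "0 \<le> r" and p: "1 \<le> p"
  shows "lp_energy p f \<le> ennreal ((2 * r) ^ CARD('n) * M powr p)"
proof -
  obtain c where c: "\<And>y. r < norm (y - c) \<Longrightarrow> f y = 0" using f by (auto simp: tame_def)
  have M: "\<bar>f y\<bar> \<le> M" for y using f by (simp add: tame_def)
  have "ennreal (\<bar>f y\<bar> powr p) \<le> ennreal (M powr p) * indicator (cball c r) y" for y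
  proof (cases "r < norm (y - c)")
    case True
    then show ?thesis using c by simp
  next
    case False
    then have "y \<in> cball c r" by (simp add: dist_norm norm_minus_commute)
    then show ?thesis using M[of y] p by (simp add: ennreal_leI powr_mono2)
  qed
  then have "lp_energy p f \<le> (\<integral>\<^sup>+y. ennreal (M powr p) * indicator (cball c r) y \<partial>lborel)"
    unfolding lp_energy_def energy_def by (intro nn_integral_mono) simp
  also have "\<dots> = ennreal (M powr p) * emeasure lborel (cball c r)"
    by (rule nn_integral_cmult_indicator) simp
  also have "\<dots> \<le> ennreal (M powr p) * ennreal ((2 * r) ^ CARD('n))"
    by (intro mult_left_mono emeasure_cball_le r) auto
  also have "\<dots> = ennreal ((2 * r) ^ CARD('n) * M powr p)"
    using r by (simp add: mult.commute flip: ennreal_mult')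
  finally show ?thesis .
qed

text \<open>The difference vanishes unless \<open>x\<close> or \<open>y\<close> lies in the support
  ball. Fixing that point and integrating the kernel over the other gives the same integral twice,
  hence the factor 2.\<close>

lemma tame_gag_energy:
  fixes f :: "real^'n \<Rightarrow> real"
  assumes f: "tame r M L f" and r: "0 \<le> r" and M: "0 < M" and L: "0 < L"
    and \<beta>: "0 < \<beta>" "\<beta> < 1" and p: "1 \<le> p"
  shows "gag_energy (real CARD('n) + \<beta> * p) p f \<le>
     ennreal (2 * (2 * r) ^ CARD('n) * (M powr p * (M / L) powr (- (\<beta> * p)))) *
     (\<integral>\<^sup>+h. ennreal (kern p (real CARD('n) + \<beta> * p) 1 1 (h :: real^'n)) \<partial>lborel)"
proof -
  let ?s = "real CARD('n) + \<beta> * p"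
  let ?I = "\<integral>\<^sup>+h. ennreal (kern p ?s M L (h :: real^'n)) \<partial>lborel"
  obtain c where c: "\<And>y. r < norm (y - c) \<Longrightarrow> f y = 0" using f by (auto simp: tame_def)
  have fM: "\<bar>f y\<bar> \<le> M" and fL: "\<bar>f y - f y'\<bar> \<le> L * norm (y - y')" for y y'
    using f by (auto simp: tame_def)
  let ?B = "cball c r"
  have [measurable]: "?B \<in> sets borel" by simp
  have m1: "(\<lambda>z. ennreal (kern p ?s M L (fst z - snd z)) * indicator ?B (fst z)) \<in> borel_measurable (lborel \<Otimes>\<^sub>M lborel)"
    and m2: "(\<lambda>z. ennreal (kern p ?s M L (fst z - snd z)) * indicator ?B (snd z)) \<in> borel_measurable (lborel \<Otimes>\<^sub>M lborel)"
    by (intro borel_measurable_times_ennreal measurable_compose[OF measurable_fst] measurable_compose[OF measurable_snd]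
        borel_measurable_indicator; measurable)+
  have out: "f y = 0" if "y \<notin> ?B" for y using that c[of y] by (auto simp: dist_norm norm_minus_commute)
  have pt: "ennreal (\<bar>f x - f y\<bar> powr p) * gag_kernel ?s (x, y)
      \<le> ennreal (kern p ?s M L (x - y)) * indicator ?B x + ennreal (kern p ?s M L (x - y)) * indicator ?B y" for x y
  proof (cases "x \<in> ?B \<or> y \<in> ?B")
    case True
    have "\<bar>f x - f y\<bar> \<le> min (2 * M) (L * norm (x - y))"
      using fM[of x] fM[of y] fL[of x y] by linarith
    then have "\<bar>f x - f y\<bar> powr p \<le> min (2 * M) (L * norm (x - y)) powr p"
      using p by (intro powr_mono2) auto
    then have "\<bar>f x - f y\<bar> powr p * (1 / norm (x - y) powr ?s) \<le> kern p ?s M L (x - y)"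
      by (simp add: kern_def divide_right_mono)
    then have "ennreal (\<bar>f x - f y\<bar> powr p) * gag_kernel ?s (x, y) \<le> ennreal (kern p ?s M L (x - y))"
      by (simp add: gag_kernel_def ennreal_leI flip: ennreal_mult')
    then show ?thesis using True
      by (auto simp: indicator_def intro: add_increasing2)
  next
    case False
    then show ?thesis using out by simp
  qed
  have I: "(\<integral>\<^sup>+y. ennreal (kern p ?s M L (x - y)) \<partial>lborel) = ?I" for x :: "real^'n"
    using nn_integral_lborel_affine[of "\<lambda>h. ennreal (kern p ?s M L (h :: real^'n))" "-1" x] by simp
  have I': "(\<integral>\<^sup>+x. ennreal (kern p ?s M L (x - y)) \<partial>lborel) = ?I" for y :: "real^'n"
    using nn_integral_lborel_affine[of "\<lambda>h. ennreal (kern p ?s M L (h :: real^'n))" 1 "-y"] by simp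
  have E: "(\<integral>\<^sup>+x. ?I * indicator ?B x \<partial>lborel) = ?I * emeasure lborel ?B"
    by (rule nn_integral_cmult_indicator) simp
  have "gag_energy ?s p f \<le> (\<integral>\<^sup>+z. ennreal (kern p ?s M L (fst z - snd z)) * indicator ?B (fst z)
       + ennreal (kern p ?s M L (fst z - snd z)) * indicator ?B (snd z) \<partial>(lborel \<Otimes>\<^sub>M lborel))"
    unfolding gag_energy_def energy_def
    by (intro nn_integral_mono) (metis pt prod.collapse)
  also have "\<dots> = (\<integral>\<^sup>+z. ennreal (kern p ?s M L (fst z - snd z)) * indicator ?B (fst z) \<partial>(lborel \<Otimes>\<^sub>M lborel))
      + (\<integral>\<^sup>+z. ennreal (kern p ?s M L (fst z - snd z)) * indicator ?B (snd z) \<partial>(lborel \<Otimes>\<^sub>M lborel))"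
    by (intro nn_integral_add m1 m2)
  also have "(\<integral>\<^sup>+z. ennreal (kern p ?s M L (fst z - snd z)) * indicator ?B (fst z) \<partial>(lborel \<Otimes>\<^sub>M lborel))
      = (\<integral>\<^sup>+x. \<integral>\<^sup>+y. ennreal (kern p ?s M L (x - y)) * indicator ?B x \<partial>lborel \<partial>lborel)"
    by (subst lborel.nn_integral_fst[OF m1, symmetric]) simp
  also have "\<dots> = (\<integral>\<^sup>+x. ?I * indicator ?B x \<partial>lborel)"
    by (simp add: nn_integral_multc I)
  also have "(\<integral>\<^sup>+z. ennreal (kern p ?s M L (fst z - snd z)) * indicator ?B (snd z) \<partial>(lborel \<Otimes>\<^sub>M lborel))
      = (\<integral>\<^sup>+y. \<integral>\<^sup>+x. ennreal (kern p ?s M L (x - y)) * indicator ?B y \<partial>lborel \<partial>lborel)"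
    by (subst lborel_pair.nn_integral_snd[symmetric]) (simp_all add: case_prod_beta' m2)
  also have "\<dots> = (\<integral>\<^sup>+x. ?I * indicator ?B x \<partial>lborel)"
    by (simp add: nn_integral_multc I')
  also have "(\<integral>\<^sup>+x. ?I * indicator ?B x \<partial>lborel) + (\<integral>\<^sup>+x. ?I * indicator ?B x \<partial>lborel)
      = 2 * (?I * emeasure lborel ?B)"
    unfolding E by (rule mult_2[symmetric])
  also have "\<dots> \<le> 2 * (?I * ennreal ((2 * r) ^ CARD('n)))"
    by (intro mult_left_mono emeasure_cball_le r) auto
  also have "\<dots> = ennreal (2 * (2 * r) ^ CARD('n) * (M powr p * (M / L) powr (- (\<beta> * p)))) *
     (\<integral>\<^sup>+h. ennreal (kern p ?s 1 1 (h :: real^'n)) \<partial>lborel)"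
    unfolding kern_integral_scale[OF M L \<beta> p] using r
    by (simp add: ennreal_mult mult_ac)
  finally show ?thesis .
qed

section \<open>Convergence by summation over the scales\<close>

lemma tendsto_0_ennrealI:
  fixes f :: "'a \<Rightarrow> ennreal"
  assumes "\<And>e. 0 < e \<Longrightarrow> \<forall>\<^sub>F x in F. f x \<le> ennreal e"
  shows "(f \<longlongrightarrow> 0) F"
proof (rule order_tendstoI)
  fix c :: ennreal assume "0 < c"
  then obtain e where e: "0 < e" "e < c" using dense by blast
  then have "e \<noteq> \<infinity>" by auto
  then obtain r where r: "e = ennreal r" "0 \<le> r" by (cases e) auto
  then have "0 < r" using e by simp
  from assms[OF this] show "\<forall>\<^sub>F x in F. f x < c"
    by eventually_elim (use e r in auto)
qed simp

text \<open>The \<open>L\<^sup>p\<close> energy is the case \<open>Q = lborel\<close>, \<open>s = 0\<close>, \<open>\<beta> = 0\<close>; the Gagliardo energy is the case of the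
  product measure with \<open>a = fst\<close>, \<open>b = snd\<close>, \<open>s = 1\<close>.\<close>

locale degree_energy = degree_scales \<Omega> R \<alpha> H + sigma_finite_measure Q
  for \<Omega> :: "(real^'n) set" and R \<alpha> H and Q :: "'z measure" +
  fixes k :: "'z \<Rightarrow> ennreal" and a b :: "'z \<Rightarrow> real^'n" and s p \<beta> d' Ce Cl :: real and j0 :: nat
  assumes p: "1 \<le> p" and \<beta>: "0 \<le> \<beta>" "\<beta> < 1"
    and k [measurable]: "k \<in> borel_measurable Q"
    and a [measurable]: "a \<in> borel_measurable Q" and b [measurable]: "b \<in> borel_measurable Q"
    and AE_ab: "\<And>P. (AE y in lborel. P y) \<Longrightarrow> AE z in Q. P (a z) \<and> P (b z)"
    and Ce: "0 \<le> Ce"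
    and tame_le: "\<And>f r M L. tame r M L f \<Longrightarrow> 0 \<le> r \<Longrightarrow> 0 < M \<Longrightarrow> 0 < L \<Longrightarrow>
      energy Q k p (\<lambda>z. f (a z) - s * f (b z)) \<le> ennreal (Ce * (r ^ CARD('n) * (M powr p * (M / L) powr (- (\<beta> * p)))))"
    and Cl: "0 < Cl"
    and layer_le: "\<And>j. j0 \<le> j \<Longrightarrow> measure lborel (layer j) \<le> Cl * eps j powr (real CARD('n) - d')"
    and \<kappa>_pos: "0 < \<alpha> * (real CARD('n) / p - \<beta>) - d'"
begin

definition "En f = energy Q k p (\<lambda>z. f (a z) - s * f (b z))"

definition "\<kappa> = \<alpha> * (real CARD('n) / p - \<beta>) - d'"

lemma En_integral:
  fixes g :: "real^'n \<Rightarrow> real^'n \<Rightarrow> real"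
  assumes S: "S \<in> sets borel" "bounded S" and g: "continuous_on UNIV (\<lambda>(y, x). g y x)"
    and int: "\<And>y. set_integrable lborel S (g y)"
    and t: "\<And>x. x \<in> S \<Longrightarrow> tame r M L (\<lambda>y. g y x)" "0 \<le> r" "0 < M" "0 < L"
  shows "En (\<lambda>y. LINT x:S|lborel. g y x) \<le>
    ennreal (measure lborel S powr p * (Ce * (r ^ CARD('n) * (M powr p * (M / L) powr (- (\<beta> * p))))))"
proof -
  let ?C = "Ce * (r ^ CARD('n) * (M powr p * (M / L) powr (- (\<beta> * p))))"
  have C0: "0 \<le> ?C" using Ce t by simp
  have gm: "(\<lambda>w. g (fst w) (snd w)) \<in> borel_measurable borel"
    using g by (intro borel_measurable_continuous_onI) (simp add: case_prod_beta')
  have pair: "(\<lambda>w. (f (fst w), snd w)) \<in> borel_measurable (Q \<Otimes>\<^sub>M (lborel :: (real^'n) measure))"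
    if [measurable]: "f \<in> borel_measurable Q" for f :: "'z \<Rightarrow> real^'n"
    by (intro borel_measurable_Pair) measurable
  have m: "(\<lambda>w. g (f (fst w)) (snd w)) \<in> borel_measurable (Q \<Otimes>\<^sub>M lborel)"
    if "f \<in> borel_measurable Q" for f
    using measurable_compose[OF pair[OF that] gm] by simp
  have eq: "(LINT x:S|lborel. g (a z) x) - s * (LINT x:S|lborel. g (b z) x)
      = (LINT x:S|lborel. g (a z) x - s * g (b z) x)" for z
    using int by (subst set_integral_diff) (auto intro: set_integrable_mult_right)
  have "energy Q k p (\<lambda>z. LINT x:S|lborel. g (a z) x - s * g (b z) x)
      \<le> ennreal (measure lborel S powr p) * ennreal ?C"
  proof (rule energy_integral_le[OF _ k _ S(1) _ _ p])
    show "sigma_finite_measure Q" ..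
    show "(\<lambda>(z, x). g (a z) x - s * g (b z) x) \<in> borel_measurable (Q \<Otimes>\<^sub>M lborel)"
      using m[OF a] m[OF b] by (simp add: case_prod_beta')
    show "emeasure lborel S < \<infinity>" using S(2) by (rule emeasure_bounded_finite)
    show "set_integrable lborel S (\<lambda>x. g (a z) x - s * g (b z) x)" for z
      using int by (intro set_integral_diff(1) set_integrable_mult_right) auto
    show "energy Q k p (\<lambda>z. g (a z) x - s * g (b z) x) \<le> ennreal ?C" if "x \<in> S" for x
      using tame_le[OF t(1)[OF that] t(2-4)] .
  qed
  also have "\<dots> = ennreal (measure lborel S powr p * ?C)"
    using C0 by (simp add: ennreal_mult)
  finally show ?thesis by (simp add: En_def eq)
qed

lemma rad_nonneg: "0 \<le> rad j" using dl_pos[of j] by (simp add: rad_def)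

lemma sets_\<Omega>: "\<Omega> \<in> sets borel" using open_\<Omega> by simp

lemma En_F_finite: "holder_on_space \<alpha> H V \<Longrightarrow> En (F V j) < \<infinity>"
proof -
  assume V: "holder_on_space \<alpha> H V"
  have "En (F V j) \<le> ennreal (measure lborel \<Omega> powr p *
      (Ce * (rad j ^ CARD('n) * (Mb j powr p * (Mb j / (Mb j / dl j)) powr (- (\<beta> * p))))))"
    unfolding F_def[abs_def]
    by (rule En_integral[OF sets_\<Omega> bounded_\<Omega> continuous_A integrable_A[OF V] tame_A[OF V] rad_nonneg Mb_pos])
       (simp_all add: Mb_pos dl_pos)
  also have "\<dots> < \<infinity>" by simp
  finally show ?thesis .
qed

lemma F_measurable [measurable]: "F V j \<in> borel_measurable borel"
proof -
  have A: "(\<lambda>w. A V j (fst w) (snd w)) \<in> borel_measurable borel"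
    using continuous_A[of V j] by (intro borel_measurable_continuous_onI) (simp add: case_prod_beta')
  have "(\<lambda>w. A V j (fst w) (snd w)) \<in> borel_measurable (borel \<Otimes>\<^sub>M lborel)"
    using A by (subst measurable_cong_sets[OF _ refl, of _ borel])
      (simp_all add: borel_prod flip: borel_prod cong: sets_pair_measure_cong)
  then have "(\<lambda>(y, x). indicator \<Omega> x *\<^sub>R A V j y x) \<in> borel_measurable (borel \<Otimes>\<^sub>M lborel)"
    using sets_\<Omega> by (simp add: case_prod_beta')
  then show ?thesis
    unfolding F_def[abs_def] set_lebesgue_integral_def
    by (rule lborel.borel_measurable_lebesgue_integral)
qed

text \<open>The bumps have height of order \<open>\<eta>\<close> at a fixed Lipschitz constant, so
  their energy is of order \<open>\<eta> powr (p * (1 - \<beta>))\<close>, which is small because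
  \<open>\<beta> < 1\<close>.\<close>

lemma En_F_diff:
  fixes e :: real
  assumes e: "0 < e"
  obtains \<eta> where "0 < \<eta>" "\<And>V V'. holder_on_space \<alpha> H V \<Longrightarrow> holder_on_space \<alpha> H V' \<Longrightarrow>
    (\<And>z. norm (V z - V' z) \<le> \<eta>) \<Longrightarrow> En (\<lambda>y. F V j y - F V' j y) \<le> ennreal e"
proof -
  define c where "c = measure lborel \<Omega> powr p * (Ce * (rad j ^ CARD('n) * (Mb j / dl j) powr p))"
  have c: "0 \<le> c" using Ce rad_nonneg[of j] by (simp add: c_def)
  let ?t = "p * (1 - \<beta>)"
  have t: "0 < ?t" using p \<beta> by simp
  \<comment> \<open>Solves \<open>(c + 1) * \<eta> powr ?t = e\<close>, capped at
    \<open>dl j\<close> so that \<open>tame_A_diff\<close> applies; the added 1 covers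
    \<open>c = 0\<close>.\<close>
  define \<eta> where "\<eta> = min (dl j) ((e / (c + 1)) powr (1 / ?t))"
  have \<eta>: "0 < \<eta>" "\<eta> \<le> dl j" using dl_pos[of j] e c by (auto simp: \<eta>_def)
  have "\<eta> powr ?t \<le> ((e / (c + 1)) powr (1 / ?t)) powr ?t"
    using \<eta> t by (intro powr_mono2) (auto simp: \<eta>_def)
  also have "\<dots> = (e / (c + 1)) powr (1 / ?t * ?t)" by (rule powr_powr)
  also have "1 / ?t * ?t = 1" using t by (metis divide_self_if less_irrefl times_divide_eq_left mult_1)
  also have "(e / (c + 1)) powr 1 = e / (c + 1)" using e c by simp
  finally have "c * \<eta> powr ?t \<le> c * (e / (c + 1))" using c by (intro mult_left_mono)
  also have "\<dots> \<le> e" using e c by (simp add: field_simps)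
  finally have ce: "c * \<eta> powr ?t \<le> e" .
  have "En (\<lambda>y. F V j y - F V' j y) \<le> ennreal e"
    if V: "holder_on_space \<alpha> H V" "holder_on_space \<alpha> H V'" and VV': "\<And>z. norm (V z - V' z) \<le> \<eta>" for V V'
  proof -
    let ?M = "Mb j * (\<eta> / dl j)" and ?L = "Mb j / dl j"
    have cont: "continuous_on UNIV (\<lambda>(y, x). A V j y x - A V' j y x)"
      using continuous_on_diff[OF continuous_A[of V j] continuous_A[of V' j]] by (simp add: case_prod_beta')
    have "En (\<lambda>y. LINT x:\<Omega>|lborel. A V j y x - A V' j y x) \<le> ennreal (measure lborel \<Omega> powr p *
        (Ce * (rad j ^ CARD('n) * (?M powr p * (?M / ?L) powr (- (\<beta> * p))))))"
      by (rule En_integral[OF sets_\<Omega> bounded_\<Omega> cont _ tame_A_diff[OF V _ VV' \<eta>(2)] rad_nonneg])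
         (use integrable_A V Mb_pos[of j] dl_pos[of j] \<eta> in \<open>auto intro!: set_integral_diff(1)\<close>)
    also have "measure lborel \<Omega> powr p * (Ce * (rad j ^ CARD('n) * (?M powr p * (?M / ?L) powr (- (\<beta> * p)))))
        = c * \<eta> powr ?t"
    proof -
      have M: "?M = ?L * \<eta>" by simp
      have "?M powr p = ?L powr p * \<eta> powr p" unfolding M by (rule powr_mult)
      moreover have "?M / ?L = \<eta>" using Mb_pos[of j] dl_pos[of j] by simp
      ultimately have "?M powr p * (?M / ?L) powr (- (\<beta> * p)) = ?L powr p * (\<eta> powr p * \<eta> powr (- (\<beta> * p)))"
        by simp
      also have "\<eta> powr p * \<eta> powr (- (\<beta> * p)) = \<eta> powr ?t"
        by (simp add: powr_add[symmetric] algebra_simps)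
      finally show ?thesis by (simp only: c_def mult.assoc)
    qed
    also have "ennreal \<dots> \<le> ennreal e" using ce by (rule ennreal_leI)
    also have "(\<lambda>y. LINT x:\<Omega>|lborel. A V j y x - A V' j y x) = (\<lambda>y. F V j y - F V' j y)"
      unfolding F_def using integrable_A V by (intro ext set_integral_diff(2)) auto
    finally show ?thesis .
  qed
  with \<eta>(1) show ?thesis using that by blast
qed

text \<open>The factors of the bound in \<open>En_step\<close> that are free of
  \<open>eps j\<close>.\<close>

definition "Cs = Cl powr p * (Ce * ((2 * real CARD('n) * K) ^ CARD('n) *
    ((30 * fact CARD('n) * real CARD('n) * (5 * C1) ^ CARD('n)) powr p * K powr (- (\<beta> * p)))))"

lemma Cs_nonneg: "0 \<le> Cs" using Ce Cl K_ge_1 by (simp add: Cs_def)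

lemma En_step:
  assumes V: "holder_on_space \<alpha> H V" and j: "j0 \<le> j"
  shows "En (\<lambda>y. F V (Suc j) y - F V j y) \<le> ennreal (Cs * (eps j powr \<kappa>) powr p)"
proof -
  let ?m = "measure lborel (layer j)" and ?e = "eps j" and ?n = "CARD('n)"
  let ?r = "Ce * (rad j ^ ?n * (Mb j powr p * (Mb j / (Mb j / dl j)) powr (- (\<beta> * p))))"
  have r0: "0 \<le> ?r" using Ce rad_nonneg[of j] by simp
  have sub: "layer j \<subseteq> \<Omega>" by (auto simp: layer_def)
  have bdl: "bounded (layer j)" using bounded_\<Omega> sub by (rule bounded_subset)
  have sl: "layer j \<in> sets borel" using open_layer by simp
  have cont: "continuous_on UNIV (\<lambda>(y, x). B V j y x - A V j y x)"
    using continuous_on_diff[OF continuous_B[of V j] continuous_A[of V j]] by (simp add: case_prod_beta')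
  have int: "set_integrable lborel (layer j) (\<lambda>x. B V j y x - A V j y x)" for y
    by (rule set_integrable_subset[OF set_integral_diff(1)[OF integrable_B[OF V] integrable_A[OF V]]])
       (use sub sl in auto)
  have "En (\<lambda>y. F V (Suc j) y - F V j y) \<le> ennreal (?m powr p * ?r)"
    unfolding F_Suc_diff[OF V]
    by (rule En_integral[OF sl bdl cont int tame_BA[OF V] rad_nonneg Mb_pos])
       (use sub Mb_pos[of j] dl_pos[of j] in auto)
  also have "\<dots> \<le> ennreal ((Cl * ?e powr (real ?n - d')) powr p * ?r)"
    using layer_le[OF j] p r0 by (intro ennreal_leI mult_right_mono powr_mono2) auto
  also have "(Cl * ?e powr (real ?n - d')) powr p * ?r = Cs * (?e powr \<kappa>) powr p"
  proof -
    note e = eps_pos[of j] K_ge_1 C1_ge_1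
    let ?N = "30 * fact ?n * real ?n * (5 * C1) ^ ?n"
    have 1: "(Cl * ?e powr (real ?n - d')) powr p = Cl powr p * ?e powr ((real ?n - d') * p)"
      using Cl by (simp add: powr_mult powr_powr)
    have 2: "rad j ^ ?n = (2 * real ?n * K) ^ ?n * ?e powr (\<alpha> * real ?n)"
      using e by (simp add: rad_def dl_def power_mult_distrib powr_powr flip: powr_realpow)
    have "Mb j = ?N * ?e powr (- real ?n)"
      using e by (simp add: Mb_def E_def power_divide powr_minus powr_realpow divide_inverse power_mult_distrib power_inverse)
    then have 3: "Mb j powr p = ?N powr p * ?e powr (- real ?n * p)"
      using e by (simp add: powr_mult powr_powr)
    have "Mb j / (Mb j / dl j) = K * ?e powr \<alpha>"
      using Mb_pos[of j] by (simp add: dl_def)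
    then have 4: "(Mb j / (Mb j / dl j)) powr (- (\<beta> * p)) = K powr (- (\<beta> * p)) * ?e powr (- \<alpha> * (\<beta> * p))"
      using e by (simp add: powr_mult powr_powr)
    \<comment> \<open>The exponents of \<open>eps j\<close> from the layer, the support radius, the
      height, and the ratio of height to Lipschitz constant, in this order.\<close>
    have "(real ?n - d') * p + (\<alpha> * real ?n + (- real ?n * p + - \<alpha> * (\<beta> * p))) = \<kappa> * p"
      using p by (simp add: \<kappa>_def field_simps)
    then have 5: "?e powr ((real ?n - d') * p) * (?e powr (\<alpha> * real ?n) * (?e powr (- real ?n * p) * ?e powr (- \<alpha> * (\<beta> * p))))
        = (?e powr \<kappa>) powr p"
      by (simp add: powr_powr flip: powr_add)
    show ?thesis
      unfolding 1 2 3 4 5[symmetric] Cs_def by (simp only: mult_ac)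
  qed
  finally show ?thesis .
qed

definition "q = (1/2) powr \<kappa>"
text \<open>Bounds the energy of everything from scale \<open>J\<close> on: a constant times the
  p-th power of a geometric tail.\<close>

definition "T J = Cs * (q ^ J / (1 - q)) powr p"

lemma q: "0 < q" "q < 1"
proof -
  have "0 < \<kappa>" using \<kappa>_pos by (simp add: \<kappa>_def)
  then show "0 < q" "q < 1" using powr_less_mono2_neg[of "-\<kappa>" 1 2] by (auto simp: q_def powr_divide powr_minus field_simps)
qed

lemma eps_powr_\<kappa>: "eps j powr \<kappa> = q ^ j"
  unfolding eps_def q_def by (induction j) (simp_all add: powr_mult powr_divide)

lemma T_tendsto_0: "T \<longlonglongrightarrow> 0"
proof -
  have "(\<lambda>J. q ^ J / (1 - q)) \<longlonglongrightarrow> 0 / (1 - q)"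
    using q by (intro tendsto_divide LIMSEQ_power_zero tendsto_const) auto
  then have "(\<lambda>J. (q ^ J / (1 - q)) powr p) \<longlonglongrightarrow> 0 powr p"
    using p q by (intro tendsto_powr2[OF _ tendsto_const]) auto
  then have "(\<lambda>J. Cs * (q ^ J / (1 - q)) powr p) \<longlonglongrightarrow> Cs * 0 powr p" by (intro tendsto_mult tendsto_const)
  then show ?thesis by (simp add: T_def[abs_def])
qed

text \<open>Uses \<open>energy_sum_le\<close> with the weights \<open>q ^ j\<close>, which match the
  decay in \<open>En_step\<close>.\<close>

lemma En_tail_finite:
  assumes V: "holder_on_space \<alpha> H V" and J: "j0 \<le> J" "J \<le> m"
  shows "En (\<lambda>y. F V m y - F V J y) \<le> ennreal (T J)"
proof -
  let ?h = "\<lambda>j z. (F V (Suc j) (a z) - F V j (a z)) - s * (F V (Suc j) (b z) - F V j (b z))"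
  have sum: "(\<Sum>j\<in>{J..<m}. F V (Suc j) y - F V j y) = F V m y - F V J y" for y
    using J(2) by (rule sum_Suc_diff')
  have "energy Q k p (\<lambda>z. \<Sum>j\<in>{J..<m}. ?h j z) \<le> ennreal (Cs * (\<Sum>j\<in>{J..<m}. q ^ j) powr p)"
  proof (rule energy_sum_le[OF _ _ p k])
    show "energy Q k p (?h j) \<le> ennreal (Cs * (q ^ j) powr p)" if "j \<in> {J..<m}" for j
      using En_step[OF V, of j] that J by (simp add: En_def eps_powr_\<kappa>)
  qed (use q Cs_nonneg in auto)
  also have "(\<lambda>z. \<Sum>j\<in>{J..<m}. ?h j z) = (\<lambda>z. (F V m (a z) - F V J (a z)) - s * (F V m (b z) - F V J (b z)))"
    by (simp add: sum sum_subtractf[of "\<lambda>j. F V (Suc j) _ - F V j _"] flip: sum_distrib_left)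
  also have "ennreal (Cs * (\<Sum>j\<in>{J..<m}. q ^ j) powr p) \<le> ennreal (T J)"
  proof -
    have "(1 - q) * (\<Sum>j\<in>{J..<m}. q ^ j) = q ^ J - q ^ m"
      using J(2)
    proof (induction m rule: dec_induct)
      case (step n)
      have "(1 - q) * (\<Sum>j\<in>{J..<Suc n}. q ^ j) = (1 - q) * (\<Sum>j\<in>{J..<n}. q ^ j) + (1 - q) * q ^ n"
        using step.hyps by (simp add: distrib_left)
      then show ?case unfolding step.IH by (simp add: algebra_simps)
    qed simp
    then have "(\<Sum>j\<in>{J..<m}. q ^ j) = (q ^ J - q ^ m) / (1 - q)"
      using q by (simp add: nonzero_eq_divide_eq mult.commute)
    also have "\<dots> \<le> q ^ J / (1 - q)" using q by (intro divide_right_mono) auto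
    finally have "(\<Sum>j\<in>{J..<m}. q ^ j) powr p \<le> (q ^ J / (1 - q)) powr p"
      using q p by (intro powr_mono2 sum_nonneg) auto
    then show ?thesis unfolding T_def using Cs_nonneg by (intro ennreal_leI mult_left_mono)
  qed
  finally show ?thesis by (simp add: En_def)
qed

text \<open>The bound on finite sums is uniform in the last scale, so Fatou's lemma carries it to
  the almost everywhere limit.\<close>

lemma En_tail:
  assumes V: "holder_on_space \<alpha> H V" and J: "j0 \<le> J"
    and lim: "AE y in lborel. (\<lambda>m. F V m y) \<longlonglongrightarrow> f y"
  shows "En (\<lambda>y. f y - F V J y) \<le> ennreal (T J)"
  unfolding En_def
proof (rule energy_fatou[OF k _ _ p])
  let ?h = "\<lambda>m z. (F V (m + J) (a z) - F V J (a z)) - s * (F V (m + J) (b z) - F V J (b z))"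
  show "?h m \<in> borel_measurable Q" for m by measurable
  show "AE z in Q. (\<lambda>m. ?h m z) \<longlonglongrightarrow> (f (a z) - F V J (a z)) - s * (f (b z) - F V J (b z))"
    using AE_ab[OF lim]
  proof eventually_elim
    case (elim z)
    then show ?case
      by (intro tendsto_intros LIMSEQ_ignore_initial_segment[of "\<lambda>m. F V m _"]) auto
  qed
  show "energy Q k p (?h m) \<le> ennreal (T J)" for m
    using En_tail_finite[OF V J, of "m + J"] by (simp add: En_def)
qed

lemma En_triangle3:
  assumes f: "f \<in> borel_measurable borel" "g \<in> borel_measurable borel" "h \<in> borel_measurable borel"
    and C: "0 \<le> C" "En f \<le> ennreal C" "En g \<le> ennreal C" "En h \<le> ennreal C"
  shows "En (\<lambda>y. f y + g y + h y) \<le> ennreal (C * 3 powr p)"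
proof -
  note [measurable] = f
  let ?F = "\<lambda>i::nat. if i = 0 then f else if i = 1 then g else h"
  have "energy Q k p (\<lambda>z. \<Sum>i\<in>{0,1,2}. ?F i (a z) - s * ?F i (b z)) \<le> ennreal (C * (\<Sum>i\<in>{0,1,2::nat}. 1) powr p)"
    by (rule energy_sum_le[OF _ _ p k]) (use C in \<open>auto simp: En_def\<close>)
  then show ?thesis by (simp add: En_def algebra_simps)
qed

lemma En_minus: "En (\<lambda>y. - f y) = En f"
proof -
  have "\<bar>- f (a z) + s * f (b z)\<bar> = \<bar>f (a z) - s * f (b z)\<bar>" for z by linarith
  then show ?thesis by (simp add: En_def energy_def)
qed

text \<open>\<open>T\<close> is the same for all maps with the Hoelder bound \<open>H\<close>, so a
  single scale \<open>J\<close> is chosen first; at this scale \<open>En_F_diff\<close> handles the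
  convergence in \<open>i\<close>.\<close>

theorem En_converges:
  assumes Vk: "\<And>i. holder_on_space \<alpha> H (Vk i)" and V: "holder_on_space \<alpha> H V"
    and unif: "\<And>\<eta>. 0 < \<eta> \<Longrightarrow> \<forall>\<^sub>F i in sequentially. \<forall>z. norm (Vk i z - V z) \<le> \<eta>"
    and limk: "\<And>i. AE y in lborel. (\<lambda>m. F (Vk i) m y) \<longlonglongrightarrow> fk i y"
    and lim: "AE y in lborel. (\<lambda>m. F V m y) \<longlonglongrightarrow> f y"
    and fm: "\<And>i. fk i \<in> borel_measurable borel" "f \<in> borel_measurable borel"
  shows "(\<lambda>i. En (\<lambda>y. fk i y - f y)) \<longlonglongrightarrow> 0"
proof (rule tendsto_0_ennrealI)
  fix e :: real assume e: "0 < e"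
  \<comment> \<open>Compensates the factor \<open>3 powr p\<close> lost in
    \<open>En_triangle3\<close>.\<close>
  define e' where "e' = e / 3 powr p"
  have e': "0 < e'" "e' * 3 powr p = e" using e by (auto simp: e'_def)
  have "\<forall>\<^sub>F J in sequentially. T J < e'" using T_tendsto_0 e'(1) by (rule order_tendstoD)
  then obtain J where J: "T J < e'" "j0 \<le> J"
    using eventually_ge_at_top[of j0] by (metis (mono_tags, lifting) eventually_conj eventually_happens sequentially_bot)
  obtain \<eta> where \<eta>: "0 < \<eta>" "\<And>V V'. holder_on_space \<alpha> H V \<Longrightarrow> holder_on_space \<alpha> H V' \<Longrightarrow>
    (\<And>z. norm (V z - V' z) \<le> \<eta>) \<Longrightarrow> En (\<lambda>y. F V J y - F V' J y) \<le> ennreal e'"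
    using En_F_diff[OF e'(1)] by blast
  show "\<forall>\<^sub>F i in sequentially. En (\<lambda>y. fk i y - f y) \<le> ennreal e"
    using unif[OF \<eta>(1)]
  proof eventually_elim
    case (elim i)
    have "En (\<lambda>y. (fk i y - F (Vk i) J y) + (F (Vk i) J y - F V J y) + - (f y - F V J y)) \<le> ennreal (e' * 3 powr p)"
    proof (rule En_triangle3)
      show "En (\<lambda>y. fk i y - F (Vk i) J y) \<le> ennreal e'"
        using En_tail[OF Vk J(2) limk, of i] J(1) by (meson ennreal_leI less_imp_le order.trans)
      show "En (\<lambda>y. F (Vk i) J y - F V J y) \<le> ennreal e'" using \<eta>(2)[OF Vk V] elim by blast
      show "En (\<lambda>y. - (f y - F V J y)) \<le> ennreal e'"
        unfolding En_minus using En_tail[OF V J(2) lim] J(1) by (meson ennreal_leI less_imp_le order.trans)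
    qed (use fm e'(1) in auto)
    then show ?case using e'(2) by simp
  qed
qed

text \<open>Compares with scale \<open>j0\<close>, from which on the layer estimate holds and whose
  own energy is finite.\<close>

theorem En_finite:
  assumes V: "holder_on_space \<alpha> H V" and lim: "AE y in lborel. (\<lambda>m. F V m y) \<longlonglongrightarrow> f y"
    and fm: "f \<in> borel_measurable borel"
  shows "En f < \<infinity>"
proof -
  obtain c where c: "En (F V j0) = ennreal c" "0 \<le> c" using En_F_finite[OF V, of j0] by (cases "En (F V j0)") auto
  have T0: "0 \<le> T j0" using Cs_nonneg by (simp add: T_def)
  have z: "En (\<lambda>y. 0) = 0" by (simp add: En_def energy_def)
  have "En (\<lambda>y. (f y - F V j0 y) + F V j0 y + 0) \<le> ennreal ((T j0 + c) * 3 powr p)"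
  proof (rule En_triangle3)
    have "ennreal (T j0) \<le> ennreal (T j0 + c)" using c by (intro ennreal_leI) simp
    then show "En (\<lambda>y. f y - F V j0 y) \<le> ennreal (T j0 + c)"
      using En_tail[OF V order_refl lim] by (rule order.trans[rotated])
    show "En (F V j0) \<le> ennreal (T j0 + c)" using c T0 by (simp add: ennreal_leI)
  qed (use fm c T0 z in auto)
  then show ?thesis by (simp add: le_less_trans)
qed

end

subsection \<open>Identification with the Brouwer degree\<close>

lemma C1_map_smooth:
  assumes "smooth_map w" shows "C1_map w (\<lambda>x. jacobian w (at x))"
proof -
  have 1: "C_on_space (Suc 0) w" using assms unfolding smooth_map_def by blast
  then have d: "w differentiable at x" for x by simp
  have c: "continuous_on UNIV (\<lambda>x. frechet_derivative w (at x) (axis j 1))" for j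
    using 1 by (auto simp: Basis_vec_def)
  have "continuous_on UNIV (\<lambda>x. \<chi> i j. frechet_derivative w (at x) (axis j 1) $ i)"
    by (intro continuous_intros c)
  then show ?thesis
    using d by (auto simp: C1_map_def jacobian_def matrix_def jacobian_works[unfolded jacobian_def matrix_def])
qed

text \<open>Polynomials are closed under differentiation. This makes them smooth in the sense of
  iterated partial derivatives (\<open>smooth_map_polynomial\<close>).\<close>

lemma real_polynomial_frechet:
  fixes f :: "'a::euclidean_space \<Rightarrow> real"
  assumes "real_polynomial_function f"
  shows "(\<forall>x. f differentiable at x) \<and> (\<forall>b. real_polynomial_function (\<lambda>x. frechet_derivative f (at x) b))"
  using assms
proof (induction rule: real_polynomial_function.induct)
  case (linear f)
  then have "(f has_derivative f) (at x)" for x by (rule bounded_linear_imp_has_derivative)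
  then have "f differentiable at x" "frechet_derivative f (at x) = f" for x
    by (auto simp: differentiable_def frechet_derivative_at[symmetric])
  then show ?case by auto
next
  case (const c)
  have "frechet_derivative (\<lambda>x::'a. c) (at x) = (\<lambda>h. 0)" for x by (rule frechet_derivative_const)
  then show ?case by auto
next
  case (add f g)
  have d: "((\<lambda>x. f x + g x) has_derivative
      (\<lambda>h. frechet_derivative f (at x) h + frechet_derivative g (at x) h)) (at x)" for x
    using add by (intro has_derivative_add) (auto simp: frechet_derivative_works[symmetric])
  have "frechet_derivative (\<lambda>x. f x + g x) (at x)
      = (\<lambda>h. frechet_derivative f (at x) h + frechet_derivative g (at x) h)" for x
    using frechet_derivative_at[OF d[of x]] by (rule sym)
  moreover have "(\<lambda>x. f x + g x) differentiable at x" for x using d by (auto simp: differentiable_def)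
  ultimately show ?case using add by auto
next
  case (mult f g)
  have d: "((\<lambda>x. f x * g x) has_derivative
      (\<lambda>h. f x * frechet_derivative g (at x) h + frechet_derivative f (at x) h * g x)) (at x)" for x
    using mult by (intro has_derivative_mult) (auto simp: frechet_derivative_works[symmetric])
  have "frechet_derivative (\<lambda>x. f x * g x) (at x)
      = (\<lambda>h. f x * frechet_derivative g (at x) h + frechet_derivative f (at x) h * g x)" for x
    using frechet_derivative_at[OF d[of x]] by (rule sym)
  moreover have "(\<lambda>x. f x * g x) differentiable at x" for x using d by (auto simp: differentiable_def)
  ultimately show ?case using mult by (auto intro!: real_polynomial_function.intros(3,4))
qed

lemma polynomial_frechet:
  fixes f :: "'a::euclidean_space \<Rightarrow> 'b::euclidean_space"
  assumes "polynomial_function f"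
  shows "f differentiable at x" "polynomial_function (\<lambda>x. frechet_derivative f (at x) b)"
proof -
  have comp: "real_polynomial_function (\<lambda>x. f x \<bullet> i)" for i
    using assms bounded_linear_inner_left[of i] unfolding polynomial_function_def comp_def by blast
  then have "(\<lambda>x. f x \<bullet> i) differentiable at x" for i x using real_polynomial_frechet by blast
  then show d: "f differentiable at x" for x
    using differentiable_componentwise_within[of f x UNIV] by simp
  have "real_polynomial_function (\<lambda>x. frechet_derivative f (at x) b \<bullet> i)" for i
  proof -
    have di: "((\<lambda>x. f x \<bullet> i) has_derivative (\<lambda>h. frechet_derivative f (at x) h \<bullet> i)) (at x)" for x
      using d[of x] by (intro has_derivative_inner_left) (simp add: frechet_derivative_works[symmetric])
    have "frechet_derivative (\<lambda>x. f x \<bullet> i) (at x) = (\<lambda>h. frechet_derivative f (at x) h \<bullet> i)" for x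
      using frechet_derivative_at[OF di[of x]] by (rule sym)
    then show ?thesis using real_polynomial_frechet[OF comp[of i]] by simp
  qed
  then show "polynomial_function (\<lambda>x. frechet_derivative f (at x) b)"
    by (subst polynomial_function_iff_Basis_inner) blast
qed

lemma smooth_map_polynomial:
  fixes f :: "'a::euclidean_space \<Rightarrow> 'b::euclidean_space"
  assumes "polynomial_function f" shows "smooth_map f"
  unfolding smooth_map_def
proof
  fix k show "C_on_space k f"
    using assms
  proof (induction k arbitrary: f)
    case 0
    then show ?case by (simp add: continuous_on_polymonial_function)
  next
    case (Suc k)
    then show ?case using polynomial_frechet[OF Suc.prems] by auto
  qed
qed

lemma C1_map_convex:
  assumes "C1_map f F" "C1_map g G"
  shows "C1_map (\<lambda>x. (1 - t) *\<^sub>R f x + t *\<^sub>R g x - y) (\<lambda>x. (1 - t) *\<^sub>R F x + t *\<^sub>R G x)"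
  unfolding C1_map_def
proof (intro conjI allI)
  fix x
  have "((\<lambda>x. (1 - t) *\<^sub>R f x + t *\<^sub>R g x - y) has_derivative
      (\<lambda>h. (1 - t) *\<^sub>R (F x *v h) + t *\<^sub>R (G x *v h) - 0)) (at x)"
    by (intro has_derivative_diff has_derivative_add has_derivative_scaleR_right has_derivative_const
        C1_map_derivative assms)
  then show "((\<lambda>x. (1 - t) *\<^sub>R f x + t *\<^sub>R g x - y) has_derivative
      (*v) ((1 - t) *\<^sub>R F x + t *\<^sub>R G x)) (at x)"
    by (rule has_derivative_eq_rhs)
       (simp add: fun_eq_iff matrix_vector_mult_add_rdistrib scaleR_matrix_vector_assoc)
  show "continuous_on UNIV (\<lambda>x. (1 - t) *\<^sub>R F x + t *\<^sub>R G x)"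
    by (intro continuous_intros C1_map_continuous'[OF assms(1)] C1_map_continuous'[OF assms(2)])
qed

lemma signed_count_Ints: "signed_count w \<Omega> y \<in> \<int>"
  unfolding signed_count_def by (intro Ints_sum) (auto simp: sgn_if)

lemma closure_extension_eq:
  assumes V: "continuous_on UNIV V" and v: "\<And>x. x \<in> \<Omega> \<Longrightarrow> V x = v x" and x: "x \<in> closure \<Omega>"
  shows "closure_extension \<Omega> v x = V x"
proof (cases "x \<in> \<Omega>")
  case False
  then have nt: "at x within \<Omega> \<noteq> bot"
    using x by (simp add: trivial_limit_within closure_def)
  have "(V \<longlongrightarrow> V x) (at x within \<Omega>)"
    using V by (meson UNIV_I continuous_on_def subset_UNIV tendsto_within_subset)
  then have "(v \<longlongrightarrow> V x) (at x within \<Omega>)"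
    by (rule Lim_transform_eventually) (auto simp: eventually_at_filter v)
  then show ?thesis using False nt by (simp add: closure_extension_def tendsto_Lim)
qed (simp add: closure_extension_def v)

section \<open>Limits of the mollified degrees\<close>

context degree_scales
begin

lemma dl_tendsto_0: "dl \<longlonglongrightarrow> 0"
proof -
  have "eps j powr \<alpha> = ((1/2) powr \<alpha>) ^ j" for j
    unfolding eps_def by (induction j) (simp_all add: powr_mult powr_divide)
  moreover have "(1/2) powr \<alpha> < (1::real)" using \<alpha>(1) powr_less_mono2[of \<alpha> "1/2" 1] by simp
  then have "(\<lambda>j. K * ((1/2) powr \<alpha>) ^ j) \<longlonglongrightarrow> K * 0"
    by (intro tendsto_mult tendsto_const LIMSEQ_power_zero) auto
  ultimately show ?thesis by (simp add: dl_def[abs_def])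
qed

lemma eps_tendsto_0: "eps \<longlonglongrightarrow> 0"
  unfolding eps_def[abs_def] by (intro LIMSEQ_power_zero) auto

lemma holder_continuous:
  fixes V :: "real^'n \<Rightarrow> real^'n"
  assumes "holder_on_space \<alpha> H V" "0 < e"
  obtains \<tau> where "0 < \<tau>" "\<And>x z. dist x z \<le> \<tau> \<Longrightarrow> norm (V x - V z) \<le> e"
proof
  \<comment> \<open>Solves \<open>(H + 1) * ?\<tau> powr \<alpha> = e\<close>; the added 1 avoids a
    division by zero.\<close>
  let ?\<tau> = "(e / (H + 1)) powr (1 / \<alpha>)"
  show "0 < ?\<tau>" using assms(2) H by simp
  fix x z :: "real^'n" assume "dist x z \<le> ?\<tau>"
  then have "norm (x - z) powr \<alpha> \<le> ?\<tau> powr \<alpha>" using \<alpha> by (intro powr_mono2) (auto simp: dist_norm)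
  also have "\<dots> = e / (H + 1)" using \<alpha> H assms(2) by (simp add: powr_powr)
  finally have "H * norm (x - z) powr \<alpha> \<le> H * (e / (H + 1))" using H by (intro mult_left_mono)
  also have "\<dots> \<le> e" using H assms(2) by (simp add: field_simps)
  finally show "norm (V x - V z) \<le> e"
    using assms(1) unfolding holder_on_space_def by (meson order.trans)
qed

lemma holder_continuous_on:
  fixes V :: "real^'n \<Rightarrow> real^'n"
  shows "holder_on_space \<alpha> H V \<Longrightarrow> continuous_on S V"
proof (rule continuous_on_subset[of UNIV])
  assume V: "holder_on_space \<alpha> H V"
  show "continuous_on UNIV V"
    unfolding continuous_on_iff
  proof (intro ballI allI impI)
    fix x :: "real^'n" and e :: real assume "0 < e"
    then obtain \<tau> where \<tau>: "0 < \<tau>" "\<And>x z. dist x z \<le> \<tau> \<Longrightarrow> norm (V x - V z) \<le> e / 2"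
      using holder_continuous[OF V, of "e / 2"] by (metis half_gt_zero)
    have "dist (V x') (V x) < e" if "dist x' x < \<tau>" for x'
      using \<tau>(2)[of x' x] that \<open>0 < e\<close> by (simp add: dist_norm)
    with \<tau>(1) show "\<exists>d>0. \<forall>x'\<in>UNIV. dist x' x < d \<longrightarrow> dist (V x') (V x) < e"
      by blast
  qed
qed simp

text \<open>Once \<open>dl j\<close> is small, \<open>u V j\<close> is joined to \<open>w\<close> by
  a segment, in steps over which \<open>integral_det_homotopy\<close> keeps the integral; at
  \<open>w\<close> the integral counts preimages. A single step would not do: near the frontier both
  maps stay away from \<open>y\<close>, but possibly in different coordinates, and a common side is
  certain only for maps that are close.\<close>

theorem F_eventually_signed_count:
  assumes V: "holder_on_space \<alpha> H V" and w: "C1_map w W"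
    and y: "y \<notin> V ` frontier \<Omega>"
    and close: "\<And>x z. x \<in> closure \<Omega> \<Longrightarrow> z \<in> frontier \<Omega> \<Longrightarrow> norm (w x - V x) < dist y (V z)"
    and reg: "\<And>x. x \<in> \<Omega> \<Longrightarrow> w x = y \<Longrightarrow> det (W x) \<noteq> 0"
  shows "\<forall>\<^sub>F j in sequentially. F V j y = (\<Sum>x\<in>{x \<in> \<Omega>. w x = y}. sgn (det (W x)))"
proof (cases "\<Omega> = {}")
  case True
  then have "F V j y = 0" for j unfolding F_def set_lebesgue_integral_def by simp
  moreover have "(\<Sum>x\<in>{x \<in> \<Omega>. w x = y}. sgn (det (W x))) = 0" using True by simp
  ultimately show ?thesis by simp
next
  case False
  let ?fr = "frontier \<Omega>" and ?n = "real CARD('n)"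
  have fr: "?fr \<noteq> {}" using False bounded_\<Omega> not_bounded_UNIV by (auto simp: frontier_eq_empty)
  have cfr: "compact ?fr" using bounded_\<Omega> by (simp add: compact_frontier_bounded)
  have ccl: "compact (closure \<Omega>)" using bounded_\<Omega> by (simp add: compact_closure)
  note cV = holder_continuous_on[OF V]
  have "continuous_on ?fr (\<lambda>z. dist y (V z))" by (intro continuous_intros cV)
  then obtain z0 where z0: "z0 \<in> ?fr" "\<And>z. z \<in> ?fr \<Longrightarrow> dist y (V z0) \<le> dist y (V z)"
    using continuous_attains_inf[OF cfr fr] by blast
  have "continuous_on (closure \<Omega>) (\<lambda>x. norm (w x - V x))" by (intro continuous_intros cV C1_map_continuous[OF w])
  moreover have "closure \<Omega> \<noteq> {}" using False by simp
  ultimately obtain x0 where x0: "x0 \<in> closure \<Omega>" "\<And>x. x \<in> closure \<Omega> \<Longrightarrow> norm (w x - V x) \<le> norm (w x0 - V x0)"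
    using continuous_attains_sup[OF ccl] by blast
  define D where "D = dist y (V z0)"
  \<comment> \<open>A quarter of the slack between the distance \<open>D\<close> of \<open>y\<close>
    from the image of the frontier and the error of \<open>w\<close>. This leaves
    \<open>2 * \<eta> \<le> norm (g t x)\<close> near the frontier.\<close>
  define \<eta> where "\<eta> = (D - norm (w x0 - V x0)) / 4"
  have \<eta>: "0 < \<eta>" "\<And>x. x \<in> \<Omega> \<Longrightarrow> norm (w x - V x) \<le> D - 4 * \<eta>" "4 * \<eta> \<le> D"
  proof -
    show "0 < \<eta>" "4 * \<eta> \<le> D" using close[OF x0(1) z0(1)] by (auto simp: \<eta>_def D_def)
    fix x assume "x \<in> \<Omega>"
    then have "x \<in> closure \<Omega>" using closure_subset by blast
    then show "norm (w x - V x) \<le> D - 4 * \<eta>" using x0(2)[of x] by (simp add: \<eta>_def field_simps)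
  qed
  obtain \<tau> where \<tau>: "0 < \<tau>" "\<And>x z. dist x z \<le> \<tau> \<Longrightarrow> norm (V x - V z) \<le> \<eta>"
    using holder_continuous[OF V \<eta>(1)] by blast
  have "(\<lambda>j. 2 * ?n * eps j) \<longlonglongrightarrow> 2 * ?n * 0" by (intro tendsto_mult tendsto_const eps_tendsto_0)
  then have "\<forall>\<^sub>F j in sequentially. 2 * ?n * eps j < \<tau>" using \<tau>(1) by (intro order_tendstoD(2)[of _ 0]) auto
  \<comment> \<open>A fixed cutoff, independent of \<open>j\<close>, whose layer is so thin that
    \<open>V\<close> is within \<open>\<eta>\<close> of some boundary value at each of its
    points.\<close>
  then obtain jc where jc: "2 * ?n * eps jc < \<tau>" by (meson eventually_happens sequentially_bot)
  have far: "D - \<eta> \<le> norm (V x - y)" if x: "x \<in> \<Omega>" "cutf jc x \<noteq> 1" for x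
  proof -
    have "x \<in> layer jc" using x by (simp add: layer_def)
    then obtain z where z: "z \<in> ?fr" "dist x z \<le> 2 * ?n * eps jc" by (rule layer_near_frontier)
    then have "norm (V x - V z) \<le> \<eta>" using \<tau>(2)[of x z] jc by simp
    moreover have "D \<le> norm (y - V z)" using z0(2)[OF z(1)] by (simp add: D_def dist_norm)
    ultimately show ?thesis using norm_triangle_ineq[of "V x - V z" "y - V x"] 
      by (simp add: norm_minus_commute algebra_simps)
  qed
  have y': "y \<notin> w ` ?fr"
  proof
    assume "y \<in> w ` ?fr"
    then obtain z where "z \<in> ?fr" "y = w z" by blast
    then show False using close[of z z] by (auto simp: frontier_def dist_norm)
  qed
  obtain \<delta>0 where \<delta>0: "\<delta>0 > 0" "\<And>\<delta>. 0 < \<delta> \<Longrightarrow> \<delta> \<le> \<delta>0 \<Longrightarrow>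
     (LINT x:\<Omega>|lborel. det (stepm \<delta> (w x - y) (W x))) = (\<Sum>x\<in>{x \<in> \<Omega>. w x = y}. sgn (det (W x)))"
    using integral_det_step_regular[OF open_\<Omega> bounded_\<Omega> w y' reg] by blast
  define \<delta>1 where "\<delta>1 = min \<delta>0 (\<eta> / ?n)"
  have "0 < \<delta>1" using \<delta>0(1) \<eta>(1) by (simp add: \<delta>1_def)
  then have "\<forall>\<^sub>F j in sequentially. dl j < \<delta>1" by (intro order_tendstoD(2)[OF dl_tendsto_0])
  then show ?thesis
  proof eventually_elim
    case (elim j)
    then have dl: "dl j \<le> \<delta>0" "dl j \<le> \<eta> / ?n" by (auto simp: \<delta>1_def)
    have "1 \<le> CARD('n)" by (simp add: Suc_le_eq)
    then have n1: "1 \<le> ?n" by linarith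
    have "\<eta> / ?n \<le> \<eta>" using \<eta>(1) n1 by (simp add: divide_le_eq)
    then have uV: "norm (u V j x - V x) \<le> \<eta>" if "x \<in> \<Omega>" for x
      using u_approx[OF V that, of j] dl dl_pos[of j] by linarith
    \<comment> \<open>Enough steps that \<open>g\<close> moves by at most
      \<open>\<eta> / (2 * ?n)\<close> in each; a coordinate larger than
      \<open>3 * \<eta> / (2 * ?n)\<close> in absolute value then stays beyond
      \<open>\<eta> / ?n\<close>, which is at least the step width.\<close>
    obtain N :: nat where N: "2 * ?n * D / \<eta> < real N" using reals_Archimedean2 by blast
    have "0 < D" using \<eta>(1,3) by linarith
    then have "0 < 2 * ?n * D / \<eta>" using \<eta>(1) n1 by simp
    with N have N0: "0 < real N" by linarith
    have DN: "D / real N \<le> \<eta> / (2 * ?n)" using N N0 \<eta>(1) n1 by (simp add: field_simps)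
    define g where "g t x = (1 - t) *\<^sub>R u V j x + t *\<^sub>R w x - y" for t :: real and x
    define G where "G t x = (1 - t) *\<^sub>R U V j x + t *\<^sub>R W x" for t :: real and x
    have gC: "C1_map (g t) (G t)" for t
      unfolding g_def[abs_def] G_def[abs_def] by (intro C1_map_convex C1_map_qi eps_pos w)
    let ?I = "\<lambda>t. LINT x:\<Omega>|lborel. det (stepm (dl j) (g t x) (G t x))"
    have step: "?I t = ?I t'" if t: "0 \<le> t" "t \<le> 1" "\<bar>t' - t\<bar> = 1 / real N" for t t'
    proof (rule integral_det_homotopy[OF open_\<Omega> bounded_\<Omega> cut[of jc] gC gC dl_pos])
      fix x assume x: "x \<in> \<Omega>" "cutf jc x \<noteq> 1"
      have m: "norm (w x - V x) \<le> D - 3 * \<eta>" "norm (u V j x - V x) \<le> D - 3 * \<eta>"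
        using \<eta> uV[OF x(1)] x(1) by force+
      have "norm ((1 - t) *\<^sub>R (u V j x - V x) + t *\<^sub>R (w x - V x)) \<le> (1 - t) * (D - 3 * \<eta>) + t * (D - 3 * \<eta>)"
        using m t by (intro order.trans[OF norm_triangle_ineq] add_mono) (auto intro!: mult_left_mono)
      then have "norm ((1 - t) *\<^sub>R (u V j x - V x) + t *\<^sub>R (w x - V x)) \<le> D - 3 * \<eta>" by (simp add: algebra_simps)
      moreover have "g t x = (V x - y) + ((1 - t) *\<^sub>R (u V j x - V x) + t *\<^sub>R (w x - V x))"
        by (simp add: g_def algebra_simps)
      ultimately have "2 * \<eta> \<le> norm (g t x)"
        using far[OF x] norm_diff_ineq[of "V x - y" "(1 - t) *\<^sub>R (u V j x - V x) + t *\<^sub>R (w x - V x)"] by simp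
      moreover have "?n * (3 * \<eta> / (2 * ?n)) < 2 * \<eta>" using n1 \<eta>(1) by (simp add: field_simps)
      ultimately have "?n * (3 * \<eta> / (2 * ?n)) < norm (g t x)" by linarith
      then obtain i where i: "3 * \<eta> / (2 * ?n) < \<bar>g t x $ i\<bar>" by (rule ex_large_component)
      have "g t' x - g t x = (t' - t) *\<^sub>R (w x - u V j x)" by (simp add: g_def algebra_simps)
      then have "norm (g t' x - g t x) = norm (w x - u V j x) / real N" using t(3) by simp
      also have "\<dots> \<le> D / real N"
      proof (intro divide_right_mono)
        have "norm (w x - u V j x) \<le> norm (w x - V x) + norm (u V j x - V x)"
          using norm_triangle_ineq4[of "w x - V x" "u V j x - V x"] by simp
        then show "norm (w x - u V j x) \<le> D" using \<eta>(1) \<eta>(2)[OF x(1)] uV[OF x(1)] by linarith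
      qed simp
      also have "\<dots> \<le> \<eta> / (2 * ?n)" by (rule DN)
      finally have "\<bar>(g t' x - g t x) $ i\<bar> \<le> \<eta> / (2 * ?n)" using component_le_norm_cart order.trans by blast
      moreover have "3 * \<eta> / (2 * ?n) = \<eta> / ?n + \<eta> / (2 * ?n)" using n1 by (simp add: field_simps)
      moreover have "0 < \<eta> / (2 * ?n)" using \<eta>(1) n1 by simp
      ultimately have "(dl j \<le> g t x $ i \<and> dl j \<le> g t' x $ i) \<or> (g t x $ i \<le> 0 \<and> g t' x $ i \<le> 0)"
        using i dl(2) dl_pos[of j] by (simp only: vector_minus_component) linarith
      then show "same_side (dl j) (g t x) (dl j) (g t' x)" unfolding same_side_def by blast
    qed
    have "?I (real i / real N) = ?I 0" if "i \<le> N" for i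
      using that
    proof (induction i)
      case (Suc i)
      have "?I (real i / real N) = ?I (real (Suc i) / real N)"
        using Suc.prems N0 by (intro step) (auto simp: field_simps)
      then show ?case using Suc by simp
    qed simp
    from this[of N] have "?I 1 = ?I 0" using N0 by simp
    moreover have "?I 0 = F V j y" by (simp add: F_def A_def g_def G_def)
    moreover have "?I 1 = (LINT x:\<Omega>|lborel. det (stepm (dl j) (w x - y) (W x)))" by (simp add: g_def G_def)
    ultimately show ?case using \<delta>0(2)[OF dl_pos dl(1)] by simp
  qed
qed

text \<open>A countable family of polynomial approximations keeps the exceptional set null: it
  consists of the image of the frontier and the critical values of all \<open>g m\<close>. For any
  other \<open>y\<close> some \<open>g m\<close> is admissible in the definition of the
  degree.\<close>

theorem brouwer_degree_eq:
  assumes V: "holder_on_space \<alpha> H V" and v: "\<And>x. x \<in> \<Omega> \<Longrightarrow> V x = v x"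
    and null: "negligible (V ` frontier \<Omega>)"
  shows "AE y in lborel. \<forall>\<^sub>F j in sequentially.
     F V j y = of_int (brouwer_degree (closure_extension \<Omega> v) \<Omega> y)"
proof -
  have ccl: "compact (closure \<Omega>)" using bounded_\<Omega> by (simp add: compact_closure)
  note cV = holder_continuous_on[OF V]
  have "\<exists>g. polynomial_function g \<and> (\<forall>x\<in>closure \<Omega>. norm (V x - g x) < inverse (real (Suc m)))" for m
    by (rule Stone_Weierstrass_polynomial_function[OF ccl cV]) simp
  then obtain g where g: "\<And>m. polynomial_function (g m)"
    "\<And>m x. x \<in> closure \<Omega> \<Longrightarrow> norm (V x - g m x) < inverse (real (Suc m))" by metis
  define crit where "crit m = {x \<in> \<Omega>. det (jacobian (g m) (at x)) = 0}" for m
  have gs: "smooth_map (g m)" for m using smooth_map_polynomial g(1) by blast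
  have "negligible (g m ` crit m)" for m
    by (rule negligible_critical_values[OF C1_map_derivative[OF C1_map_smooth[OF gs]]])
       (simp add: crit_def)
  then have "negligible (V ` frontier \<Omega> \<union> (\<Union>m. g m ` crit m))"
    using null by (intro negligible_Un negligible_countable_Union) auto
  then have "AE y in lebesgue. y \<notin> V ` frontier \<Omega> \<union> (\<Union>m. g m ` crit m)"
    unfolding negligible_iff_null_sets by (rule AE_not_in)
  then have "AE y in lborel. y \<notin> V ` frontier \<Omega> \<union> (\<Union>m. g m ` crit m)"
    by (simp add: AE_completion_iff)
  then show ?thesis
  proof eventually_elim
    case (elim y)
    then have y: "y \<notin> V ` frontier \<Omega>" by blast
    let ?v = "closure_extension \<Omega> v"
    have vV: "?v x = V x" if "x \<in> closure \<Omega>" for x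
      using closure_extension_eq[OF cV v that] .
    have fcl: "frontier \<Omega> \<subseteq> closure \<Omega>" by (auto simp: frontier_def)
    have img: "?v ` frontier \<Omega> = V ` frontier \<Omega>" using vV fcl by (intro image_cong) auto
    define valid where "valid w \<longleftrightarrow> smooth_map w \<and> regular_value_on w \<Omega> y \<and>
      (\<forall>x\<in>closure \<Omega>. \<forall>z\<in>frontier \<Omega>. norm (w x - ?v x) < dist y (?v z))" for w
    have ev: "\<forall>\<^sub>F j in sequentially. F V j y = signed_count w \<Omega> y" if "valid w" for w
      unfolding signed_count_def
    proof (rule F_eventually_signed_count[OF V C1_map_smooth y])
      show "smooth_map w" using that by (simp add: valid_def)
      show "norm (w x - V x) < dist y (V z)" if "x \<in> closure \<Omega>" "z \<in> frontier \<Omega>" for x z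
        using \<open>valid w\<close> that vV fcl unfolding valid_def by (metis subsetD)
      show "det (jacobian w (at x)) \<noteq> 0" if "x \<in> \<Omega>" "w x = y" for x
        using \<open>valid w\<close> that unfolding valid_def regular_value_on_def by blast
    qed
    have "\<exists>m. valid (g m)"
    proof -
      have "\<exists>m. \<forall>z\<in>frontier \<Omega>. inverse (real (Suc m)) < dist y (V z)"
      proof (cases "frontier \<Omega> = {}")
        case False
        have "compact (frontier \<Omega>)" using bounded_\<Omega> by (simp add: compact_frontier_bounded)
        moreover have "continuous_on (frontier \<Omega>) (\<lambda>z. dist y (V z))" by (intro continuous_intros cV)
        ultimately obtain z0 where z0: "z0 \<in> frontier \<Omega>" "\<And>z. z \<in> frontier \<Omega> \<Longrightarrow> dist y (V z0) \<le> dist y (V z)"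
          using continuous_attains_inf[OF _ False] by blast
        have "0 < dist y (V z0)" using y z0(1) by auto
        then obtain m where "inverse (real (Suc m)) < dist y (V z0)" using reals_Archimedean by blast
        then show ?thesis using z0(2) by (meson less_le_trans)
      qed auto
      then obtain m where m: "\<And>z. z \<in> frontier \<Omega> \<Longrightarrow> inverse (real (Suc m)) < dist y (V z)" by blast
      have "valid (g m)"
        unfolding valid_def
      proof (intro conjI ballI)
        show "regular_value_on (g m) \<Omega> y"
          using elim unfolding regular_value_on_def crit_def by blast
        fix x z assume "x \<in> closure \<Omega>" "z \<in> frontier \<Omega>"
        then show "norm (g m x - ?v x) < dist y (?v z)"
          using g(2)[of x m] m[of z] vV fcl by (force simp: norm_minus_commute)
      qed (rule gs)
      then show ?thesis by blast
    qed
    then obtain m0 where m0: "valid (g m0)" by blast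
    obtain i where i: "signed_count (g m0) \<Omega> y = of_int i" using signed_count_Ints by (metis Ints_cases)
    have "brouwer_degree ?v \<Omega> y = i"
      unfolding brouwer_degree_def img if_not_P[OF y]
    proof (rule the_equality)
      show "\<exists>w. smooth_map w \<and> regular_value_on w \<Omega> y \<and>
              (\<forall>x\<in>closure \<Omega>. \<forall>z\<in>frontier \<Omega>. norm (w x - ?v x) < dist y (?v z)) \<and>
              of_int i = signed_count w \<Omega> y"
        using m0 i unfolding valid_def by (metis)
      fix m assume "\<exists>w. smooth_map w \<and> regular_value_on w \<Omega> y \<and>
              (\<forall>x\<in>closure \<Omega>. \<forall>z\<in>frontier \<Omega>. norm (w x - ?v x) < dist y (?v z)) \<and>
              of_int m = signed_count w \<Omega> y"
      \<comment> \<open>Uniqueness: the counts of any two admissible maps both equal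
        \<open>F V j y\<close> for large \<open>j\<close>.\<close>
      then obtain w where w: "valid w" "of_int m = signed_count w \<Omega> y" unfolding valid_def by blast
      have "\<forall>\<^sub>F j::nat in sequentially. signed_count w \<Omega> y = signed_count (g m0) \<Omega> y"
        using ev[OF w(1)] ev[OF m0] by eventually_elim simp
      then have "signed_count w \<Omega> y = signed_count (g m0) \<Omega> y" by simp
      then show "m = i" using w(2) i by simp
    qed
    then show ?case using ev[OF m0] i by simp
  qed
qed

end

subsection \<open>Hoelder extension\<close>

text \<open>On the unit interval \<open>x \<le> x powr \<alpha>\<close>; this is applied to the
  shares of \<open>a\<close> and \<open>b\<close> in \<open>a + b\<close>.\<close>

lemma powr_subadditive:
  fixes a b :: real
  assumes "0 \<le> a" "0 \<le> b" "0 < \<alpha>" "\<alpha> \<le> 1"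
  shows "(a + b) powr \<alpha> \<le> a powr \<alpha> + b powr \<alpha>"
proof (cases "a + b = 0")
  case False
  then have s: "0 < a + b" using assms by linarith
  have le: "x / (a + b) \<le> (x / (a + b)) powr \<alpha>" if "0 \<le> x" "x \<le> a + b" for x
  proof (cases "x = 0")
    case False
    have "(x / (a + b)) powr 1 \<le> (x / (a + b)) powr \<alpha>"
      using that s False assms by (intro powr_mono') auto
    then show ?thesis using that s by simp
  qed simp
  have "1 = a / (a + b) + b / (a + b)" using s by (simp add: add_divide_distrib[symmetric])
  also have "\<dots> \<le> (a / (a + b)) powr \<alpha> + (b / (a + b)) powr \<alpha>"
    using assms by (intro add_mono le) auto
  also have "\<dots> = (a powr \<alpha> + b powr \<alpha>) / (a + b) powr \<alpha>"
    using assms s by (simp add: powr_divide add_divide_distrib)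
  finally show ?thesis using s by (simp add: le_divide_eq)
qed (use assms in simp)

text \<open>McShane's extension formula, one coordinate at a time. It is stable under uniform
  perturbations of \<open>v\<close>, so uniform convergence on \<open>\<Omega>\<close> carries over
  to the whole space.\<close>

definition mcshane :: "real \<Rightarrow> real \<Rightarrow> (real^'n) set \<Rightarrow> (real^'n \<Rightarrow> real^'n) \<Rightarrow> real^'n \<Rightarrow> real^'n" where
  "mcshane \<alpha> H \<Omega> v x = (\<chi> i. INF z\<in>\<Omega>. v z $ i + H * norm (x - z) powr \<alpha>)"

context
  fixes \<Omega> :: "(real^'n) set" and H \<alpha> :: real
  assumes ne: "\<Omega> \<noteq> {}" and H: "0 \<le> H" and \<alpha>: "0 < \<alpha>" "\<alpha> \<le> 1"
begin

lemma powr_dist_triangle: "norm (x - z) powr \<alpha> \<le> norm (x - y) powr \<alpha> + norm (y - z) powr \<alpha>"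
  for x y z :: "real^'n"
proof -
  have "norm (x - z) \<le> norm (x - y) + norm (y - z)" using norm_triangle_ineq[of "x - y" "y - z"] by simp
  then have "norm (x - z) powr \<alpha> \<le> (norm (x - y) + norm (y - z)) powr \<alpha>" using \<alpha> by (intro powr_mono2) auto
  also have "\<dots> \<le> norm (x - y) powr \<alpha> + norm (y - z) powr \<alpha>" using \<alpha> by (intro powr_subadditive) auto
  finally show ?thesis .
qed

lemma mcshane_lower:
  assumes v: "\<And>x y. x \<in> \<Omega> \<Longrightarrow> y \<in> \<Omega> \<Longrightarrow> norm (v x - v y) \<le> H * norm (x - y) powr \<alpha>"
    and z: "z \<in> \<Omega>" "z0 \<in> \<Omega>"
  shows "v z0 $ i - H * norm (x - z0) powr \<alpha> \<le> v z $ i + H * norm (x - z) powr \<alpha>"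
proof -
  have "v z0 $ i - v z $ i \<le> H * norm (z0 - z) powr \<alpha>"
    using component_le_norm_cart[of "v z0 - v z" i] v[OF z(2,1)] by simp
  also have "\<dots> \<le> H * (norm (z0 - x) powr \<alpha> + norm (x - z) powr \<alpha>)"
    using H powr_dist_triangle by (intro mult_left_mono) auto
  finally show ?thesis by (simp add: norm_minus_commute algebra_simps)
qed

lemma mcshane_bdd:
  assumes v: "\<And>x y. x \<in> \<Omega> \<Longrightarrow> y \<in> \<Omega> \<Longrightarrow> norm (v x - v y) \<le> H * norm (x - y) powr \<alpha>"
  shows "bdd_below ((\<lambda>z. v z $ i + H * norm (x - z) powr \<alpha>) ` \<Omega>)"
proof -
  obtain z0 where "z0 \<in> \<Omega>" using ne by blast
  then show ?thesis using mcshane_lower[OF v] by (intro bdd_belowI2) blast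
qed

lemma mcshane_eq:
  assumes v: "\<And>x y. x \<in> \<Omega> \<Longrightarrow> y \<in> \<Omega> \<Longrightarrow> norm (v x - v y) \<le> H * norm (x - y) powr \<alpha>" and x: "x \<in> \<Omega>"
  shows "mcshane \<alpha> H \<Omega> v x = v x"
proof -
  have "(INF z\<in>\<Omega>. v z $ i + H * norm (x - z) powr \<alpha>) = v x $ i" for i
  proof (rule antisym)
    show "(INF z\<in>\<Omega>. v z $ i + H * norm (x - z) powr \<alpha>) \<le> v x $ i"
      using cINF_lower[OF mcshane_bdd[OF v] x, of i x] by simp
    show "v x $ i \<le> (INF z\<in>\<Omega>. v z $ i + H * norm (x - z) powr \<alpha>)"
      using mcshane_lower[OF v _ x, of _ i x] by (intro cINF_greatest ne) auto
  qed
  then show ?thesis by (simp add: mcshane_def vec_eq_iff)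
qed

text \<open>Serves twice: \<open>x = y\<close> gives stability in the uniform norm, and
  \<open>v = v'\<close> with \<open>\<eta> = 0\<close> gives the Hoelder bound.\<close>

lemma mcshane_diff_le:
  assumes v: "\<And>x y. x \<in> \<Omega> \<Longrightarrow> y \<in> \<Omega> \<Longrightarrow> norm (v x - v y) \<le> H * norm (x - y) powr \<alpha>"
    and v': "\<And>x y. x \<in> \<Omega> \<Longrightarrow> y \<in> \<Omega> \<Longrightarrow> norm (v' x - v' y) \<le> H * norm (x - y) powr \<alpha>"
    and d: "\<And>z. z \<in> \<Omega> \<Longrightarrow> norm (v z - v' z) \<le> \<eta>"
  shows "mcshane \<alpha> H \<Omega> v x $ i - mcshane \<alpha> H \<Omega> v' y $ i \<le> \<eta> + H * norm (x - y) powr \<alpha>"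
proof -
  have "mcshane \<alpha> H \<Omega> v x $ i - (\<eta> + H * norm (x - y) powr \<alpha>) \<le> v' z $ i + H * norm (y - z) powr \<alpha>"
    if z: "z \<in> \<Omega>" for z
  proof -
    have "mcshane \<alpha> H \<Omega> v x $ i \<le> v z $ i + H * norm (x - z) powr \<alpha>"
      unfolding mcshane_def using cINF_lower[OF mcshane_bdd[OF v] z] by simp
    moreover have "v z $ i - v' z $ i \<le> \<eta>"
      using component_le_norm_cart[of "v z - v' z" i] d[OF z] by simp
    moreover have "H * norm (x - z) powr \<alpha> \<le> H * (norm (x - y) powr \<alpha> + norm (y - z) powr \<alpha>)"
      using H powr_dist_triangle by (intro mult_left_mono) auto
    ultimately show ?thesis by (simp add: algebra_simps)
  qed
  then have "mcshane \<alpha> H \<Omega> v x $ i - (\<eta> + H * norm (x - y) powr \<alpha>) \<le> mcshane \<alpha> H \<Omega> v' y $ i"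
    unfolding mcshane_def[of \<alpha> H \<Omega> v'] by (simp add: cINF_greatest[OF ne])
  then show ?thesis by simp
qed

lemma mcshane_close:
  assumes v: "\<And>x y. x \<in> \<Omega> \<Longrightarrow> y \<in> \<Omega> \<Longrightarrow> norm (v x - v y) \<le> H * norm (x - y) powr \<alpha>"
    and v': "\<And>x y. x \<in> \<Omega> \<Longrightarrow> y \<in> \<Omega> \<Longrightarrow> norm (v' x - v' y) \<le> H * norm (x - y) powr \<alpha>"
    and d: "\<And>z. z \<in> \<Omega> \<Longrightarrow> norm (v z - v' z) \<le> \<eta>"
  shows "norm (mcshane \<alpha> H \<Omega> v x - mcshane \<alpha> H \<Omega> v' x) \<le> real CARD('n) * \<eta>"
proof (rule norm_le_card_bound)
  fix i
  have d': "norm (v' z - v z) \<le> \<eta>" if "z \<in> \<Omega>" for z using d[OF that] by (simp add: norm_minus_commute)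
  show "\<bar>(mcshane \<alpha> H \<Omega> v x - mcshane \<alpha> H \<Omega> v' x) $ i\<bar> \<le> \<eta>"
    using mcshane_diff_le[OF v v' d, of x i x] mcshane_diff_le[OF v' v d', of x i x] by (simp add: abs_le_iff)
qed

lemma mcshane_holder:
  assumes v: "\<And>x y. x \<in> \<Omega> \<Longrightarrow> y \<in> \<Omega> \<Longrightarrow> norm (v x - v y) \<le> H * norm (x - y) powr \<alpha>"
  shows "holder_on_space \<alpha> (real CARD('n) * H) (mcshane \<alpha> H \<Omega> v)"
  unfolding holder_on_space_def
proof (intro conjI allI)
  show "0 \<le> real CARD('n) * H" using H by simp
  fix x y
  have "norm (mcshane \<alpha> H \<Omega> v x - mcshane \<alpha> H \<Omega> v y) \<le> real CARD('n) * (H * norm (x - y) powr \<alpha>)"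
  proof (rule norm_le_card_bound)
    fix i
    show "\<bar>(mcshane \<alpha> H \<Omega> v x - mcshane \<alpha> H \<Omega> v y) $ i\<bar> \<le> H * norm (x - y) powr \<alpha>"
      using mcshane_diff_le[OF v v, of 0 x i y] mcshane_diff_le[OF v v, of 0 y i x]
      by (simp add: abs_le_iff norm_minus_commute)
  qed
  then show "norm (mcshane \<alpha> H \<Omega> v x - mcshane \<alpha> H \<Omega> v y) \<le> real CARD('n) * H * norm (x - y) powr \<alpha>"
    by (simp add: mult.assoc)
qed

end

text \<open>\<open>ennreal C\<close> is 0 for negative \<open>C\<close>, which the absolute value
  accommodates.\<close>

lemma holder_norm_bound:
  assumes "holder_norm \<alpha> \<Omega> v \<le> ennreal C" "x \<in> \<Omega>" "y \<in> \<Omega>"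
  shows "norm (v x - v y) \<le> \<bar>C\<bar> * norm (x - y) powr \<alpha>"
proof (cases "x = y")
  case False
  have "ennreal (norm (v x - v y) / norm (x - y) powr \<alpha>)
      \<le> (SUP (x, y)\<in>{(x, y). x \<in> \<Omega> \<and> y \<in> \<Omega> \<and> x \<noteq> y}. ennreal (norm (v x - v y) / norm (x - y) powr \<alpha>))"
    using assms False by (intro SUP_upper2[of "(x, y)"]) auto
  also have "\<dots> \<le> holder_norm \<alpha> \<Omega> v" unfolding holder_norm_def by simp
  also have "\<dots> \<le> ennreal \<bar>C\<bar>" using assms(1) by (rule order.trans) (simp add: ennreal_leI)
  finally have "norm (v x - v y) / norm (x - y) powr \<alpha> \<le> \<bar>C\<bar>" by (simp add: ennreal_le_iff)
  then show ?thesis using False by (simp add: divide_le_eq)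
qed simp

subsection \<open>Consequences of the box dimension\<close>

lemma box_dim_cover:
  fixes K :: "'a::euclidean_space set"
  assumes K: "bounded K" and dim: "box_dim K = ereal d" and d': "d < d'"
  shows "\<forall>\<^sub>F \<epsilon> in at_right 0. \<exists>C. finite C \<and> K \<subseteq> (\<Union>c\<in>C. ball c \<epsilon>) \<and> real (card C) \<le> \<epsilon> powr (- d')"
proof -
  have "Limsup (at_right 0) (\<lambda>\<epsilon>. ereal (ln (real (covering_number \<epsilon> K)) / ln (1 / \<epsilon>))) < ereal d'"
    using dim d' by (simp add: box_dim_def)
  then have "\<forall>\<^sub>F \<epsilon> in at_right 0. ereal (ln (real (covering_number \<epsilon> K)) / ln (1 / \<epsilon>)) < ereal d'"
    by (rule Limsup_lessD)
  moreover have "\<forall>\<^sub>F \<epsilon>::real in at_right 0. 0 < \<epsilon> \<and> \<epsilon> < 1"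
    by (auto simp: eventually_at_right_field intro: exI[of _ 1])
  ultimately show ?thesis
  proof eventually_elim
    case (elim \<epsilon>)
    \<comment> \<open>Total boundedness supplies some finite cover, so that the minimum in
      \<open>covering_number\<close> is attained.\<close>
    have "compact (closure K)" using K by (simp add: compact_closure)
    then obtain C0 where "finite C0" "closure K \<subseteq> (\<Union>x\<in>C0. ball x \<epsilon>)"
      using elim(2) unfolding compact_eq_totally_bounded by blast
    then have "\<exists>m C. finite C \<and> card C = m \<and> K \<subseteq> (\<Union>c\<in>C. ball c \<epsilon>)" using closure_subset[of K] by blast
    from LeastI_ex[OF this] obtain C where C: "finite C" "card C = covering_number \<epsilon> K" "K \<subseteq> (\<Union>c\<in>C. ball c \<epsilon>)"
      unfolding covering_number_def by blast
    have "real (covering_number \<epsilon> K) \<le> \<epsilon> powr (- d')"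
    proof (cases "covering_number \<epsilon> K = 0")
      case False
      have l: "0 < ln (1 / \<epsilon>)" using elim(2) by simp
      have "ln (real (covering_number \<epsilon> K)) < d' * ln (1 / \<epsilon>)"
        using elim(1) l by (simp add: divide_less_eq)
      also have "\<dots> = ln (\<epsilon> powr (- d'))" using elim(2) by (simp add: ln_powr ln_div)
      finally show ?thesis using False elim(2) by (subst (asm) ln_less_cancel_iff) auto
    qed simp
    then show ?case using C by auto
  qed
qed

lemma measure_UN_cball_le:
  fixes c :: "'b \<Rightarrow> real^'n"
  assumes C: "finite C" and S: "S \<subseteq> (\<Union>i\<in>C. cball (c i) r)" "S \<in> sets borel" and r: "0 \<le> r"
  shows "emeasure lborel S \<le> ennreal (real (card C) * (2 * r) ^ CARD('n))"
proof -
  have "emeasure lborel S \<le> emeasure lborel (\<Union>i\<in>C. cball (c i) r)"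
    using S C by (intro emeasure_mono) auto
  also have "\<dots> \<le> (\<Sum>i\<in>C. emeasure lborel (cball (c i) r))"
    using C by (intro emeasure_subadditive_finite) auto
  also have "\<dots> \<le> (\<Sum>i\<in>C. ennreal ((2 * r) ^ CARD('n)))"
    using r by (intro sum_mono emeasure_cball_le)
  also have "\<dots> = ennreal (real (card C) * (2 * r) ^ CARD('n))"
    using r by (simp add: ennreal_mult ennreal_of_nat_eq_real_of_nat)
  finally show ?thesis .
qed

context degree_scales
begin

lemma eventually_eps:
  assumes "\<forall>\<^sub>F \<epsilon> in at_right 0. P \<epsilon>" shows "\<forall>\<^sub>F j in sequentially. P (eps j)"
proof -
  have "filterlim eps (at_right 0) sequentially"
  proof (rule tendsto_imp_filterlim_at_right[OF eps_tendsto_0])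
    show "\<forall>\<^sub>F j in sequentially. 0 < eps j" by (simp add: eps_pos)
  qed
  then show ?thesis using assms by (simp add: filterlim_iff)
qed

text \<open>The layer is within \<open>2 * CARD('n) * eps j\<close> of the frontier, so enlarging
  covering balls of radius \<open>eps j\<close> by that much covers the layer. The outer factor 2
  comes from enclosing balls in cubes.\<close>

lemma measure_layer_le:
  assumes dim: "box_dim (frontier \<Omega>) = ereal d" and d': "d < d'"
  obtains j0 where "\<And>j. j0 \<le> j \<Longrightarrow>
    measure lborel (layer j) \<le> (2 * (2 * real CARD('n) + 1)) ^ CARD('n) * eps j powr (real CARD('n) - d')"
proof -
  have "bounded (frontier \<Omega>)" using bounded_\<Omega> compact_frontier_bounded compact_imp_bounded by blast
  from eventually_eps[OF box_dim_cover[OF this dim d']] obtain j0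
    where j0: "\<And>j. j0 \<le> j \<Longrightarrow> \<exists>C. finite C \<and> frontier \<Omega> \<subseteq> (\<Union>c\<in>C. ball c (eps j)) \<and> real (card C) \<le> eps j powr (- d')"
    unfolding eventually_sequentially by blast
  have "measure lborel (layer j) \<le> (2 * (2 * real CARD('n) + 1)) ^ CARD('n) * eps j powr (real CARD('n) - d')"
    if j: "j0 \<le> j" for j
  proof -
    let ?n = "real CARD('n)" and ?r = "(2 * real CARD('n) + 1) * eps j"
    obtain C where C: "finite C" "frontier \<Omega> \<subseteq> (\<Union>c\<in>C. ball c (eps j))" "real (card C) \<le> eps j powr (- d')"
      using j0[OF j] by blast
    have "layer j \<subseteq> (\<Union>c\<in>C. cball c ?r)"
    proof
      fix x assume "x \<in> layer j"
      then obtain z where z: "z \<in> frontier \<Omega>" "dist x z \<le> 2 * ?n * eps j" by (rule layer_near_frontier)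
      then obtain c where c: "c \<in> C" "dist c z < eps j" using C(2) by auto
      have "dist c x \<le> ?r" using z(2) c(2) dist_triangle2[of c x z] by (simp add: algebra_simps)
      then show "x \<in> (\<Union>c\<in>C. cball c ?r)" using c(1) by auto
    qed
    then have "emeasure lborel (layer j) \<le> ennreal (real (card C) * (2 * ?r) ^ CARD('n))"
      using C(1) open_layer eps_pos[of j] by (intro measure_UN_cball_le[where c="\<lambda>c. c"]) auto
    also have "\<dots> \<le> ennreal (eps j powr (- d') * (2 * ?r) ^ CARD('n))"
      using C(3) eps_pos[of j] by (intro ennreal_leI mult_right_mono) auto
    also have "eps j powr (- d') * (2 * ?r) ^ CARD('n)
        = (2 * (2 * ?n + 1)) ^ CARD('n) * eps j powr (?n - d')"
    proof -
      have "(2 * ?r) ^ CARD('n) = (2 * (2 * ?n + 1)) ^ CARD('n) * eps j powr ?n"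
      proof -
        have "2 * ?r = (2 * (2 * ?n + 1)) * eps j" by (simp only: mult.assoc)
        then show ?thesis by (simp only: power_mult_distrib powr_realpow[OF eps_pos])
      qed
      moreover have "eps j powr (?n - d') = eps j powr ?n * eps j powr (- d')" by (simp flip: powr_add)
      ultimately show ?thesis by simp
    qed
    finally show ?thesis
      by (simp add: measure_def enn2real_leI)
  qed
  then show ?thesis using that by blast
qed

text \<open>A ball of radius \<epsilon> has its image in a ball of radius
  \<open>H * \<epsilon> powr \<alpha>\<close>; with \<open>n\<close> the dimension the volumes add
  up to order \<open>\<epsilon> powr (\<alpha> * n - d')\<close>, which tends to 0.\<close>

lemma negligible_image_frontier:
  assumes V: "holder_on_space \<alpha> H V" and dim: "box_dim (frontier \<Omega>) = ereal d"
    and d': "d < d'" "d' < \<alpha> * real CARD('n)"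
  shows "negligible (V ` frontier \<Omega>)"
proof -
  let ?S = "V ` frontier \<Omega>" and ?n = "CARD('n)"
  have "compact (frontier \<Omega>)" using bounded_\<Omega> by (simp add: compact_frontier_bounded)
  then have cS: "compact ?S" by (intro compact_continuous_image holder_continuous_on[OF V])
  have "bounded (frontier \<Omega>)" using bounded_\<Omega> compact_frontier_bounded compact_imp_bounded by blast
  from eventually_eps[OF box_dim_cover[OF this dim d'(1)]]
  have ev: "\<forall>\<^sub>F j in sequentially. emeasure lborel ?S \<le> ennreal ((2 * H) ^ ?n * eps j powr (\<alpha> * real ?n - d'))"
  proof eventually_elim
    case (elim j)
    then obtain C where C: "finite C" "frontier \<Omega> \<subseteq> (\<Union>c\<in>C. ball c (eps j))" "real (card C) \<le> eps j powr (- d')"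
      by blast
    let ?r = "H * eps j powr \<alpha>"
    have "?S \<subseteq> (\<Union>c\<in>C. cball (V c) ?r)"
    proof
      fix y assume "y \<in> ?S"
      then obtain z c where zc: "y = V z" "c \<in> C" "dist c z < eps j" using C(2) by force
      have "norm (V c - V z) \<le> H * norm (c - z) powr \<alpha>" using V by (simp add: holder_on_space_def)
      also have "\<dots> \<le> ?r" using zc(3) H \<alpha> by (intro mult_left_mono powr_mono2) (auto simp: dist_norm)
      finally show "y \<in> (\<Union>c\<in>C. cball (V c) ?r)" using zc by (auto simp: dist_norm)
    qed
    then have "emeasure lborel ?S \<le> ennreal (real (card C) * (2 * ?r) ^ ?n)"
      using C(1) cS H by (intro measure_UN_cball_le[where c=V]) (auto intro: borel_compact)
    also have "\<dots> \<le> ennreal (eps j powr (- d') * (2 * ?r) ^ ?n)"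
      using C(3) H by (intro ennreal_leI mult_right_mono) auto
    also have "eps j powr (- d') * (2 * ?r) ^ ?n = (2 * H) ^ ?n * eps j powr (\<alpha> * real ?n - d')"
    proof -
      have "(eps j powr \<alpha>) ^ ?n = eps j powr (\<alpha> * real ?n)"
        using eps_pos[of j] by (simp add: powr_powr flip: powr_realpow)
      moreover have "eps j powr (\<alpha> * real ?n - d') = eps j powr (\<alpha> * real ?n) * eps j powr (- d')"
        by (simp flip: powr_add)
      ultimately show ?thesis by (simp add: power_mult_distrib)
    qed
    finally show ?case .
  qed
  have "(\<lambda>j. eps j powr (\<alpha> * real ?n - d')) \<longlonglongrightarrow> 0 powr (\<alpha> * real ?n - d')"
    using d'(2) eps_pos by (intro tendsto_powr2 eps_tendsto_0 tendsto_const) (auto simp: less_imp_le)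
  then have "(\<lambda>j. (2 * H) ^ ?n * eps j powr (\<alpha> * real ?n - d')) \<longlonglongrightarrow> (2 * H) ^ ?n * 0"
    by (intro tendsto_mult tendsto_const) simp
  then have "(\<lambda>j. ennreal ((2 * H) ^ ?n * eps j powr (\<alpha> * real ?n - d'))) \<longlonglongrightarrow> ennreal 0"
    by (intro tendsto_ennrealI) simp
  then have "emeasure lborel ?S \<le> ennreal 0" using ev by (rule tendsto_lowerbound) simp
  then have "?S \<in> null_sets lborel" using cS by (auto simp: null_sets_def borel_compact)
  then show ?thesis by (simp add: negligible_iff_null_sets null_sets_completionI)
qed

end

subsection \<open>Convergence in Sobolev norm\<close>

lemma AE_pair_Borel:
  assumes "AE y in (lborel :: (real^'n) measure). P y"
  shows "AE z in (lborel :: (real^'n) measure) \<Otimes>\<^sub>M (lborel :: (real^'n) measure). P (fst z) \<and> P (snd z)"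
proof -
  obtain N where N: "{y. \<not> P y} \<subseteq> N" "N \<in> sets lborel" "emeasure lborel N = 0"
    using AE_E[OF assms] by auto
  then have "AE y in lborel. y \<notin> N" by (intro AE_not_in) (simp add: null_sets_def)
  then have ae: "AE x in lborel. AE y in lborel. fst (x, y) \<notin> N \<and> snd (x, y) \<notin> N"
    by (auto intro: eventually_mono)
  have [measurable]: "N \<in> sets borel" using N(2) by simp
  have "AE z in lborel \<Otimes>\<^sub>M lborel. fst z \<notin> N \<and> snd z \<notin> N"
    by (rule lborel_pair.AE_pair_measure[OF _ ae]) measurable
  then show ?thesis by eventually_elim (use N(1) in auto)
qed

lemma lp_energy_cong:
  fixes f g :: "real^'n \<Rightarrow> real"
  assumes "AE y in lborel. f y = g y"
  shows "(\<integral>\<^sup>+x. ennreal (\<bar>f x\<bar> powr p) \<partial>lebesgue) = lp_energy p g"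
  unfolding lp_energy_def energy_def nn_integral_completion
  using assms by (intro nn_integral_cong_AE) (auto elim: eventually_mono)

text \<open>The function is exchanged inside the iterated integral, one variable after the other;
  Tonelli's theorem is then applied to the Borel representative only.\<close>

lemma gag_energy_cong:
  fixes f g :: "real^'n \<Rightarrow> real"
  assumes fg: "AE y in lborel. f y = g y" and g [measurable]: "g \<in> borel_measurable borel"
  shows "(\<integral>\<^sup>+x. \<integral>\<^sup>+y. ennreal (\<bar>f x - f y\<bar> powr p / norm (x - y) powr s) \<partial>lebesgue \<partial>lebesgue) = gag_energy s p g"
proof -
  have "(\<integral>\<^sup>+x. \<integral>\<^sup>+y. ennreal (\<bar>f x - f y\<bar> powr p / norm (x - y) powr s) \<partial>lebesgue \<partial>lebesgue)
      = (\<integral>\<^sup>+x. \<integral>\<^sup>+y. ennreal (\<bar>g x - g y\<bar> powr p) * gag_kernel s (x, y) \<partial>lborel \<partial>lborel)"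
    unfolding nn_integral_completion
  proof (rule nn_integral_cong_AE)
    show "AE x in lborel. (\<integral>\<^sup>+y. ennreal (\<bar>f x - f y\<bar> powr p / norm (x - y) powr s) \<partial>lborel)
        = (\<integral>\<^sup>+y. ennreal (\<bar>g x - g y\<bar> powr p) * gag_kernel s (x, y) \<partial>lborel)"
      using fg
    proof eventually_elim
      case (elim x)
      show ?case
      proof (rule nn_integral_cong_AE)
        show "AE y in lborel. ennreal (\<bar>f x - f y\<bar> powr p / norm (x - y) powr s)
            = ennreal (\<bar>g x - g y\<bar> powr p) * gag_kernel s (x, y)"
          using fg
        proof eventually_elim
          case (elim y)
          then show ?case using \<open>f x = g x\<close> by (simp add: gag_kernel_def flip: ennreal_mult')
        qed
      qed
    qed
  qed
  also have "\<dots> = gag_energy s p g"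
    unfolding gag_energy_def energy_def
    by (subst lborel.nn_integral_fst[symmetric]) auto
  finally show ?thesis .
qed

lemma borel_measurable_lebesgue_AE:
  fixes f g :: "real^'n \<Rightarrow> real"
  assumes fg: "AE y in lborel. f y = g y" and g [measurable]: "g \<in> borel_measurable borel"
  shows "f \<in> borel_measurable lebesgue"
proof -
  obtain N where N: "{y. f y \<noteq> g y} \<subseteq> N" "N \<in> sets lborel" "emeasure lborel N = 0"
    using AE_E[OF fg] by auto
  then have N0: "N \<in> null_sets lebesgue" by (intro null_sets_completionI) (simp add: null_sets_def)
  have gl: "g \<in> borel_measurable lebesgue" using g by (intro measurable_completion) simp
  show ?thesis
  proof (rule measurableI)
    fix A :: "real set" assume A: "A \<in> sets borel"
    have eq: "f -` A \<inter> space lebesgue = ((g -` A \<inter> space lebesgue) - N) \<union> (f -` A \<inter> N)" using N(1) by auto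
    have "f -` A \<inter> N \<in> sets lebesgue"
      using N0 by (meson Int_lower2 null_setsD2 null_sets_completion_subset)
    moreover have "g -` A \<inter> space lebesgue \<in> sets lebesgue" using gl A by (rule measurable_sets)
    ultimately show "f -` A \<inter> space lebesgue \<in> sets lebesgue"
      unfolding eq using null_setsD2[OF N0] by (intro sets.Un sets.Diff)
  qed simp
qed

lemma ennreal_rpow_tendsto_0:
  assumes E: "(E \<longlongrightarrow> 0) F" and r: "0 < r"
  shows "((\<lambda>i. ennreal_rpow (E i) r) \<longlongrightarrow> 0) F"
proof (rule tendsto_0_ennrealI)
  fix e :: real assume e: "0 < e"
  have "\<forall>\<^sub>F i in F. E i < ennreal (e powr (1 / r))" using E e by (intro order_tendstoD(2)) auto
  then show "\<forall>\<^sub>F i in F. ennreal_rpow (E i) r \<le> ennreal e"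
  proof eventually_elim
    case (elim i)
    then obtain c where c: "E i = ennreal c" "0 \<le> c" by (cases "E i") auto
    then have "c \<le> e powr (1 / r)" using elim by (simp add: ennreal_less_iff)
    then have "c powr r \<le> (e powr (1 / r)) powr r" using r c by (intro powr_mono2) auto
    then show ?case using c r e by (simp add: ennreal_rpow_def powr_powr ennreal_leI)
  qed
qed

lemma ennreal_rpow_finite: "E < \<infinity> \<Longrightarrow> ennreal_rpow E r < \<infinity>"
  by (auto simp: ennreal_rpow_def)

context degree_scales
begin

lemma degree_energy_lp:
  assumes dim: "box_dim (frontier \<Omega>) = ereal d" and d': "d < d'" "0 < \<alpha> * (real CARD('n) / p) - d'" and p: "1 \<le> p"
  obtains j0 where "degree_energy \<Omega> R \<alpha> H (lborel :: (real^'n) measure) (\<lambda>_. 1) (\<lambda>y. y) (\<lambda>y. y) 0 p 0 d'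
     (2 ^ CARD('n)) ((2 * (2 * real CARD('n) + 1)) ^ CARD('n)) j0"
proof -
  obtain j0 where j0: "\<And>j. j0 \<le> j \<Longrightarrow>
    measure lborel (layer j) \<le> (2 * (2 * real CARD('n) + 1)) ^ CARD('n) * eps j powr (real CARD('n) - d')"
    using measure_layer_le[OF dim d'(1)] by blast
  have "degree_energy \<Omega> R \<alpha> H (lborel :: (real^'n) measure) (\<lambda>_. 1) (\<lambda>y. y) (\<lambda>y. y) 0 p 0 d'
     (2 ^ CARD('n)) ((2 * (2 * real CARD('n) + 1)) ^ CARD('n)) j0"
  proof (intro degree_energy.intro degree_energy_axioms.intro)
    fix f :: "real^'n \<Rightarrow> real" and r M L :: real
    assume f: "tame r M L f" "0 \<le> r" "0 < M" "0 < L"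
    have eq: "(2 * r) ^ CARD('n) * M powr p
        = 2 ^ CARD('n) * (r ^ CARD('n) * (M powr p * (M / L) powr - (0 * p)))"
      using f by (simp add: power_mult_distrib)
    have "energy lborel (\<lambda>_. 1) p (\<lambda>z. f z - 0 * f z) \<le> ennreal ((2 * r) ^ CARD('n) * M powr p)"
      using tame_lp_energy[OF f(1,2) p] by (simp add: lp_energy_def)
    then show "energy lborel (\<lambda>_. 1) p (\<lambda>z. f z - 0 * f z)
        \<le> ennreal (2 ^ CARD('n) * (r ^ CARD('n) * (M powr p * (M / L) powr - (0 * p))))"
      unfolding eq .
  next
    show "degree_scales \<Omega> R \<alpha> H" by unfold_locales
    show "sigma_finite_measure (lborel :: (real^'n) measure)" by unfold_locales
  qed (use p d' j0 in \<open>auto simp: add_pos_nonneg\<close>)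
  then show ?thesis using that by blast
qed

lemma degree_energy_gag:
  assumes dim: "box_dim (frontier \<Omega>) = ereal d" and d': "d < d'" "0 < \<alpha> * (real CARD('n) / p - \<beta>) - d'" and p: "1 \<le> p"
    and \<beta>: "0 < \<beta>" "\<beta> < 1"
  obtains j0 Ce where "degree_energy \<Omega> R \<alpha> H ((lborel :: (real^'n) measure) \<Otimes>\<^sub>M (lborel :: (real^'n) measure))
     (gag_kernel (real CARD('n) + \<beta> * p)) fst snd 1 p \<beta> d'
     Ce ((2 * (2 * real CARD('n) + 1)) ^ CARD('n)) j0"
proof -
  obtain j0 where j0: "\<And>j. j0 \<le> j \<Longrightarrow>
    measure lborel (layer j) \<le> (2 * (2 * real CARD('n) + 1)) ^ CARD('n) * eps j powr (real CARD('n) - d')"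
    using measure_layer_le[OF dim d'(1)] by blast
  obtain I where I: "(\<integral>\<^sup>+h. ennreal (kern p (real CARD('n) + \<beta> * p) 1 1 (h :: real^'n)) \<partial>lborel) = ennreal I" "0 \<le> I"
    using kern_integral_finite[OF \<beta> p, where 'n='n] 
    by (cases "\<integral>\<^sup>+h. ennreal (kern p (real CARD('n) + \<beta> * p) 1 1 (h :: real^'n)) \<partial>lborel") auto
  have "degree_energy \<Omega> R \<alpha> H ((lborel :: (real^'n) measure) \<Otimes>\<^sub>M (lborel :: (real^'n) measure))
     (gag_kernel (real CARD('n) + \<beta> * p)) fst snd 1 p \<beta> d'
     (2 * 2 ^ CARD('n) * I) ((2 * (2 * real CARD('n) + 1)) ^ CARD('n)) j0"
  proof (intro degree_energy.intro degree_energy_axioms.intro)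
    fix f :: "real^'n \<Rightarrow> real" and r M L :: real
    assume f: "tame r M L f" "0 \<le> r" "0 < M" "0 < L"
    have "gag_energy (real CARD('n) + \<beta> * p) p f
        \<le> ennreal (2 * (2 * r) ^ CARD('n) * (M powr p * (M / L) powr (- (\<beta> * p)))) * ennreal I"
      using tame_gag_energy[OF f(1-4) \<beta> p] unfolding I(1) .
    also have "\<dots> = ennreal (2 * (2 * r) ^ CARD('n) * (M powr p * (M / L) powr (- (\<beta> * p))) * I)"
      using f I(2) by (simp add: ennreal_mult)
    also have "2 * (2 * r) ^ CARD('n) * (M powr p * (M / L) powr (- (\<beta> * p))) * I
        = 2 * 2 ^ CARD('n) * I * (r ^ CARD('n) * (M powr p * (M / L) powr - (\<beta> * p)))"
      by (simp add: power_mult_distrib)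
    finally show "energy (lborel \<Otimes>\<^sub>M lborel) (gag_kernel (real CARD('n) + \<beta> * p)) p (\<lambda>z. f (fst z) - 1 * f (snd z))
        \<le> ennreal (2 * 2 ^ CARD('n) * I * (r ^ CARD('n) * (M powr p * (M / L) powr - (\<beta> * p))))"
      by (simp add: gag_energy_def)
  next
    show "degree_scales \<Omega> R \<alpha> H" by unfold_locales
    show "sigma_finite_measure ((lborel :: (real^'n) measure) \<Otimes>\<^sub>M (lborel :: (real^'n) measure))" by unfold_locales
    show "AE z in lborel \<Otimes>\<^sub>M lborel. P (fst z) \<and> P (snd z)" if "AE y in lborel. P y" for P :: "real^'n \<Rightarrow> bool"
      using that by (rule AE_pair_Borel)
  qed (use p d' j0 \<beta> I in \<open>auto simp: add_pos_nonneg\<close>)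
  then show ?thesis using that by blast
qed

end

text \<open>On an empty domain every smooth map is admissible and counts nothing; the zero map
  serves as a witness.\<close>

lemma brouwer_degree_empty:
  fixes v :: "real^'n \<Rightarrow> real^'n"
  shows "brouwer_degree v {} y = 0"
proof -
  have "smooth_map (\<lambda>x::real^'n. 0::real^'n)" by (intro smooth_map_polynomial) simp
  then have "(THE m. \<exists>w. smooth_map w \<and> regular_value_on w {} y \<and>
      (\<forall>x\<in>closure {}. \<forall>z\<in>frontier {}. norm (w x - v x) < dist y (v z)) \<and> of_int m = signed_count w {} y) = (0::int)"
    by (intro the_equality) (auto simp: regular_value_on_def signed_count_def)
  then show ?thesis by (simp add: brouwer_degree_def)
qed

theorem corollary1p2:
  fixes \<Omega> :: "(real^'n) set"
    and d \<alpha> \<beta> p :: real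
    and v :: "real^'n \<Rightarrow> real^'n"
    and vk :: "nat \<Rightarrow> real^'n \<Rightarrow> real^'n"
  assumes "open \<Omega>" and "bounded \<Omega>"
    and "box_dim (frontier \<Omega>) = ereal d"
    and "real CARD('n) - 1 \<le> d" and "d < real CARD('n)"
    and "d / real CARD('n) < \<alpha>" and "\<alpha> \<le> 1"
    and "\<And>k. vk k \<in> holder_space \<alpha> \<Omega>"
    and "\<exists>C::real. \<forall>k. holder_norm \<alpha> \<Omega> (vk k) \<le> ennreal C"
    and "uniform_limit \<Omega> vk v sequentially"
    and "p \<ge> 1" and "0 \<le> \<beta>" and "\<beta> < real CARD('n) / p - d / \<alpha>"
  shows "sobolev_tendsto \<beta> p
           (\<lambda>k y. of_int (brouwer_degree (closure_extension \<Omega> (vk k)) \<Omega> y))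
           (\<lambda>y. of_int (brouwer_degree (closure_extension \<Omega> v) \<Omega> y))"
proof (cases "\<Omega> = {}")
  case True
  \<comment> \<open>The infimum in \<open>mcshane\<close> needs a nonempty domain, so the empty one
    is treated apart.\<close>
  have "Lp_norm p (\<lambda>x::real^'n. 0) = 0" "gagliardo_seminorm \<beta> p (\<lambda>x::real^'n. 0) = 0"
    by (auto simp: Lp_norm_def gagliardo_seminorm_def ennreal_rpow_def)
  then have "sobolev_norm \<beta> p (\<lambda>x::real^'n. 0) = 0" by (simp add: sobolev_norm_def)
  then show ?thesis
    using True by (simp add: sobolev_tendsto_def sobolev_space_def brouwer_degree_empty)
next
  case False
  let ?n = "real CARD('n)"
  have "1 \<le> CARD('n)" by (simp add: Suc_le_eq)
  then have n1: "1 \<le> ?n" by linarith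
  then have d0: "0 \<le> d" using assms(4) by linarith
  have "0 \<le> d / ?n" using d0 n1 by simp
  then have \<alpha>: "0 < \<alpha>" "\<alpha> \<le> 1" using assms(6,7) by linarith+
  note p = \<open>p \<ge> 1\<close>
  \<comment> \<open>The lower bound on \<open>d\<close> enters here:
    \<open>\<beta> < ?n / p - d / \<alpha> \<le> ?n - d \<le> 1\<close>.\<close>
  have \<beta>1: "\<beta> < 1"
  proof -
    have "?n / p \<le> ?n" using p n1 by (simp add: divide_le_eq mult_le_cancel_left1)
    moreover have "d \<le> d / \<alpha>" using d0 \<alpha> by (simp add: le_divide_eq mult_left_le)
    ultimately show ?thesis using assms(4,13) by linarith
  qed
  \<comment> \<open>Midway between the box dimension and the exponent gained from the bumps: larger
    than \<open>d\<close> for the covering bound, small enough to keep the decay rate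
    positive.\<close>
  define d' where "d' = (d + \<alpha> * (?n / p - \<beta>)) / 2"
  have "d / \<alpha> < ?n / p - \<beta>" using assms(13) by linarith
  then have "d < \<alpha> * (?n / p - \<beta>)" using \<alpha> by (simp add: divide_less_eq mult.commute)
  then have d': "d < d'" "0 < \<alpha> * (?n / p - \<beta>) - d'" by (auto simp: d'_def)
  have "\<alpha> * (?n / p - \<beta>) \<le> \<alpha> * (?n / p)" using assms(12) \<alpha> by (intro mult_left_mono) auto
  then have d'lp: "0 < \<alpha> * (?n / p) - d'" using d'(2) by linarith
  have "\<alpha> * (?n / p) \<le> \<alpha> * ?n" using p n1 \<alpha> by (intro mult_left_mono) (auto simp: divide_le_eq mult_le_cancel_left1)
  then have d'n: "d' < \<alpha> * ?n" using d'lp by linarith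
  obtain C where C: "\<And>k. holder_norm \<alpha> \<Omega> (vk k) \<le> ennreal C" using assms(9) by blast
  define H0 where "H0 = \<bar>C\<bar>"
  have H0: "0 \<le> H0" by (simp add: H0_def)
  have hk: "norm (vk k x - vk k y) \<le> H0 * norm (x - y) powr \<alpha>" if "x \<in> \<Omega>" "y \<in> \<Omega>" for k x y
    unfolding H0_def by (rule holder_norm_bound[OF C that])
  \<comment> \<open>The Hoelder bound survives the pointwise limit, so \<open>v\<close> is extended
    with the same constant as the sequence.\<close>
  have h: "norm (v x - v y) \<le> H0 * norm (x - y) powr \<alpha>" if "x \<in> \<Omega>" "y \<in> \<Omega>" for x y
  proof (rule Lim_bounded)
    show "(\<lambda>k. norm (vk k x - vk k y)) \<longlonglongrightarrow> norm (v x - v y)"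
      using tendsto_uniform_limitI[OF assms(10)] that by (intro tendsto_intros) auto
  qed (use hk[OF that] in auto)
  define V where "V = mcshane \<alpha> H0 \<Omega> v"
  define Vk where "Vk k = mcshane \<alpha> H0 \<Omega> (vk k)" for k
  define H where "H = ?n * H0"
  have V: "holder_on_space \<alpha> H V" "\<And>x. x \<in> \<Omega> \<Longrightarrow> V x = v x"
    unfolding V_def H_def using mcshane_holder[OF False H0 \<alpha> h] mcshane_eq[OF False H0 \<alpha> h] by auto
  have Vk: "holder_on_space \<alpha> H (Vk k)" "\<And>x. x \<in> \<Omega> \<Longrightarrow> Vk k x = vk k x" for k
    unfolding Vk_def H_def using mcshane_holder[OF False H0 \<alpha> hk] mcshane_eq[OF False H0 \<alpha> hk] by auto
  have unif: "\<forall>\<^sub>F k in sequentially. \<forall>z. norm (Vk k z - V z) \<le> \<eta>" if "0 < \<eta>" for \<eta>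
  proof -
    have "\<forall>\<^sub>F k in sequentially. \<forall>z\<in>\<Omega>. dist (vk k z) (v z) < \<eta> / ?n"
      using assms(10) that n1 by (intro uniform_limitD) auto
    then show ?thesis
    proof eventually_elim
      case (elim k)
      have "norm (Vk k z - V z) \<le> ?n * (\<eta> / ?n)" for z
        unfolding V_def Vk_def
        by (rule mcshane_close[OF False H0 \<alpha> hk h]) (use elim in \<open>auto simp: dist_norm less_imp_le\<close>)
      then show ?case using n1 by simp
    qed
  qed
  obtain R where R: "\<And>x. x \<in> \<Omega> \<Longrightarrow> norm x \<le> R" using assms(2) by (auto simp: bounded_iff)
  interpret degree_scales \<Omega> R \<alpha> H
    using assms(1,2) R \<alpha> H0 n1 by unfold_locales (auto simp: H_def)
  \<comment> \<open>Borel representatives of the degrees: measurability is clear for limits of the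
    mollified degrees, and the degrees agree with them almost everywhere.\<close>
  define f where "f y = lim (\<lambda>j. F V j y)" for y
  define fk where "fk k y = lim (\<lambda>j. F (Vk k) j y)" for k y
  let ?g = "\<lambda>y. real_of_int (brouwer_degree (closure_extension \<Omega> v) \<Omega> y)"
  let ?gk = "\<lambda>k y. real_of_int (brouwer_degree (closure_extension \<Omega> (vk k)) \<Omega> y)"
  obtain j0 where E0: "degree_energy \<Omega> R \<alpha> H (lborel :: (real^'n) measure) (\<lambda>_. 1) (\<lambda>y. y) (\<lambda>y. y) 0 p 0 d'
     (2 ^ CARD('n)) ((2 * (2 * ?n + 1)) ^ CARD('n)) j0"
    using degree_energy_lp[OF assms(3) d'(1) d'lp p] by blast
  interpret lp: degree_energy \<Omega> R \<alpha> H "lborel :: (real^'n) measure" "\<lambda>_. 1" "\<lambda>y. y" "\<lambda>y. y" 0 p 0 d'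
     "2 ^ CARD('n)" "(2 * (2 * ?n + 1)) ^ CARD('n)" j0
    by (rule E0)
  note Fm = lp.F_measurable
  have fm: "f \<in> borel_measurable borel" "\<And>k. fk k \<in> borel_measurable borel"
    unfolding f_def[abs_def] fk_def[abs_def] using Fm by (auto intro!: borel_measurable_lim_metric)
  have ae: "AE y in lborel. (\<lambda>j. F W j y) \<longlonglongrightarrow> lim (\<lambda>j. F W j y) \<and>
      real_of_int (brouwer_degree (closure_extension \<Omega> w) \<Omega> y) = lim (\<lambda>j. F W j y)"
    if W: "holder_on_space \<alpha> H W" "\<And>x. x \<in> \<Omega> \<Longrightarrow> W x = w x" for W w
  proof -
    have "AE y in lborel. \<forall>\<^sub>F j in sequentially.
        F W j y = of_int (brouwer_degree (closure_extension \<Omega> w) \<Omega> y)"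
      by (rule brouwer_degree_eq[OF W(1) _ negligible_image_frontier[OF W(1) assms(3) d'(1) d'n]])
         (rule W(2))
    then show ?thesis
    proof eventually_elim
      case (elim y)
      then have "(\<lambda>j. F W j y) \<longlonglongrightarrow> real_of_int (brouwer_degree (closure_extension \<Omega> w) \<Omega> y)"
        by (rule tendsto_eventually)
      then show ?case by (simp add: limI)
    qed
  qed
  have lim: "AE y in lborel. (\<lambda>j. F V j y) \<longlonglongrightarrow> f y" "AE y in lborel. ?g y = f y"
    using ae[OF V] unfolding f_def by (auto elim: eventually_mono)
  have limk: "AE y in lborel. (\<lambda>j. F (Vk k) j y) \<longlonglongrightarrow> fk k y" "AE y in lborel. ?gk k y = fk k y" for k
    using ae[OF Vk] unfolding fk_def by (auto elim: eventually_mono)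
  have diff: "AE y in lborel. ?gk k y - ?g y = fk k y - f y" for k
    using limk(2)[of k] lim(2) by eventually_elim simp
  have dm: "(\<lambda>y. fk k y - f y) \<in> borel_measurable borel" for k using fm by measurable
  have lpE: "(\<lambda>k. lp_energy p (\<lambda>y. fk k y - f y)) \<longlonglongrightarrow> 0" "lp_energy p f < \<infinity>" "lp_energy p (fk k) < \<infinity>" for k
  proof -
    have "(\<lambda>k. lp.En (\<lambda>y. fk k y - f y)) \<longlonglongrightarrow> 0"
      by (rule lp.En_converges[OF Vk(1) V(1) _ limk(1) lim(1) fm(2,1)]) (rule unif)
    then show "(\<lambda>k. lp_energy p (\<lambda>y. fk k y - f y)) \<longlonglongrightarrow> 0"
      by (simp add: lp.En_def lp_energy_def)
    show "lp_energy p f < \<infinity>" "lp_energy p (fk k) < \<infinity>"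
      using lp.En_finite[OF V(1) lim(1) fm(1)] lp.En_finite[OF Vk(1) limk(1) fm(2), of k]
      by (simp_all add: lp.En_def lp_energy_def)
  qed
  have Lp: "Lp_norm p g = ennreal_rpow (lp_energy p f) (1 / p)" if "AE y in lborel. g y = f y"
    for g f :: "real^'n \<Rightarrow> real"
    unfolding Lp_norm_def lp_energy_cong[OF that] ..
  have Gag: "gagliardo_seminorm \<beta> p g = ennreal_rpow (gag_energy (?n + \<beta> * p) p f) (1 / p)"
    if "AE y in lborel. g y = f y" "f \<in> borel_measurable borel" for g f :: "real^'n \<Rightarrow> real"
    unfolding gagliardo_seminorm_def gag_energy_cong[OF that] ..
  have gagE: "(\<lambda>k. gag_energy (?n + \<beta> * p) p (\<lambda>y. fk k y - f y)) \<longlonglongrightarrow> 0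
      \<and> gag_energy (?n + \<beta> * p) p f < \<infinity> \<and> (\<forall>k. gag_energy (?n + \<beta> * p) p (fk k) < \<infinity>)" if "\<beta> \<noteq> 0"
  proof -
    have \<beta>: "0 < \<beta>" using that assms(12) by simp
    obtain j0 Ce where E: "degree_energy \<Omega> R \<alpha> H ((lborel :: (real^'n) measure) \<Otimes>\<^sub>M (lborel :: (real^'n) measure))
     (gag_kernel (?n + \<beta> * p)) fst snd 1 p \<beta> d' Ce ((2 * (2 * ?n + 1)) ^ CARD('n)) j0"
      using degree_energy_gag[OF assms(3) d' p \<beta> \<beta>1] by blast
    interpret gag: degree_energy \<Omega> R \<alpha> H "(lborel :: (real^'n) measure) \<Otimes>\<^sub>M (lborel :: (real^'n) measure)"
      "gag_kernel (?n + \<beta> * p)" fst snd 1 p \<beta> d' Ce "(2 * (2 * ?n + 1)) ^ CARD('n)" j0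
      by (rule E)
    have "(\<lambda>k. gag.En (\<lambda>y. fk k y - f y)) \<longlonglongrightarrow> 0"
      by (rule gag.En_converges[OF Vk(1) V(1) _ limk(1) lim(1) fm(2,1)]) (rule unif)
    then show ?thesis
      using gag.En_finite[OF V(1) lim(1) fm(1)] gag.En_finite[OF Vk(1) limk(1) fm(2)]
      by (simp add: gag.En_def gag_energy_def)
  qed
  have p': "0 < 1 / p" using p by simp
  have conv: "(\<lambda>k. sobolev_norm \<beta> p (\<lambda>x. ?gk k x - ?g x)) \<longlonglongrightarrow> 0"
  proof (cases "\<beta> = 0")
    case True
    then show ?thesis
      using ennreal_rpow_tendsto_0[OF lpE(1) p'] by (simp add: sobolev_norm_def Lp[OF diff])
  next
    case False
    then have "(\<lambda>k. ennreal_rpow (lp_energy p (\<lambda>y. fk k y - f y)) (1 / p)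
        + ennreal_rpow (gag_energy (?n + \<beta> * p) p (\<lambda>y. fk k y - f y)) (1 / p)) \<longlonglongrightarrow> 0 + 0"
      using gagE by (intro tendsto_add ennreal_rpow_tendsto_0 lpE(1) p') auto
    then show ?thesis using False by (simp add: sobolev_norm_def Lp[OF diff] Gag[OF diff dm])
  qed
  have space: "g \<in> sobolev_space \<beta> p"
    if "AE y in lborel. g y = f y" "f \<in> borel_measurable borel" "lp_energy p f < \<infinity>"
      "\<beta> \<noteq> 0 \<Longrightarrow> gag_energy (?n + \<beta> * p) p f < \<infinity>" for g f :: "real^'n \<Rightarrow> real"
    using that ennreal_rpow_finite[of "lp_energy p f" "1/p"] ennreal_rpow_finite[of "gag_energy (?n + \<beta> * p) p f" "1/p"]
    by (auto simp: sobolev_space_def sobolev_norm_def Lp[OF that(1)] Gag[OF that(1,2)]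
        intro: borel_measurable_lebesgue_AE[OF that(1,2)])
  show ?thesis
    unfolding sobolev_tendsto_def
    using conv space[OF lim(2) fm(1) lpE(2)] space[OF limk(2) fm(2) lpE(3)] gagE by auto
qed

end
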